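(* Assume that $K$ is injective with dense range; that there exists an injective operator $A\in\mathcal{L}(\mathcal{Y})$ with $\lim_{m\to\infty}P_m^*P_my=Ay$ for all $y\in\mathcal{Y}$; that the errors satisfy either (1) the random variables $(\delta_{ij}^{(m)})_{i,j,m\in\mathbb{N}}$ are i.i.d. with zero mean and bounded variance, or (2) there are $C_d\in\mathbb{R}$ and $p>1$ such that for all $m\in\mathbb{N}$ the random variables $(\delta_{ij}^{(m)})_{i,j\in\mathbb{N}}$ are i.i.d. with zero mean and $\mathbb{E}|\delta^{(m)}_{ij}|^{2p}\big/\big(\mathbb{E}(\delta_{ij}^{(m)})^2\big)^p\le C_d$; and that $(F_\alpha)_{\alpha>0}$ satisfies the filter conditions given in the context with a qualification $\nu_0>1$. Then, with $\alpha_{m,n}$ the output of the discrepancy principle described in the context, $$\lim_{\substack{m,n\to\infty\\ m/n\to0}}\mathbb{P}\left(\left\|R^{(m)}_{\alpha_{m,n}}\bar Y_n^{(m)}-K^+\hat y\right\|\ge\varepsilon\right)=0$$ for all $\varepsilon>0$.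
   Context: $\mathcal{X},\mathcal{Y}$ are real Hilbert spaces, $K:\mathcal{X}\to\mathcal{Y}$ is a compact linear operator, $K^+$ is its generalised (Moore-Penrose) inverse with domain $\mathcal{D}(K^+)$, and $\hat y\in\mathcal{D}(K^+)$. Discretisation: for each $m\in\mathbb{N}$, $l^{(m)}_1,\dots,l_m^{(m)}$ are continuous linear functionals on $\mathcal{Y}$ with $\|l_1^{(m)}\|=\dots=\|l_m^{(m)}\|$, and $P_m:\mathcal{Y}\to\mathbb{R}^m$, $P_my=(l_1^{(m)}(y),\dots,l_m^{(m)}(y))^T$; it is assumed that $P_mP_m^*$ is bijective. Measurements: $Y^{(m)}_{ij}=l_j^{(m)}(\hat y)+\delta_{ij}^{(m)}$ and $\bar Y_n^{(m)}=\frac1n\sum_{i=1}^n(Y^{(m)}_{i1},\dots,Y^{(m)}_{im})^T$. Estimated noise level: $\delta^{est}_{m,n}=\sqrt{\frac mn s_{m,n}^2}$ with $s^2_{m,n}=\frac1m\sum_{j=1}^m\frac1{n-1}\sum_{i=1}^n\big(Y^{(m)}_{ij}-\frac1n\sum_{l=1}^nY^{(m)}_{lj}\big)^2$. Filter conditions: $(F_\alpha)_{\alpha>0}$ are piecewise continuous real-valued functions on $[0,\|K\|^2]$ such that: (i) $\lim_{\alpha\to0}\sup_{\varepsilon\le\lambda\le\|K\|^2}|F_\alpha(\lambda)-1/\lambda|=0$ for all $\varepsilon>0$; (ii) there is $C_R\in\mathbb{R}$ with $\lambda|F_\alpha(\lambda)|\le C_R$ for all $\lambda\in(0,\|K\|^2]$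 and $\alpha>0$; (iii) it has qualification $\nu_0\ge0$, i.e. $\nu_0$ is maximal such that for all $0\le\nu\le\nu_0$ there exists a constant $C_\nu\in\mathbb{R}$ with $\sup_{\lambda\in(0,\|K\|^2]}\lambda^{\nu/2}|1-F_\alpha(\lambda)\lambda|\le C_\nu\alpha^{\nu/2}$, where for $\nu=0$ the constant $C_0$ is assumed to be known; (iv) there is $C_F\in\mathbb{R}$ with $|F_\alpha(\lambda)|\le C_F/\alpha$ for all $\alpha>0$ and $\lambda\in(0,\|K\|^2]$. Regularisation: $R^{(m)}_\alpha:=F_\alpha\big((P_mK)^*P_mK\big)(P_mK)^*$. Discrepancy principle: fix $\tau>C_0$ and $q\in(0,1)$. Starting from $k=0$, increase $k$ by one as long as $\|P_mKR^{(m)}_{q^k}\bar Y_n^{(m)}-\bar Y_n^{(m)}\|>\tau\,\delta^{est}_{m,n}$; then set $\alpha_{m,n}=q^k$ for the resulting $k$, i.e. for the smallest $k\in\{0,1,2,\dots\}$ with $\|P_mKR^{(m)}_{q^k}\bar Y_n^{(m)}-\bar Y_n^{(m)}\|\le\tau\,\delta^{est}_{m,n}$.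
   Formalization: The filter conditions are assumed up to max(‖K‖², sup_m‖P_mK‖²), so that F_α is defined on all the spectra; the error variance is assumed positive and, in case (2), bounded uniformly in m, since otherwise m/n→0 does not make the noise vanish and the claim fails. *)

theory Defs
  imports "HOL-Probability.Probability"
begin

section \<open>Operators on Hilbert spaces\<close>

definition compact_operator ::
  "('x::real_normed_vector \<Rightarrow>\<^sub>L 'y::real_normed_vector) \<Rightarrow> bool" where
  "compact_operator K \<longleftrightarrow> (\<forall>B. bounded B \<longrightarrow> compact (closure (blinfun_apply K ` B)))"

text \<open>The generalised inverse of \<open>K\<close> is the linear extension of the inverse of the restriction of
  \<open>K\<close> to the orthogonal complement of its kernel, with domain the range of \<open>K\<close> plus the
  orthogonal complement of the range, and vanishing on the latter summand.\<close>

definition mp_domain :: "('x::real_inner \<Rightarrow>\<^sub>L 'y::real_inner) \<Rightarrow> 'y set" where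
  "mp_domain K = {u + v | u v. u \<in> range (blinfun_apply K) \<and> v \<in> (range (blinfun_apply K))\<^sup>\<bottom>}"

definition mp_inverse :: "('x::real_inner \<Rightarrow>\<^sub>L 'y::real_inner) \<Rightarrow> 'y \<Rightarrow> 'x" where
  "mp_inverse K y = (THE x. x \<in> {z. blinfun_apply K z = 0}\<^sup>\<bottom> \<and>
                            y - blinfun_apply K x \<in> (range (blinfun_apply K))\<^sup>\<bottom>)"

definition orth_proj :: "'x::real_inner set \<Rightarrow> 'x \<Rightarrow> 'x" where
  "orth_proj S x = (THE p. p \<in> S \<and> x - p \<in> S\<^sup>\<bottom>)"

text \<open>Functional calculus \<open>f(T)\<close> through the spectral decomposition of a compact self-adjoint
  operator \<open>T\<close>. It is applied below to finite-rank operators only, for which the sum is finite.\<close>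

definition spectral_calculus ::
  "(real \<Rightarrow> real) \<Rightarrow> ('x::real_inner \<Rightarrow> 'x) \<Rightarrow> 'x \<Rightarrow> 'x" where
  "spectral_calculus f T x =
     (\<Sum>\<^sub>\<infinity>t\<in>{t. \<exists>v. v \<noteq> 0 \<and> T v = t *\<^sub>R v}. f t *\<^sub>R orth_proj {v. T v = t *\<^sub>R v} x)"


section \<open>Discretisation\<close>

text \<open>As \<open>m\<close> varies, the space \<open>\<real>\<^sup>m\<close> is represented by the functions on \<open>{1..m}\<close>, i.e. by the
  extensional functions \<open>{1..m} \<rightarrow>\<^sub>E UNIV\<close>; its Euclidean norm is \<open>L2_set v {1..m}\<close>.\<close>

definition meas_op ::
  "(nat \<Rightarrow> nat \<Rightarrow> 'y::real_inner \<Rightarrow>\<^sub>L real) \<Rightarrow> nat \<Rightarrow> 'y \<Rightarrow> (nat \<Rightarrow> real)" where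
  "meas_op l m y = (\<lambda>j\<in>{1..m}. blinfun_apply (l m j) y)"

text \<open>The Hilbert space adjoint of an operator \<open>B\<close> with values in \<open>\<real>\<^sup>m\<close>.\<close>

definition adjoint_Rm ::
  "nat \<Rightarrow> ('h::real_inner \<Rightarrow> (nat \<Rightarrow> real)) \<Rightarrow> (nat \<Rightarrow> real) \<Rightarrow> 'h" where
  "adjoint_Rm m B v = (THE h. \<forall>x. x \<bullet> h = (\<Sum>j=1..m. B x j * v j))"

definition disc_op ::
  "('x::real_inner \<Rightarrow>\<^sub>L 'y::real_inner) \<Rightarrow> (nat \<Rightarrow> nat \<Rightarrow> 'y \<Rightarrow>\<^sub>L real) \<Rightarrow> nat
    \<Rightarrow> 'x \<Rightarrow> (nat \<Rightarrow> real)" where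
  "disc_op K l m x = meas_op l m (blinfun_apply K x)"

definition disc_gram ::
  "('x::real_inner \<Rightarrow>\<^sub>L 'y::real_inner) \<Rightarrow> (nat \<Rightarrow> nat \<Rightarrow> 'y \<Rightarrow>\<^sub>L real) \<Rightarrow> nat
    \<Rightarrow> 'x \<Rightarrow> 'x" where
  "disc_gram K l m x = adjoint_Rm m (disc_op K l m) (disc_op K l m x)"

text \<open>The operators \<open>F\<^sub>\<alpha>((P\<^sub>m K)\<^sup>* P\<^sub>m K)\<close> only make sense if \<open>F\<^sub>\<alpha>\<close> is defined on the spectra of all
  the \<open>(P\<^sub>m K)\<^sup>* P\<^sub>m K\<close>, which lie in \<open>[0, \<parallel>P\<^sub>m K\<parallel>\<^sup>2]\<close>. The filters therefore live on \<open>[0, \<Lambda>]\<close>, where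
  \<open>\<Lambda>\<close> is the maximum of \<open>\<parallel>K\<parallel>\<^sup>2\<close> and of the \<open>\<parallel>P\<^sub>m K\<parallel>\<^sup>2 = \<parallel>(P\<^sub>m K)\<^sup>* P\<^sub>m K\<parallel>\<close>. This is the interval
  \<open>[0, \<parallel>K\<parallel>\<^sup>2]\<close> whenever the spectra are contained in it. The supremum is finite if \<open>P\<^sub>m\<^sup>* P\<^sub>m\<close>
  converges pointwise, by the uniform boundedness principle.\<close>

definition spectral_bound ::
  "('x::real_inner \<Rightarrow>\<^sub>L 'y::real_inner) \<Rightarrow> (nat \<Rightarrow> nat \<Rightarrow> 'y \<Rightarrow>\<^sub>L real) \<Rightarrow> real" where
  "spectral_bound K l = max ((norm K)\<^sup>2) (SUP m\<in>{1..}. onorm (disc_gram K l m))"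


section \<open>Filters and regularisation\<close>

definition piecewise_continuous :: "real \<Rightarrow> real \<Rightarrow> (real \<Rightarrow> real) \<Rightarrow> bool" where
  "piecewise_continuous a b f \<longleftrightarrow>
     (\<exists>S. finite S \<and> continuous_on ({a..b} - S) f) \<and>
     (\<forall>x\<in>{a..<b}. \<exists>L. (f \<longlongrightarrow> L) (at_right x)) \<and>
     (\<forall>x\<in>{a<..b}. \<exists>L. (f \<longlongrightarrow> L) (at_left x))"

definition qualification_order :: "real \<Rightarrow> (real \<Rightarrow> real \<Rightarrow> real) \<Rightarrow> real \<Rightarrow> bool" where
  "qualification_order \<Lambda> F \<nu> \<longleftrightarrow>
     (\<exists>C. \<forall>\<alpha>>0. \<forall>t\<in>{0<..\<Lambda>}. t powr (\<nu>/2) * \<bar>1 - F \<alpha> t * t\<bar> \<le> C * \<alpha> powr (\<nu>/2))"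

text \<open>The qualification may be infinite, as it is for instance for spectral cut-off.\<close>

definition has_qualification :: "real \<Rightarrow> (real \<Rightarrow> real \<Rightarrow> real) \<Rightarrow> ereal \<Rightarrow> bool" where
  "has_qualification \<Lambda> F \<nu>0 \<longleftrightarrow>
     0 \<le> \<nu>0 \<and>
     (\<forall>\<nu>\<ge>0. ereal \<nu> \<le> \<nu>0 \<longrightarrow> qualification_order \<Lambda> F \<nu>) \<and>
     (\<forall>\<mu>. (\<forall>\<nu>\<ge>0. ereal \<nu> \<le> \<mu> \<longrightarrow> qualification_order \<Lambda> F \<nu>) \<longrightarrow> \<mu> \<le> \<nu>0)"

definition regularising_filter ::
  "real \<Rightarrow> (real \<Rightarrow> real \<Rightarrow> real) \<Rightarrow> ereal \<Rightarrow> real \<Rightarrow> bool" where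
  "regularising_filter \<Lambda> F \<nu>0 C0 \<longleftrightarrow>
     (\<forall>\<alpha>>0. piecewise_continuous 0 \<Lambda> (F \<alpha>)) \<and>
     (\<forall>\<epsilon>>0. uniform_limit {\<epsilon>..\<Lambda>} F (\<lambda>t. 1 / t) (at_right 0)) \<and>
     (\<exists>CR. \<forall>\<alpha>>0. \<forall>t\<in>{0<..\<Lambda>}. t * \<bar>F \<alpha> t\<bar> \<le> CR) \<and>
     has_qualification \<Lambda> F \<nu>0 \<and>
     (\<forall>\<alpha>>0. \<forall>t\<in>{0<..\<Lambda>}. \<bar>1 - F \<alpha> t * t\<bar> \<le> C0) \<and>
     (\<exists>CF. \<forall>\<alpha>>0. \<forall>t\<in>{0<..\<Lambda>}. \<bar>F \<alpha> t\<bar> \<le> CF / \<alpha>)"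

definition reg_op ::
  "('x::real_inner \<Rightarrow>\<^sub>L 'y::real_inner) \<Rightarrow> (nat \<Rightarrow> nat \<Rightarrow> 'y \<Rightarrow>\<^sub>L real)
    \<Rightarrow> (real \<Rightarrow> real \<Rightarrow> real) \<Rightarrow> nat \<Rightarrow> real \<Rightarrow> (nat \<Rightarrow> real) \<Rightarrow> 'x" where
  "reg_op K l F m \<alpha> v =
     spectral_calculus (F \<alpha>) (disc_gram K l m) (adjoint_Rm m (disc_op K l m) v)"


section \<open>Measurements and errors\<close>

text \<open>\<open>\<delta> m i j \<omega>\<close> is the error of the \<open>i\<close>-th repetition of the \<open>j\<close>-th measurement at
  discretisation level \<open>m\<close>. All three indices are positive.\<close>

definition obs ::
  "(nat \<Rightarrow> nat \<Rightarrow> 'y::real_inner \<Rightarrow>\<^sub>L real) \<Rightarrow> 'y \<Rightarrow> (nat \<Rightarrow> nat \<Rightarrow> nat \<Rightarrow> 'w \<Rightarrow> real)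
    \<Rightarrow> nat \<Rightarrow> nat \<Rightarrow> nat \<Rightarrow> 'w \<Rightarrow> real" where
  "obs l y \<delta> m i j \<omega> = blinfun_apply (l m j) y + \<delta> m i j \<omega>"

definition obs_mean ::
  "(nat \<Rightarrow> nat \<Rightarrow> 'y::real_inner \<Rightarrow>\<^sub>L real) \<Rightarrow> 'y \<Rightarrow> (nat \<Rightarrow> nat \<Rightarrow> nat \<Rightarrow> 'w \<Rightarrow> real)
    \<Rightarrow> nat \<Rightarrow> nat \<Rightarrow> 'w \<Rightarrow> (nat \<Rightarrow> real)" where
  "obs_mean l y \<delta> m n \<omega> = (\<lambda>j\<in>{1..m}. 1 / real n * (\<Sum>i=1..n. obs l y \<delta> m i j \<omega>))"

definition sample_var ::
  "(nat \<Rightarrow> nat \<Rightarrow> 'y::real_inner \<Rightarrow>\<^sub>L real) \<Rightarrow> 'y \<Rightarrow> (nat \<Rightarrow> nat \<Rightarrow> nat \<Rightarrow> 'w \<Rightarrow> real)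
    \<Rightarrow> nat \<Rightarrow> nat \<Rightarrow> 'w \<Rightarrow> real" where
  "sample_var l y \<delta> m n \<omega> =
     1 / real m * (\<Sum>j=1..m. 1 / (real n - 1) *
       (\<Sum>i=1..n. (obs l y \<delta> m i j \<omega> - 1 / real n * (\<Sum>k=1..n. obs l y \<delta> m k j \<omega>))\<^sup>2))"

definition noise_est ::
  "(nat \<Rightarrow> nat \<Rightarrow> 'y::real_inner \<Rightarrow>\<^sub>L real) \<Rightarrow> 'y \<Rightarrow> (nat \<Rightarrow> nat \<Rightarrow> nat \<Rightarrow> 'w \<Rightarrow> real)
    \<Rightarrow> nat \<Rightarrow> nat \<Rightarrow> 'w \<Rightarrow> real" where
  "noise_est l y \<delta> m n \<omega> = sqrt (real m / real n * sample_var l y \<delta> m n \<omega>)"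

definition (in prob_space) iid_vars :: "('i \<Rightarrow> 'a \<Rightarrow> real) \<Rightarrow> 'i set \<Rightarrow> bool" where
  "iid_vars X I \<longleftrightarrow>
     indep_vars (\<lambda>_. borel) X I \<and>
     (\<forall>i\<in>I. \<forall>j\<in>I. distr M borel (X i) = distr M borel (X j))"

text \<open>In both error models the variance is required to be positive: for errors that vanish almost
  surely the estimated noise level is \<open>0\<close> and the discrepancy principle need not terminate (and
  the quotient in the second model is not defined).\<close>

definition (in prob_space) errors_iid :: "(nat \<Rightarrow> nat \<Rightarrow> nat \<Rightarrow> 'a \<Rightarrow> real) \<Rightarrow> bool" where
  "errors_iid \<delta> \<longleftrightarrow>
     iid_vars (\<lambda>(m, i, j). \<delta> m i j) ({1..} \<times> {1..} \<times> {1..}) \<and>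
     (\<forall>m\<ge>1. \<forall>i\<ge>1. \<forall>j\<ge>1.
        integrable M (\<delta> m i j) \<and> expectation (\<delta> m i j) = 0 \<and>
        integrable M (\<lambda>\<omega>. (\<delta> m i j \<omega>)\<^sup>2) \<and> variance (\<delta> m i j) > 0)"

text \<open>In the second model the distribution may depend on \<open>m\<close>. The bound on the moment quotient is
  invariant under scaling, so it does not prevent the variance from growing with \<open>m\<close>, in which
  case \<open>m/n \<rightarrow> 0\<close> would not force the noise to vanish. As in the first model the variance is
  bounded, here uniformly in \<open>m\<close>.\<close>

definition (in prob_space) errors_rowwise_iid ::
  "(nat \<Rightarrow> nat \<Rightarrow> nat \<Rightarrow> 'a \<Rightarrow> real) \<Rightarrow> bool" where
  "errors_rowwise_iid \<delta> \<longleftrightarrow>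
     (\<exists>Cd p V. p > 1 \<and>
       (\<forall>m\<ge>1. iid_vars (\<lambda>(i, j). \<delta> m i j) ({1..} \<times> {1..}) \<and>
         (\<forall>i\<ge>1. \<forall>j\<ge>1.
            integrable M (\<delta> m i j) \<and> expectation (\<delta> m i j) = 0 \<and>
            integrable M (\<lambda>\<omega>. \<bar>\<delta> m i j \<omega>\<bar> powr (2 * p)) \<and>
            0 < variance (\<delta> m i j) \<and> variance (\<delta> m i j) \<le> V \<and>
            expectation (\<lambda>\<omega>. \<bar>\<delta> m i j \<omega>\<bar> powr (2 * p))
              / (expectation (\<lambda>\<omega>. (\<delta> m i j \<omega>)\<^sup>2)) powr p \<le> Cd)))"


section \<open>Discrepancy principle\<close>

text \<open>The value is unspecified if the principle does not terminate.\<close>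

definition dp_alpha ::
  "('x::real_inner \<Rightarrow>\<^sub>L 'y::real_inner) \<Rightarrow> (nat \<Rightarrow> nat \<Rightarrow> 'y \<Rightarrow>\<^sub>L real)
    \<Rightarrow> (real \<Rightarrow> real \<Rightarrow> real) \<Rightarrow> real \<Rightarrow> real \<Rightarrow> 'y \<Rightarrow> (nat \<Rightarrow> nat \<Rightarrow> nat \<Rightarrow> 'w \<Rightarrow> real)
    \<Rightarrow> nat \<Rightarrow> nat \<Rightarrow> 'w \<Rightarrow> real" where
  "dp_alpha K l F \<tau> q y \<delta> m n \<omega> =
     q ^ (LEAST k. L2_set (\<lambda>j. disc_op K l m (reg_op K l F m (q ^ k) (obs_mean l y \<delta> m n \<omega>)) j
                                - obs_mean l y \<delta> m n \<omega> j) {1..m}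
                    \<le> \<tau> * noise_est l y \<delta> m n \<omega>)"

text \<open>The filter on pairs \<open>(m, n)\<close> describing \<open>m, n \<rightarrow> \<infinity>\<close> with \<open>m / n \<rightarrow> 0\<close>.\<close>

definition joint_limit :: "(nat \<times> nat) filter" where
  "joint_limit = inf (sequentially \<times>\<^sub>F sequentially)
                     (filtercomap (\<lambda>(m, n). real m / real n) (nhds 0))"

end

theory Submission
  imports Defs
begin

text \<open>Let \<open>B = P\<^sub>m K\<close> and \<open>T\<^sub>m = B\<^sup>* B = K\<^sup>* P\<^sub>m\<^sup>* P\<^sub>m K\<close>. Then \<open>T\<^sub>m\<close> converges pointwise to \<open>T = K\<^sup>* A K\<close>, which
  is injective and self-adjoint, so its range is dense and the solution can be written as
  \<open>x = T\<^sub>m w + e\<close> with a fixed \<open>w\<close> and an \<open>e\<close> that is small uniformly in \<open>m\<close>. With the singular value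
  decomposition of \<open>B\<close>, the qualification above 1 makes the residual of exact data
  \<open>o(\<surd>\<alpha>) + O(\<surd>\<alpha> \<parallel>e\<parallel>)\<close>. If the noise \<open>\<xi>\<close> satisfies \<open>C\<^sub>0 \<parallel>\<xi>\<parallel> \<le> \<tau>' d\<close> with \<open>\<tau>' < \<tau>\<close> for the noise level
  \<open>d\<close>, the discrepancy principle stops at an \<open>\<alpha>\<close> for which the exact residual is \<open>O(d)\<close>, whereas at
  \<open>\<alpha> / q\<close> it is at least \<open>(\<tau> - \<tau>') d\<close>. The former makes the approximation error small by
  interpolation, the latter makes \<open>d / \<surd>\<alpha>\<close> and hence the propagated noise small.

  That \<open>C\<^sub>0 \<parallel>\<xi>\<parallel> \<le> \<tau>' d\<close> holds with high probability for the estimated noise level follows because both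
  \<open>\<parallel>\<xi>\<parallel>\<^sup>2\<close> and \<open>d\<^sup>2\<close> are close to \<open>m/n\<close> times the variance: the mixed products of the errors are orthogonal,
  and their squares obey a weak law of large numbers by uniform integrability.\<close>

section \<open>Hilbert spaces\<close>

text \<open>\<open>T\<^sub>m\<close> converges only pointwise, so eigenvectors of different levels
  cannot be compared. Every spectral argument is therefore made at a fixed level, with constants
  independent of the level, and the limit acts on the single vector \<open>w\<close>. The order of
  choices makes this work: the size of \<open>e\<close> is fixed by \<epsilon> and the constants,
  then \<open>w\<close> is found by density, and only then are the level and the noise threshold
  chosen, since both depend on \<open>w\<close>.

  The gap between \<open>C\<^sub>0\<close> and \<tau> serves twice. With an intermediate
  \<open>\<tau>1\<close>, the part from \<open>C\<^sub>0\<close> to \<open>\<tau>1\<close> pays for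
  the fluctuation of the estimated noise level, and the part from \<open>\<tau>1\<close> to \<tau>
  gives the lower bound for the residual at \<alpha> / q. There \<nu> > 1 is essential: dividing by
  the square root of the parameter leaves the positive power (\<nu> - 1) / 2. The deterministic
  estimate holds for every noise level and noise vector, so it applies outcome by outcome to a level
  that itself depends on the data.\<close>

lemma parallelogram_law:
  fixes a b :: "'a::real_inner"
  shows "(norm (a + b))\<^sup>2 + (norm (a - b))\<^sup>2 = 2 * (norm a)\<^sup>2 + 2 * (norm b)\<^sup>2"
  by (simp add: power2_norm_eq_inner inner_add inner_diff inner_commute)

text \<open>A minimising sequence is Cauchy: the midpoint of two members lies in \<open>S\<close>,
  hence is no closer to \<open>x\<close> than \<open>d\<close>, and the parallelogram law bounds
  their distance by how far each exceeds \<open>d\<close>.\<close>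

lemma closed_subspace_nearest_point:
  fixes S :: "'a::{real_inner,complete_space} set"
  assumes S: "subspace S" "closed S"
  obtains p where "p \<in> S" "\<And>s. s \<in> S \<Longrightarrow> norm (x - p) \<le> norm (x - s)"
proof -
  have ne: "S \<noteq> {}" using subspace_0[OF S(1)] by auto
  define d where "d = infdist x S"
  have d0: "0 \<le> d" by (simp add: d_def infdist_nonneg)
  have dle: "d \<le> norm (x - s)" if "s \<in> S" for s
    using infdist_le[OF that, of x] by (simp add: d_def dist_norm)
  have "\<exists>p\<in>S. norm (x - p) < d + 1 / real (Suc n)" for n
  proof (rule ccontr)
    assume "\<not> ?thesis"
    then have "d + 1 / real (Suc n) \<le> infdist x S"
      unfolding infdist_notempty[OF ne] by (intro cINF_greatest ne) (auto simp: dist_norm not_less)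
    then show False by (simp add: d_def)
  qed
  then obtain p where p: "\<And>n. p n \<in> S" "\<And>n. norm (x - p n) < d + 1 / real (Suc n)"
    by metis
  have lim: "(\<lambda>n. norm (x - p n)) \<longlonglongrightarrow> d"
  proof (rule tendsto_sandwich)
    show "(\<lambda>n. d) \<longlonglongrightarrow> d" by simp
    show "(\<lambda>n. d + 1 / real (Suc n)) \<longlonglongrightarrow> d"
      using tendsto_add[OF tendsto_const[of d] LIMSEQ_inverse_real_of_nat]
      by (simp add: inverse_eq_divide)
  qed (use dle p(1) less_imp_le[OF p(2)] in \<open>auto simp del: of_nat_Suc\<close>)
  have sq: "(norm (p i - p j))\<^sup>2 \<le> 2 * ((norm (x - p i))\<^sup>2 - d\<^sup>2) + 2 * ((norm (x - p j))\<^sup>2 - d\<^sup>2)" for i j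
  proof -
    have "(1/2) *\<^sub>R (p i + p j) \<in> S"
      using S(1) p by (intro subspace_scale subspace_add)
    then have "d \<le> norm (x - (1/2) *\<^sub>R (p i + p j))" by (rule dle)
    also have "(x - (1/2) *\<^sub>R (p i + p j)) = (1/2) *\<^sub>R ((x - p i) + (x - p j))"
      by (simp add: algebra_simps flip: scaleR_left_distrib)
    finally have "2 * d \<le> norm ((x - p i) + (x - p j))" by simp
    then have "(2 * d)\<^sup>2 \<le> (norm ((x - p i) + (x - p j)))\<^sup>2" using d0 by (intro power_mono) auto
    moreover have "norm ((x - p i) - (x - p j)) = norm (p i - p j)"
      by (simp add: norm_minus_commute)
    ultimately show ?thesis using parallelogram_law[of "x - p i" "x - p j"]
      by (simp add: power_mult_distrib)
  qed
  have lim2: "(\<lambda>n. 4 * ((norm (x - p n))\<^sup>2 - d\<^sup>2)) \<longlonglongrightarrow> 0"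
    by (rule tendsto_eq_intros lim refl | simp)+
  have "Cauchy p"
  proof (rule metric_CauchyI)
    fix e :: real assume e: "0 < e"
    then have "eventually (\<lambda>n. 4 * ((norm (x - p n))\<^sup>2 - d\<^sup>2) < e\<^sup>2) sequentially"
      by (intro order_tendstoD(2)[OF lim2]) auto
    then obtain N where N: "\<And>n. n \<ge> N \<Longrightarrow> 4 * ((norm (x - p n))\<^sup>2 - d\<^sup>2) < e\<^sup>2"
      by (auto simp: eventually_sequentially)
    show "\<exists>M. \<forall>m\<ge>M. \<forall>n\<ge>M. dist (p m) (p n) < e"
    proof (intro exI allI impI)
      fix m n assume "N \<le> m" "N \<le> n"
      then have "(norm (p m - p n))\<^sup>2 < e\<^sup>2" using sq[of m n] N[of m] N[of n] by linarith
      then show "dist (p m) (p n) < e"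
        using e by (simp add: dist_norm power2_less_imp_less)
    qed
  qed
  then obtain q where q: "p \<longlonglongrightarrow> q" by (auto simp: Cauchy_convergent_iff convergent_def)
  have "q \<in> S" using closed_sequentially[OF S(2)] p(1) q by blast
  moreover have "norm (x - q) = d"
    by (rule LIMSEQ_unique[OF _ lim]) (intro tendsto_intros q)
  ultimately show ?thesis using that dle by auto
qed

text \<open>If the residual at the nearest point were not orthogonal to some \<open>s\<close>, a
  step of the optimal length \<open>t\<close> along \<open>s\<close> would shorten it.\<close>

lemma closed_subspace_projection:
  fixes S :: "'a::{real_inner,complete_space} set"
  assumes S: "subspace S" "closed S"
  obtains p where "p \<in> S" "\<And>s. s \<in> S \<Longrightarrow> (x - p) \<bullet> s = 0"
proof -
  obtain p where p: "p \<in> S" "\<And>s. s \<in> S \<Longrightarrow> norm (x - p) \<le> norm (x - s)"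
    using closed_subspace_nearest_point[OF S, of x] by blast
  have "(x - p) \<bullet> s = 0" if s: "s \<in> S" for s
  proof (rule ccontr)
    assume ne: "(x - p) \<bullet> s \<noteq> 0"
    then have s0: "s \<bullet> s > 0" by auto
    define t where "t = ((x - p) \<bullet> s) / (s \<bullet> s)"
    have "p + t *\<^sub>R s \<in> S" using S(1) p(1) s by (intro subspace_add subspace_scale)
    then have "norm (x - p) \<le> norm (x - (p + t *\<^sub>R s))" by (rule p)
    then have "(x - p) \<bullet> (x - p) \<le> (x - (p + t *\<^sub>R s)) \<bullet> (x - (p + t *\<^sub>R s))"
      by (simp add: norm_le)
    also have "\<dots> = (x - p) \<bullet> (x - p) - 2 * t * ((x - p) \<bullet> s) + t * t * (s \<bullet> s)"
      by (simp add: inner_add inner_diff inner_commute algebra_simps)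
    also have "\<dots> = (x - p) \<bullet> (x - p) - ((x - p) \<bullet> s)\<^sup>2 / (s \<bullet> s)"
      using s0 by (simp add: t_def field_simps power2_eq_square)
    finally show False using ne s0 by (simp add: divide_le_0_iff)
  qed
  then show ?thesis using that p by blast
qed

lemma subspace_closure:
  fixes S :: "'a::real_normed_vector set"
  assumes "subspace S" shows "subspace (closure S)"
proof (rule subspaceI)
  show "0 \<in> closure S" using subspace_0[OF assms] closure_subset by blast
next
  fix x y assume "x \<in> closure S" "y \<in> closure S"
  then obtain a b where "\<And>n. a n \<in> S" "a \<longlonglongrightarrow> x" "\<And>n. b n \<in> S" "b \<longlonglongrightarrow> y"
    unfolding closure_sequential by blast
  then show "x + y \<in> closure S" unfolding closure_sequential
    by (intro exI[of _ "\<lambda>n. a n + b n"]) (auto intro: tendsto_add subspace_add[OF assms])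
next
  fix c x assume "x \<in> closure S"
  then obtain a where "\<And>n. a n \<in> S" "a \<longlonglongrightarrow> x"
    unfolding closure_sequential by blast
  then show "c *\<^sub>R x \<in> closure S" unfolding closure_sequential
    by (intro exI[of _ "\<lambda>n. c *\<^sub>R a n"]) (auto intro: tendsto_scaleR subspace_scale[OF assms])
qed

lemma not_dense_imp_orthogonal_vector:
  fixes S :: "'a::{real_inner,complete_space} set"
  assumes S: "subspace S" and "closure S \<noteq> UNIV"
  obtains z where "z \<noteq> 0" "\<And>s. s \<in> S \<Longrightarrow> z \<bullet> s = 0"
proof -
  obtain x where x: "x \<notin> closure S" using assms(2) by auto
  obtain p where p: "p \<in> closure S" "\<And>s. s \<in> closure S \<Longrightarrow> (x - p) \<bullet> s = 0"
    using closed_subspace_projection[OF subspace_closure[OF S] closed_closure] by blast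
  show ?thesis
    by (rule that[of "x - p"]) (use x p closure_subset in auto)
qed

section \<open>Riesz representation and adjoints\<close>

lemma riesz_representation:
  fixes f :: "'a::{real_inner,complete_space} \<Rightarrow>\<^sub>L real"
  obtains h where "\<And>x. blinfun_apply f x = x \<bullet> h"
proof (cases "\<forall>x. blinfun_apply f x = 0")
  case True
  then show ?thesis using that[of 0] by simp
next
  case False
  then obtain x where x: "blinfun_apply f x \<noteq> 0" by blast
  define S where "S = {x. blinfun_apply f x = 0}"
  have S: "subspace S" by (auto simp: S_def subspace_def blinfun.bilinear_simps)
  have "closed S" unfolding S_def
    by (intro closed_Collect_eq continuous_intros)
  then have "closure S \<noteq> UNIV" using x by (auto simp: S_def)
  then obtain z where z: "z \<noteq> 0" "\<And>s. s \<in> S \<Longrightarrow> z \<bullet> s = 0"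
    using not_dense_imp_orthogonal_vector[OF S] by blast
  have fz: "blinfun_apply f z \<noteq> 0"
    using z(1) z(2)[of z] by (auto simp: S_def)
  show ?thesis
  proof (rule that)
    fix x
    have "blinfun_apply f z *\<^sub>R x - blinfun_apply f x *\<^sub>R z \<in> S"
      by (simp add: S_def blinfun.bilinear_simps)
    then have "z \<bullet> (blinfun_apply f z *\<^sub>R x - blinfun_apply f x *\<^sub>R z) = 0" by (rule z)
    then show "blinfun_apply f x = x \<bullet> ((blinfun_apply f z / (z \<bullet> z)) *\<^sub>R z)"
      using z(1) fz by (simp add: inner_diff inner_commute field_simps)
  qed
qed

text \<open>\<open>Ks y\<close> is the representer of \<open>x \<mapsto> K x \<bullet> y\<close>;
  linearity follows from uniqueness of representers, boundedness from
  \<open>\<parallel>Ks y\<parallel>\<^sup>2 = K (Ks y) \<bullet> y\<close>.\<close>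

lemma bounded_linear_adjoint_exists:
  fixes K :: "'x::{real_inner,complete_space} \<Rightarrow>\<^sub>L 'y::real_inner"
  obtains Ks :: "'y \<Rightarrow> 'x" where "bounded_linear Ks"
    "\<And>x y. x \<bullet> Ks y = blinfun_apply K x \<bullet> y"
proof -
  have "\<exists>h. \<forall>x. blinfun_apply K x \<bullet> y = x \<bullet> h" for y
  proof -
    have "bounded_linear (\<lambda>x. blinfun_apply K x \<bullet> y)"
      by (intro bounded_linear_inner_left_comp blinfun.bounded_linear_right)
    then show ?thesis
      using riesz_representation[of "Blinfun (\<lambda>x. blinfun_apply K x \<bullet> y)"]
      by (metis bounded_linear_Blinfun_apply)
  qed
  then obtain Ks where Ks: "\<And>x y. x \<bullet> Ks y = blinfun_apply K x \<bullet> y" by metis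
  have "bounded_linear Ks"
  proof (rule bounded_linear_intro[where K = "norm K"])
    show "Ks (x + y) = Ks x + Ks y" for x y
      using vector_eq_ldot[of "Ks (x + y)" "Ks x + Ks y"] by (simp add: Ks inner_add)
    show "Ks (r *\<^sub>R x) = r *\<^sub>R Ks x" for r x
      using vector_eq_ldot[of "Ks (r *\<^sub>R x)" "r *\<^sub>R Ks x"] by (simp add: Ks)
    show "norm (Ks y) \<le> norm y * norm K" for y
    proof (cases "Ks y = 0")
      case False
      have "norm (Ks y) * norm (Ks y) = blinfun_apply K (Ks y) \<bullet> y"
        by (simp add: flip: Ks power2_norm_eq_inner power2_eq_square)
      also have "\<dots> \<le> norm (blinfun_apply K (Ks y)) * norm y"
        by (rule norm_cauchy_schwarz)
      also have "\<dots> \<le> (norm K * norm (Ks y)) * norm y"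
        by (intro mult_right_mono norm_blinfun) auto
      finally show ?thesis using False by (simp add: field_simps)
    qed simp
  qed
  with Ks show ?thesis using that by blast
qed

section \<open>Uniform boundedness\<close>

lemma norm_le_max_add_diff:
  fixes a b :: "'a::real_normed_vector"
  shows "norm b \<le> max (norm (a + b)) (norm (a - b))"
proof -
  have "2 *\<^sub>R b = (a + b) - (a - b)" by (simp add: scaleR_2)
  then have "2 * norm b = norm ((a + b) - (a - b))" by (metis norm_scaleR abs_numeral)
  also have "\<dots> \<le> norm (a + b) + norm (a - b)" by (rule norm_triangle_ineq4)
  finally show ?thesis by linarith
qed

text \<open>The gliding hump argument of Sokal: adding a multiple of a near-norming vector with the right
  sign never decreases the image, and the later steps are too small to undo the growth.\<close>

lemma pointwise_bounded_imp_bounded: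
  fixes T :: "'i \<Rightarrow> 'a::{real_normed_vector,complete_space} \<Rightarrow>\<^sub>L 'b::real_normed_vector"
  assumes "\<And>x. bdd_above ((\<lambda>i. norm (blinfun_apply (T i) x)) ` I)"
  shows "bdd_above ((\<lambda>i. norm (T i)) ` I)"
proof (rule ccontr)
  assume unb: "\<not> ?thesis"
  \<comment> \<open>Norms growing like \<open>4 ^ n\<close> outweigh steps shrinking like
    \<open>(1/3) ^ n\<close>: the images grow like \<open>(4/3) ^ n\<close>.\<close>
  have "\<exists>i\<in>I. norm (T i) \<ge> 4 ^ n" for n :: nat
  proof (rule ccontr)
    assume "\<not> ?thesis"
    then have "bdd_above ((\<lambda>i. norm (T i)) ` I)"
      by (intro bdd_aboveI[of _ "4 ^ n"]) (auto simp: not_le intro: less_imp_le)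
    with unb show False ..
  qed
  then obtain i where i: "\<And>n. i n \<in> I" "\<And>n. norm (T (i n)) \<ge> 4 ^ n" by metis
  have "\<exists>y. norm y \<le> (1/3) ^ n \<and> norm (blinfun_apply (T (i n)) (x + y)) \<ge> (2/3) * (1/3) ^ n * norm (T (i n))"
    for x n
  proof -
    have pos: "norm (T (i n)) > 0" using i(2)[of n] by (rule less_le_trans[rotated]) simp
    have "\<exists>u. norm u = 1 \<and> norm (blinfun_apply (T (i n)) u) \<ge> (2/3) * norm (T (i n))"
    proof (rule ccontr)
      assume "\<not> ?thesis"
      then have neg: "norm (blinfun_apply (T (i n)) u) < (2/3) * norm (T (i n))" if "norm u = 1" for u
        using that by (meson not_le)
      have "norm (T (i n)) \<le> (2/3) * norm (T (i n))"
      proof (rule norm_blinfun_bound)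
        fix x show "norm (blinfun_apply (T (i n)) x) \<le> 2 / 3 * norm (T (i n)) * norm x"
        proof (cases "x = 0")
          case False
          then have "norm (blinfun_apply (T (i n)) (x /\<^sub>R norm x)) < (2/3) * norm (T (i n))"
            by (intro neg) simp
          then show ?thesis using False by (simp add: blinfun.scaleR_right field_simps)
        qed (use pos in auto)
      qed (use pos in auto)
      then show False using pos by simp
    qed
    then obtain u where u: "norm u = 1" "norm (blinfun_apply (T (i n)) u) \<ge> (2/3) * norm (T (i n))" by blast
    define b where "b = (1/3) ^ n *\<^sub>R u"
    have nb: "norm b = (1/3) ^ n" by (simp add: b_def u(1))
    have "(2/3) * (1/3) ^ n * norm (T (i n)) \<le> (1/3) ^ n * norm (blinfun_apply (T (i n)) u)"
      using mult_left_mono[OF u(2), of "(1/3) ^ n"] by (simp add: mult.assoc mult.left_commute)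
    also have "\<dots> = norm (blinfun_apply (T (i n)) b)" by (simp add: b_def blinfun.scaleR_right)
    also have "\<dots> \<le> max (norm (blinfun_apply (T (i n)) (x + b))) (norm (blinfun_apply (T (i n)) (x + - b)))"
      using norm_le_max_add_diff[of "blinfun_apply (T (i n)) b" "blinfun_apply (T (i n)) x"]
      by (simp add: blinfun.bilinear_simps)
    finally show ?thesis using nb unfolding le_max_iff_disj
      by (metis norm_minus_cancel order_refl)
  qed
  then have "\<forall>x n. \<exists>y. norm y \<le> (1/3) ^ n \<and>
      norm (blinfun_apply (T (i n)) (x + y)) \<ge> (2/3) * (1/3) ^ n * norm (T (i n))"
    by blast
  then obtain y where y: "\<And>x n. norm (y x n) \<le> (1/3) ^ n"
    "\<And>x n. norm (blinfun_apply (T (i n)) (x + y x n)) \<ge> (2/3) * (1/3) ^ n * norm (T (i n))"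
    unfolding choice_iff by blast
  define s where "s = rec_nat 0 (\<lambda>n a. a + y a (Suc n))"
  have s_Suc: "s (Suc n) = s n + y (s n) (Suc n)" for n by (simp add: s_def)
  have step: "norm (s (n + k) - s n) \<le> (1/2) * (1/3) ^ n * (1 - (1/3) ^ k)" for n k
  proof (induction k)
    case (Suc k)
    have "norm (s (n + Suc k) - s n) \<le> norm (s (n + k) - s n) + norm (y (s (n + k)) (Suc (n + k)))"
    proof -
      have "s (n + Suc k) - s n = (s (n + k) - s n) + y (s (n + k)) (Suc (n + k))"
        by (simp add: s_Suc)
      then show ?thesis by (metis norm_triangle_ineq)
    qed
    also have "\<dots> \<le> (1/2) * (1/3) ^ n * (1 - (1/3) ^ k) + (1/3) ^ Suc (n + k)"
      by (intro add_mono Suc y)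
    also have "\<dots> = (1/2) * (1/3) ^ n * (1 - (1/3) ^ Suc k)"
      by (simp add: power_add algebra_simps diff_divide_distrib)
    finally show ?case .
  qed simp
  have step': "norm (s m - s n) \<le> (1/2) * (1/3) ^ n" if "n \<le> m" for m n
  proof -
    have "norm (s m - s n) \<le> (1/2) * (1/3) ^ n * (1 - (1/3) ^ (m - n))"
      using step[of n "m - n"] that by simp
    also have "\<dots> \<le> (1/2) * (1/3) ^ n * 1" by (intro mult_left_mono) auto
    finally show ?thesis by simp
  qed
  have "Cauchy s"
  proof (rule CauchyI')
    fix e :: real assume "0 < e"
    then obtain N where N: "(1/3) ^ N < e" using real_arch_pow_inv[of e "1/3"] by auto
    have "norm (s m - s n) < e" if "N \<le> m" "m < n" for m n
    proof -
      have "norm (s m - s n) \<le> (1/2) * (1/3) ^ m"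
        using step'[of m n] that by (simp add: norm_minus_commute)
      also have "\<dots> \<le> 1 * (1/3) ^ N"
        using that(1) by (intro mult_mono power_decreasing) auto
      finally show ?thesis using N by simp
    qed
    then show "\<exists>M. \<forall>m\<ge>M. \<forall>n>m. dist (s m) (s n) < e" by (auto simp: dist_norm)
  qed
  then obtain x where x: "s \<longlonglongrightarrow> x" by (auto simp: Cauchy_convergent_iff convergent_def)
  have tail: "norm (x - s n) \<le> (1/2) * (1/3) ^ n" for n
  proof (rule tendsto_upperbound)
    show "(\<lambda>m. norm (s m - s n)) \<longlonglongrightarrow> norm (x - s n)" by (intro tendsto_intros x)
    show "eventually (\<lambda>m. norm (s m - s n) \<le> (1/2) * (1/3) ^ n) sequentially"
      by (rule eventually_sequentiallyI[of n]) (rule step')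
  qed simp
  \<comment> \<open>The near-norming factor 2/3 exceeds the 1/2 that the later steps, a geometric
    series, can undo; 1/6 is the difference.\<close>
  have big: "norm (blinfun_apply (T (i (Suc n))) x) \<ge> (1/6) * (4/3) ^ Suc n" for n
  proof -
    let ?T = "T (i (Suc n))"
    have "(2/3) * (1/3) ^ Suc n * norm ?T \<le> norm (blinfun_apply ?T (s (Suc n)))"
      using y(2) unfolding s_Suc .
    also have "\<dots> \<le> norm (blinfun_apply ?T x) + norm (blinfun_apply ?T (x - s (Suc n)))"
      using norm_triangle_ineq4[of "blinfun_apply ?T x" "blinfun_apply ?T (x - s (Suc n))"]
      by (simp add: blinfun.diff_right)
    also have "norm (blinfun_apply ?T (x - s (Suc n))) \<le> norm ?T * ((1/2) * (1/3) ^ Suc n)"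
      by (rule order.trans[OF norm_blinfun]) (intro mult_left_mono tail norm_ge_zero)
    finally have "(1/6) * ((1/3) ^ Suc n * norm ?T) \<le> norm (blinfun_apply ?T x)"
      by (simp add: algebra_simps)
    moreover have "(1/3) ^ Suc n * 4 ^ Suc n \<le> (1/3) ^ Suc n * norm ?T"
      by (intro mult_left_mono i) auto
    moreover have "(1/3) ^ Suc n * 4 ^ Suc n = (4/3 :: real) ^ Suc n"
      by (simp flip: power_mult_distrib)
    ultimately show ?thesis by linarith
  qed
  obtain C where C: "\<And>j. j \<in> I \<Longrightarrow> norm (blinfun_apply (T j) x) \<le> C"
    using assms[of x] by (auto simp: bdd_above_def)
  obtain n where "6 * \<bar>C\<bar> < (4/3 :: real) ^ n" using real_arch_pow[of "4/3"] by auto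
  then have "(4/3 :: real) ^ Suc n > 6 * \<bar>C\<bar>"
    by (smt (verit, best) power_Suc mult_le_cancel_right1 zero_less_power divide_nonneg_nonneg le_divide_eq_1_pos)
  then show False using big[of n] C[OF i(1)[of "Suc n"]] by linarith
qed

section \<open>Spectral decomposition of frame operators\<close>

text \<open>A sum of finitely many segments. Such a set will contain the image of the unit ball
  under a finite-rank operator and supplies the compactness that the eigenvector argument needs in
  an infinite-dimensional space.\<close>

lemma compact_bounded_combinations:
  fixes h :: "'i \<Rightarrow> 'a::real_normed_vector"
  assumes "finite J"
  shows "compact {\<Sum>j\<in>J. c j *\<^sub>R h j | c. \<forall>j\<in>J. \<bar>c j\<bar> \<le> b j}"
  using assms
proof (induction J rule: finite_induct)
  case (insert i J)
  have "{\<Sum>j\<in>insert i J. c j *\<^sub>R h j | c. \<forall>j\<in>insert i J. \<bar>c j\<bar> \<le> b j}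
      = {x + y | x y. x \<in> (\<lambda>t. t *\<^sub>R h i) ` {- b i..b i}
                    \<and> y \<in> {\<Sum>j\<in>J. c j *\<^sub>R h j | c. \<forall>j\<in>J. \<bar>c j\<bar> \<le> b j}}" (is "?L = ?R")
  proof (intro equalityI subsetI)
    fix x assume "x \<in> ?L"
    then obtain c where c: "x = (\<Sum>j\<in>insert i J. c j *\<^sub>R h j)" "\<forall>j\<in>insert i J. \<bar>c j\<bar> \<le> b j" by blast
    show "x \<in> ?R"
      by (rule CollectI, rule exI[of _ "c i *\<^sub>R h i"], rule exI[of _ "\<Sum>j\<in>J. c j *\<^sub>R h j"])
        (use c insert in \<open>auto simp: abs_le_iff\<close>)
  next
    fix x assume "x \<in> ?R"
    then obtain t c where tc: "x = t *\<^sub>R h i + (\<Sum>j\<in>J. c j *\<^sub>R h j)" "t \<in> {- b i..b i}"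
      "\<forall>j\<in>J. \<bar>c j\<bar> \<le> b j" by blast
    have "(\<Sum>j\<in>J. (c(i := t)) j *\<^sub>R h j) = (\<Sum>j\<in>J. c j *\<^sub>R h j)"
      using insert by (intro sum.cong) auto
    then show "x \<in> ?L"
      by (intro CollectI exI[of _ "c(i := t)"]) (use tc insert in \<open>auto simp: abs_le_iff\<close>)
  qed
  also have "compact \<dots>"
    by (intro compact_sums insert.IH compact_continuous_image continuous_intros) simp
  finally show ?case .
qed simp

text \<open>A maximising sequence for the norm of \<open>S\<close> yields an eigenvector \<open>x\<close> of \<open>S\<^sup>2\<close> for \<open>\<parallel>S\<parallel>\<^sup>2\<close>, and
  then \<open>S x + \<parallel>S\<parallel> x\<close> is an eigenvector of \<open>S\<close>; it is nonzero because \<open>S\<close> is positive.\<close>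

lemma compact_positive_eigenvector:
  fixes S :: "'a::real_inner \<Rightarrow> 'a"
  assumes S: "bounded_linear S"
    and sym: "\<And>x y. S x \<bullet> y = x \<bullet> S y" and pos: "\<And>x. 0 \<le> S x \<bullet> x"
    and C: "compact C" "S ` cball 0 1 \<subseteq> C" and nz: "S z \<noteq> 0"
  obtains v \<mu> where "v \<noteq> 0" "\<mu> > 0" "S v = \<mu> *\<^sub>R v"
proof -
  interpret S: bounded_linear S by fact
  define \<mu> where "\<mu> = onorm S"
  have \<mu>: "\<mu> > 0" using onorm_pos_lt[OF S] nz by (auto simp: \<mu>_def)
  have le: "norm (S x) \<le> \<mu> * norm x" for x unfolding \<mu>_def by (rule onorm[OF S])
  have "\<exists>x. norm x = 1 \<and> norm (S x) > \<mu> - 1 / real (Suc n)" for n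
  proof (rule ccontr)
    assume "\<not> ?thesis"
    then have neg: "norm (S x) \<le> \<mu> - 1 / real (Suc n)" if "norm x = 1" for x
      using that by (meson not_le)
    have n0: "0 \<le> \<mu> - 1 / real (Suc n)"
      using neg[of "z /\<^sub>R norm z"] nz S.zero by (metis norm_ge_zero order_trans norm_sgn sgn_div_norm)
    have "\<mu> \<le> \<mu> - 1 / real (Suc n)" unfolding \<mu>_def
    proof (rule onorm_bound)
      fix x show "norm (S x) \<le> (onorm S - 1 / real (Suc n)) * norm x"
      proof (cases "x = 0")
        case False
        then have "norm (S (x /\<^sub>R norm x)) \<le> \<mu> - 1 / real (Suc n)"
          by (intro neg) simp
        then have "norm (S x) / norm x \<le> \<mu> - 1 / real (Suc n)"
          using False by (simp add: S.scaleR divide_inverse mult.commute)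
        then show ?thesis using False by (simp only: \<mu>_def[symmetric]) (simp add: pos_divide_le_eq)
      qed (simp add: S.zero)
    qed (use n0 \<mu>_def in simp)
    then show False by simp
  qed
  then obtain x where x: "\<And>n. norm (x n) = 1" "\<And>n. norm (S (x n)) > \<mu> - 1 / real (Suc n)"
    by metis
  have lim: "(\<lambda>n. norm (S (x n))) \<longlonglongrightarrow> \<mu>"
  proof (rule tendsto_sandwich)
    show "(\<lambda>n. \<mu> - 1 / real (Suc n)) \<longlonglongrightarrow> \<mu>"
      using tendsto_diff[OF tendsto_const[of \<mu>] LIMSEQ_inverse_real_of_nat]
      by (simp add: inverse_eq_divide)
    show "(\<lambda>n. \<mu>) \<longlonglongrightarrow> \<mu>" by simp
  qed (use x(1) le[of "x _"] less_imp_le[OF x(2)] in \<open>auto simp del: of_nat_Suc\<close>)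
  \<comment> \<open>By symmetry \<open>S (S x) \<bullet> x\<close> is
    \<open>\<parallel>S x\<parallel>\<^sup>2\<close>, so near-maximality of
    \<open>\<parallel>S x\<parallel>\<close> alone makes \<open>x\<close> an approximate eigenvector
    of the square of \<open>S\<close>.\<close>
  have sq: "(norm (S (S (x n)) - \<mu>\<^sup>2 *\<^sub>R x n))\<^sup>2 \<le> \<mu>\<^sup>2 * (\<mu>\<^sup>2 - (norm (S (x n)))\<^sup>2)" for n
  proof -
    have "(norm (S (S (x n)) - \<mu>\<^sup>2 *\<^sub>R x n))\<^sup>2
        = (norm (S (S (x n))))\<^sup>2 - 2 * \<mu>\<^sup>2 * (S (S (x n)) \<bullet> x n) + \<mu>\<^sup>2 * \<mu>\<^sup>2 * (norm (x n))\<^sup>2"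
      by (simp add: power2_norm_eq_inner inner_diff inner_commute algebra_simps)
    also have "S (S (x n)) \<bullet> x n = (norm (S (x n)))\<^sup>2"
      by (simp add: sym power2_norm_eq_inner)
    also have "(norm (S (S (x n))))\<^sup>2 \<le> (\<mu> * norm (S (x n)))\<^sup>2"
      by (intro power_mono le) simp
    finally show ?thesis by (simp add: x(1) algebra_simps power2_eq_square)
  qed
  have diff0: "(\<lambda>n. S (S (x n)) - \<mu>\<^sup>2 *\<^sub>R x n) \<longlonglongrightarrow> 0"
  proof (rule tendsto_norm_zero_cancel)
    have "(\<lambda>n. \<mu>\<^sup>2 * (\<mu>\<^sup>2 - (norm (S (x n)))\<^sup>2)) \<longlonglongrightarrow> 0"
      by (rule tendsto_eq_intros lim refl | simp)+
    then have "(\<lambda>n. (norm (S (S (x n)) - \<mu>\<^sup>2 *\<^sub>R x n))\<^sup>2) \<longlonglongrightarrow> 0"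
      by (rule Lim_null_comparison[rotated]) (use sq in auto)
    then have "(\<lambda>n. sqrt ((norm (S (S (x n)) - \<mu>\<^sup>2 *\<^sub>R x n))\<^sup>2)) \<longlonglongrightarrow> sqrt 0"
      by (rule tendsto_real_sqrt)
    then show "(\<lambda>n. norm (S (S (x n)) - \<mu>\<^sup>2 *\<^sub>R x n)) \<longlonglongrightarrow> 0" by simp
  qed
  have "S (x n) \<in> C" for n using C(2) x(1)[of n] by auto
  then obtain y r where r: "strict_mono (r :: nat \<Rightarrow> nat)" "(\<lambda>n. S (x (r n))) \<longlonglongrightarrow> y"
    using C(1)[unfolded compact_def, rule_format, of "\<lambda>n. S (x n)"] by (auto simp: comp_def)
  \<comment> \<open>Compactness gives convergence of \<open>S (x (r n))\<close> only; that of
    \<open>x (r n)\<close> follows because \<open>\<mu>\<^sup>2 *\<^sub>R x (r n)\<close> is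
    asymptotically \<open>S (S (x (r n)))\<close>.\<close>
  define w where "w = (1 / \<mu>\<^sup>2) *\<^sub>R S y"
  have "(\<lambda>n. (1 / \<mu>\<^sup>2) *\<^sub>R (S (S (x (r n))) - (S (S (x (r n))) - \<mu>\<^sup>2 *\<^sub>R x (r n)))) \<longlonglongrightarrow> (1 / \<mu>\<^sup>2) *\<^sub>R (S y - 0)"
    by (intro tendsto_intros S.tendsto r(2) LIMSEQ_subseq_LIMSEQ[OF diff0 r(1), unfolded comp_def])
  then have xw: "(\<lambda>n. x (r n)) \<longlonglongrightarrow> w" using \<mu> by (simp add: w_def)
  have "(\<lambda>n. norm (x (r n))) \<longlonglongrightarrow> norm w" by (intro tendsto_intros xw)
  then have w1: "norm w = 1" by (simp add: x(1) LIMSEQ_const_iff)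
  have "(\<lambda>n. S (S (x (r n))) - \<mu>\<^sup>2 *\<^sub>R x (r n)) \<longlonglongrightarrow> S (S w) - \<mu>\<^sup>2 *\<^sub>R w"
    by (intro tendsto_intros S.tendsto xw)
  then have SS: "S (S w) = \<mu>\<^sup>2 *\<^sub>R w"
    using LIMSEQ_unique[OF LIMSEQ_subseq_LIMSEQ[OF diff0 r(1), unfolded comp_def]]
    by (metis eq_iff_diff_eq_0)
  show ?thesis
  proof (rule that[OF _ \<mu>])
    have "(S w + \<mu> *\<^sub>R w) \<bullet> w \<ge> \<mu>"
      using pos[of w] w1 by (simp add: inner_add flip: power2_norm_eq_inner)
    then show "S w + \<mu> *\<^sub>R w \<noteq> 0" using \<mu> by auto
    show "S (S w + \<mu> *\<^sub>R w) = \<mu> *\<^sub>R (S w + \<mu> *\<^sub>R w)"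
      by (simp add: S.add S.scaleR SS scaleR_right_distrib power2_eq_square)
  qed
qed

text \<open>This is \<open>B\<^sup>* B\<close> for the map \<open>B\<close> sending \<open>x\<close>
  to the family of numbers \<open>h j \<bullet> x\<close>; with Riesz representers of the
  measurements as \<open>h\<close> it is the Gram operator of the discretisation.\<close>

definition frame_op :: "'i set \<Rightarrow> ('i \<Rightarrow> 'a::real_inner) \<Rightarrow> 'a \<Rightarrow> 'a" where
  "frame_op J h x = (\<Sum>j\<in>J. (h j \<bullet> x) *\<^sub>R h j)"

lemma bounded_linear_frame_op: "bounded_linear (frame_op J h)"
  unfolding frame_op_def
  by (intro bounded_linear_sum bounded_linear_scaleR_const bounded_linear_inner_right)

lemma frame_op_inner: "frame_op J h x \<bullet> y = (\<Sum>j\<in>J. (h j \<bullet> x) * (h j \<bullet> y))"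
  by (simp add: frame_op_def inner_sum_left)

lemma frame_op_sym: "frame_op J h x \<bullet> y = x \<bullet> frame_op J h y"
  by (subst (2) inner_commute) (simp add: frame_op_inner mult.commute)

definition eigen_system :: "('a::real_inner \<Rightarrow> 'a) \<Rightarrow> 'a set \<Rightarrow> bool" where
  "eigen_system T U \<longleftrightarrow> finite U \<and> (\<forall>u\<in>U. \<forall>u'\<in>U. u \<bullet> u' = (if u = u' then 1 else 0)) \<and>
     (\<forall>u\<in>U. 0 < T u \<bullet> u \<and> T u = (T u \<bullet> u) *\<^sub>R u)"

lemma eigen_system_sum_inner:
  assumes "eigen_system T U" "u \<in> U"
  shows "(\<Sum>w\<in>U. c w *\<^sub>R w) \<bullet> u = c u"
proof -
  have "(\<Sum>w\<in>U. c w *\<^sub>R w) \<bullet> u = (\<Sum>w\<in>U. if w = u then c w else 0)"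
    unfolding inner_sum_left
    using assms by (intro sum.cong) (auto simp: eigen_system_def)
  also have "\<dots> = c u" using assms by (simp add: eigen_system_def)
  finally show ?thesis .
qed

text \<open>A system of maximal cardinality is complete: if \<open>T\<close> did not vanish on its
  orthogonal complement, the operator with the known eigenvectors projected out would be nonzero,
  positive and of finite rank, and one of its eigenvectors would enlarge the system.\<close>

lemma frame_op_spectral:
  fixes h :: "'i \<Rightarrow> 'a::real_inner"
  assumes J: "finite J"
  obtains U where "eigen_system (frame_op J h) U"
    "\<And>x. (\<And>u. u \<in> U \<Longrightarrow> u \<bullet> x = 0) \<Longrightarrow> frame_op J h x = 0"
proof -
  define T where "T = frame_op J h"
  interpret T: bounded_linear T unfolding T_def by (rule bounded_linear_frame_op)
  have Tsym: "T x \<bullet> y = x \<bullet> T y" for x y by (simp add: T_def frame_op_sym)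
  have Tpos: "0 \<le> T x \<bullet> x" for x by (simp add: T_def frame_op_inner sum_nonneg)
  \<comment> \<open>An eigenvector of a nonzero eigenvalue is a multiple of its image, hence lies in
    the span of the finitely many \<open>h j\<close>; a maximal cardinality therefore
    exists.\<close>
  have bound: "card U \<le> card (h ` J)" if U: "eigen_system T U" for U
  proof -
    have "independent U"
    proof (rule pairwise_orthogonal_independent)
      show "pairwise orthogonal U" using U by (auto simp: pairwise_def orthogonal_def eigen_system_def)
      show "0 \<notin> U" using U by (force simp: eigen_system_def)
    qed
    moreover have "U \<subseteq> span (h ` J)"
    proof
      fix u assume "u \<in> U"
      then have u: "0 < T u \<bullet> u" "T u = (T u \<bullet> u) *\<^sub>R u" using U unfolding eigen_system_def by blast+
      have "T u \<in> span (h ` J)" unfolding T_def frame_op_def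
        by (intro span_sum span_scale span_base) auto
      then have "(1 / (T u \<bullet> u)) *\<^sub>R T u \<in> span (h ` J)" by (rule span_scale)
      also have "(1 / (T u \<bullet> u)) *\<^sub>R T u = u" using u(1) by (subst u(2)) simp
      finally show "u \<in> span (h ` J)" .
    qed
    ultimately show ?thesis using independent_span_bound[of "h ` J" U] J by simp
  qed
  have "\<exists>U. eigen_system T U \<and> (\<forall>V. eigen_system T V \<longrightarrow> card V \<le> card U)"
    by (rule ex_has_greatest_nat[of _ "{}" card "Suc (card (h ` J))"])
      (use bound in \<open>auto simp: eigen_system_def le_imp_less_Suc\<close>)
  then obtain U where U: "eigen_system T U" and max: "\<And>V. eigen_system T V \<Longrightarrow> card V \<le> card U"
    by blast
  have finU: "finite U" and lam: "\<And>u. u \<in> U \<Longrightarrow> 0 < T u \<bullet> u" "\<And>u. u \<in> U \<Longrightarrow> T u = (T u \<bullet> u) *\<^sub>R u"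
    using U unfolding eigen_system_def by blast+
  define P where "P x = (\<Sum>u\<in>U. (u \<bullet> x) *\<^sub>R u)" for x
  have Pu: "(x - P x) \<bullet> u = 0" if "u \<in> U" for x u
    unfolding P_def inner_diff_left eigen_system_sum_inner[OF U that] by (simp add: inner_commute)
  have P: "bounded_linear P" unfolding P_def
    by (intro bounded_linear_sum bounded_linear_scaleR_const bounded_linear_inner_right)
  \<comment> \<open>Deflation: \<open>S\<close> agrees with \<open>T\<close> on the complement of
    \<open>U\<close> and kills \<open>U\<close>. It stays symmetric because \<open>P\<close>
    projects onto a span of eigenvectors.\<close>
  define S where "S x = T (x - P x)" for x
  have S: "bounded_linear S" unfolding S_def
    by (intro bounded_linear_compose[OF T.bounded_linear_axioms] bounded_linear_sub bounded_linear_ident P)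
  interpret S: bounded_linear S by (rule S)
  have S_eq: "S x = T x - (\<Sum>u\<in>U. ((T u \<bullet> u) * (u \<bullet> x)) *\<^sub>R u)" for x
  proof -
    have "T (P x) = (\<Sum>u\<in>U. (u \<bullet> x) *\<^sub>R T u)" by (simp add: P_def T.sum T.scaleR)
    also have "\<dots> = (\<Sum>u\<in>U. (u \<bullet> x) *\<^sub>R ((T u \<bullet> u) *\<^sub>R u))"
      by (intro sum.cong refl arg_cong2[of _ _ _ _ scaleR] lam(2))
    finally show ?thesis by (simp add: S_def T.diff mult.commute)
  qed
  have S_inner: "S x \<bullet> y = T x \<bullet> y - (\<Sum>u\<in>U. (T u \<bullet> u) * (u \<bullet> x) * (u \<bullet> y))" for x y
    by (simp add: S_eq inner_diff_left inner_sum_left)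
  have Ssym: "S x \<bullet> y = x \<bullet> S y" for x y
  proof -
    have "T x \<bullet> y = T y \<bullet> x" using Tsym[of x y] by (simp add: inner_commute)
    then have "S x \<bullet> y = S y \<bullet> x" unfolding S_inner by (simp add: mult_ac)
    then show ?thesis by (simp add: inner_commute)
  qed
  have Su: "S u = 0" if "u \<in> U" for u
  proof -
    have "P u = u" using that U unfolding P_def eigen_system_def
      by (subst sum.remove[of _ u]) (auto intro!: sum.neutral)
    then show ?thesis by (simp add: S_def T.zero)
  qed
  have SP: "S x \<bullet> P x = 0" for x
    unfolding P_def inner_sum_right by (rule sum.neutral) (simp add: Ssym Su)
  have Spos: "0 \<le> S x \<bullet> x" for x
  proof -
    have "S x \<bullet> x = T (x - P x) \<bullet> (x - P x)"
      using SP[of x] by (simp add: S_def inner_diff_right)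
    then show ?thesis using Tpos by simp
  qed
  have zero: "T x = 0" if x: "\<And>u. u \<in> U \<Longrightarrow> u \<bullet> x = 0" for x
  proof (rule ccontr)
    assume "T x \<noteq> 0"
    moreover have "S x = T x" using x by (simp add: S_eq)
    ultimately have "S x \<noteq> 0" by simp
    define C where "C = {\<Sum>j\<in>J. c j *\<^sub>R h j | c. \<forall>j\<in>J. \<bar>c j\<bar> \<le> norm (h j) * onorm (\<lambda>x. x - P x)}"
    have C: "compact C" unfolding C_def by (rule compact_bounded_combinations[OF J])
    have "S ` cball 0 1 \<subseteq> C"
    proof (intro subsetI, elim imageE)
      fix y z assume y: "y = S z" and z: "z \<in> cball 0 1"
      have bP: "bounded_linear (\<lambda>x. x - P x)" by (intro bounded_linear_sub bounded_linear_ident P)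
      have "norm (z - P z) \<le> onorm (\<lambda>x. x - P x)"
        by (rule order.trans[OF onorm[OF bP]]) (use z onorm_pos_le[OF bP] in \<open>simp add: mult_left_le\<close>)
      then have "\<bar>h j \<bullet> (z - P z)\<bar> \<le> norm (h j) * onorm (\<lambda>x. x - P x)" for j
        by (intro order.trans[OF Cauchy_Schwarz_ineq2] mult_left_mono) auto
      then show "y \<in> C" unfolding C_def y S_def T_def frame_op_def
        by (intro CollectI exI[of _ "\<lambda>j. h j \<bullet> (z - P z)"]) simp
    qed
    then obtain v \<mu> where v: "v \<noteq> 0" "\<mu> > 0" "S v = \<mu> *\<^sub>R v"
      using compact_positive_eigenvector[OF S Ssym Spos C _ \<open>S x \<noteq> 0\<close>] by blast
    have uv: "u \<bullet> v = 0" if "u \<in> U" for u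
    proof -
      have "\<mu> * (u \<bullet> v) = u \<bullet> S v" by (simp add: v(3))
      also have "\<dots> = 0" using Su[OF that] Ssym[of u v] by simp
      finally show ?thesis using v(2) by simp
    qed
    then have Tv: "T v = \<mu> *\<^sub>R v" using v(3) by (simp add: S_eq)
    define e where "e = v /\<^sub>R norm v"
    have e: "e \<bullet> e = 1" using v(1) by (simp add: e_def flip: power2_norm_eq_inner)
    have Te: "T e = \<mu> *\<^sub>R e" by (simp add: e_def T.scaleR Tv)
    have ue: "u \<bullet> e = 0" if "u \<in> U" for u using uv[OF that] by (simp add: e_def)
    have "e \<notin> U" using ue[of e] e by auto
    have "eigen_system T (insert e U)"
      unfolding eigen_system_def
    proof (intro conjI ballI)
      show "finite (insert e U)" using finU by simp
      show "u \<bullet> u' = (if u = u' then 1 else 0)" if "u \<in> insert e U" "u' \<in> insert e U" for u u'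
        using that U e ue ue[THEN trans[OF inner_commute]] \<open>e \<notin> U\<close>
        unfolding eigen_system_def by auto
      show "0 < T u \<bullet> u" if "u \<in> insert e U" for u
        using that lam(1) e v(2) by (elim insertE) (simp_all add: Te)
      show "T u = (T u \<bullet> u) *\<^sub>R u" if "u \<in> insert e U" for u
        using that
      proof (elim insertE)
        assume "u = e" then show ?thesis by (simp add: Te e)
      qed (rule lam(2))
    qed
    from max[OF this] show False using finU \<open>e \<notin> U\<close> by simp
  qed
  show ?thesis by (rule that[of U]) (use U zero T_def in auto)
qed

section \<open>Singular value decomposition and functional calculus\<close>

lemma orth_proj_eqI:
  assumes "subspace S" "p \<in> S" "\<And>y. y \<in> S \<Longrightarrow> (x - p) \<bullet> y = 0"
  shows "orth_proj S x = p"
  unfolding orth_proj_def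
proof (rule the_equality)
  show "p \<in> S \<and> x - p \<in> S\<^sup>\<bottom>"
    using assms by (auto simp: orthogonal_comp_def orthogonal_def inner_commute)
next
  fix p' assume p': "p' \<in> S \<and> x - p' \<in> S\<^sup>\<bottom>"
  then have d: "p' - p \<in> S" using assms by (auto intro: subspace_diff)
  have "(x - p) \<bullet> (p' - p) = 0" "(x - p') \<bullet> (p' - p) = 0"
    using assms(3)[OF d] p' d by (auto simp: orthogonal_comp_def orthogonal_def inner_commute)
  then have "(p' - p) \<bullet> (p' - p) = 0" by (simp add: inner_diff_left)
  then show "p' = p" by simp
qed

text \<open>The data of a singular value decomposition of the operator \<open>x \<mapsto> (h j \<bullet> x)\<^sub>j\<close>: the right
  singular vectors form \<open>U\<close>, and \<open>\<sigma> u\<close> is the square of the singular value belonging to \<open>u\<close>.\<close>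

locale frame_svd =
  fixes J :: "'i set" and h :: "'i \<Rightarrow> 'a::real_inner" and U :: "'a set"
  assumes finJ: "finite J"
    and eig: "eigen_system (frame_op J h) U"
    and frame_op_zero: "\<And>x. (\<And>u. u \<in> U \<Longrightarrow> u \<bullet> x = 0) \<Longrightarrow> frame_op J h x = 0"
begin

abbreviation T where "T \<equiv> frame_op J h"

definition \<sigma> where "\<sigma> u = T u \<bullet> u"

text \<open>\<open>coef v x\<close> is \<open>B\<^sup>* v \<bullet> x\<close>. For \<open>u\<close>
  in \<open>U\<close>, \<open>(coef v u)\<^sup>2 / \<sigma> u\<close> is the squared coefficient of
  \<open>v\<close> along the left singular vector \<open>B u / sqrt (\<sigma> u)\<close>; in this
  way left singular vectors enter without being named.\<close>

definition coef :: "('i \<Rightarrow> real) \<Rightarrow> 'a \<Rightarrow> real" where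
  "coef v x = (\<Sum>j\<in>J. v j * (h j \<bullet> x))"

text \<open>The regularised solution \<open>f (B\<^sup>* B) B\<^sup>* v\<close> in coordinates. The
  value of \<open>f\<close> at 0 never occurs, in accordance with filter estimates for positive
  arguments.\<close>

definition filt :: "(real \<Rightarrow> real) \<Rightarrow> ('i \<Rightarrow> real) \<Rightarrow> 'a" where
  "filt f v = (\<Sum>u\<in>U. (f (\<sigma> u) * coef v u) *\<^sub>R u)"

sublocale T: bounded_linear T
  by (rule bounded_linear_frame_op)

lemma finU: "finite U" and orthU: "\<And>u u'. u \<in> U \<Longrightarrow> u' \<in> U \<Longrightarrow> u \<bullet> u' = (if u = u' then 1 else 0)"
  and \<sigma>_pos: "\<And>u. u \<in> U \<Longrightarrow> 0 < \<sigma> u" and T_eig: "\<And>u. u \<in> U \<Longrightarrow> T u = \<sigma> u *\<^sub>R u"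
  using eig unfolding eigen_system_def \<sigma>_def by blast+

lemmas sum_inner = eigen_system_sum_inner[OF eig]

lemma \<sigma>_le_onorm: "u \<in> U \<Longrightarrow> \<sigma> u \<le> onorm T"
  using onorm[OF bounded_linear_frame_op, of J h u] orthU[of u u] \<sigma>_pos[of u]
  by (simp add: T_eig norm_eq_sqrt_inner)

definition proj :: "'a \<Rightarrow> 'a" where "proj x = (\<Sum>u\<in>U. (u \<bullet> x) *\<^sub>R u)"

lemma diff_proj_inner: "u \<in> U \<Longrightarrow> (x - proj x) \<bullet> u = 0"
  unfolding proj_def inner_diff_left by (simp add: sum_inner) (simp add: inner_commute)

lemma T_diff_proj: "T (x - proj x) = 0"
  by (rule frame_op_zero) (metis diff_proj_inner inner_commute)

lemma frame_inner_zero: assumes "T x = 0" "j \<in> J" shows "h j \<bullet> x = 0"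
proof -
  have "(\<Sum>j\<in>J. (h j \<bullet> x) * (h j \<bullet> x)) = 0"
    using frame_op_inner[of J h x x] assms by simp
  then show ?thesis using assms(2) finJ by (subst (asm) sum_nonneg_eq_0_iff) auto
qed

lemma T_expand: "T x = (\<Sum>u\<in>U. (\<sigma> u * (u \<bullet> x)) *\<^sub>R u)"
proof -
  have "T x = T (proj x)" using T_diff_proj[of x] by (simp add: T.diff)
  also have "\<dots> = (\<Sum>u\<in>U. (u \<bullet> x) *\<^sub>R T u)" by (simp add: proj_def T.sum T.scaleR)
  also have "\<dots> = (\<Sum>u\<in>U. (\<sigma> u * (u \<bullet> x)) *\<^sub>R u)"
    by (intro sum.cong refl) (simp add: T_eig mult.commute)
  finally show ?thesis .
qed

lemma T_inner: "u \<in> U \<Longrightarrow> T x \<bullet> u = \<sigma> u * (u \<bullet> x)"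
  unfolding T_expand by (rule sum_inner)

lemma coef_frame: "u \<in> U \<Longrightarrow> coef (\<lambda>j. h j \<bullet> x) u = \<sigma> u * (u \<bullet> x)"
  using T_inner[of u x] by (simp add: coef_def frame_op_inner)

lemma sum_frame_sq: "(\<Sum>j\<in>J. (h j \<bullet> x)\<^sup>2) = (\<Sum>u\<in>U. \<sigma> u * (u \<bullet> x)\<^sup>2)"
proof -
  have "(\<Sum>j\<in>J. (h j \<bullet> x)\<^sup>2) = T x \<bullet> x" by (simp add: frame_op_inner power2_eq_square)
  also have "\<dots> = (\<Sum>u\<in>U. \<sigma> u * (u \<bullet> x)\<^sup>2)"
    unfolding T_expand by (simp add: inner_sum_left power2_eq_square mult.assoc)
  finally show ?thesis .
qed

lemma sum_norm_sq: "(norm (\<Sum>u\<in>U. a u *\<^sub>R u))\<^sup>2 = (\<Sum>u\<in>U. (a u)\<^sup>2)"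
  unfolding power2_norm_eq_inner inner_sum_right
  by (intro sum.cong refl) (simp add: sum_inner power2_eq_square)

lemma bessel: "(\<Sum>u\<in>U. (u \<bullet> x)\<^sup>2) \<le> (norm x)\<^sup>2"
proof -
  have "(norm x)\<^sup>2 = (norm (x - proj x))\<^sup>2 + (norm (proj x))\<^sup>2"
  proof -
    have "(x - proj x) \<bullet> proj x = 0"
      by (subst (2) proj_def) (simp add: inner_sum_right diff_proj_inner)
    then show ?thesis by (simp add: power2_norm_eq_inner inner_diff inner_commute)
  qed
  then show ?thesis using sum_norm_sq[of "\<lambda>u. u \<bullet> x"] by (simp add: proj_def)
qed

text \<open>The left singular coefficients of \<open>v\<close> survive in the residual with the
  factor \<open>1 - f (\<sigma> u) * \<sigma> u\<close>, and the part of \<open>v\<close> outside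
  the range of \<open>B\<close> survives unchanged. Subtracting 1 from the squared factors allows
  the full norm of \<open>v\<close> to stand for that part.\<close>

lemma residual_eq:
  "(\<Sum>j\<in>J. (h j \<bullet> filt f v - v j)\<^sup>2)
     = (\<Sum>j\<in>J. (v j)\<^sup>2) + (\<Sum>u\<in>U. ((1 - f (\<sigma> u) * \<sigma> u)\<^sup>2 - 1) * ((coef v u)\<^sup>2 / \<sigma> u))"
proof -
  have inner: "u \<bullet> filt f v = f (\<sigma> u) * coef v u" if "u \<in> U" for u
    using sum_inner[OF that] by (simp add: filt_def inner_commute)
  have coef: "coef v (filt f v) = (\<Sum>u\<in>U. f (\<sigma> u) * (coef v u)\<^sup>2)"
    unfolding coef_def filt_def inner_sum_right inner_scaleR_right sum_distrib_left
    by (subst sum.swap) (simp add: sum_distrib_left power2_eq_square mult_ac)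
  have "(\<Sum>j\<in>J. (h j \<bullet> filt f v - v j)\<^sup>2)
      = (\<Sum>j\<in>J. (h j \<bullet> filt f v)\<^sup>2) - 2 * coef v (filt f v) + (\<Sum>j\<in>J. (v j)\<^sup>2)"
    by (simp add: power2_diff coef_def sum.distrib sum_subtractf sum_distrib_left mult_ac)
  also have "\<dots> = (\<Sum>j\<in>J. (v j)\<^sup>2)
      + (\<Sum>u\<in>U. \<sigma> u * (f (\<sigma> u) * coef v u)\<^sup>2 - 2 * (f (\<sigma> u) * (coef v u)\<^sup>2))"
    unfolding sum_frame_sq coef by (simp add: inner sum_subtractf sum_distrib_left)
  also have "(\<Sum>u\<in>U. \<sigma> u * (f (\<sigma> u) * coef v u)\<^sup>2 - 2 * (f (\<sigma> u) * (coef v u)\<^sup>2))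
      = (\<Sum>u\<in>U. ((1 - f (\<sigma> u) * \<sigma> u)\<^sup>2 - 1) * ((coef v u)\<^sup>2 / \<sigma> u))"
  proof (intro sum.cong refl)
    fix u assume "u \<in> U"
    have eq: "(1 - f (\<sigma> u) * \<sigma> u)\<^sup>2 - 1 = \<sigma> u * (\<sigma> u * (f (\<sigma> u))\<^sup>2 - 2 * f (\<sigma> u))"
      by (simp add: power2_eq_square algebra_simps)
    show "\<sigma> u * (f (\<sigma> u) * coef v u)\<^sup>2 - 2 * (f (\<sigma> u) * (coef v u)\<^sup>2)
        = ((1 - f (\<sigma> u) * \<sigma> u)\<^sup>2 - 1) * ((coef v u)\<^sup>2 / \<sigma> u)"
      unfolding eq using \<sigma>_pos[OF \<open>u \<in> U\<close>] by (simp add: power_mult_distrib algebra_simps)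
  qed
  finally show ?thesis .
qed

text \<open>For the exact inverse \<open>1 / t\<close> the residual is, up to sign, \<open>v\<close>
  minus its projection to the range of \<open>B\<close>, and its squared norm is
  nonnegative.\<close>

lemma bessel_coef: "(\<Sum>u\<in>U. (coef v u)\<^sup>2 / \<sigma> u) \<le> (\<Sum>j\<in>J. (v j)\<^sup>2)"
proof -
  have "(\<Sum>u\<in>U. ((1 - (1 / \<sigma> u) * \<sigma> u)\<^sup>2 - 1) * ((coef v u)\<^sup>2 / \<sigma> u)) = (\<Sum>u\<in>U. - ((coef v u)\<^sup>2 / \<sigma> u))"
    using \<sigma>_pos by (intro sum.cong refl) force
  then show ?thesis
    using residual_eq[of "\<lambda>t. 1 / t" v] sum_nonneg[of J "\<lambda>j. (h j \<bullet> filt (\<lambda>t. 1 / t) v - v j)\<^sup>2"]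
    by (simp add: sum_negf)
qed

text \<open>The bound \<open>1 \<le> C\<close> accounts for the component of \<open>v\<close>
  outside the range of \<open>B\<close>, which no filter touches.\<close>

lemma residual_le:
  assumes "\<And>u. u \<in> U \<Longrightarrow> \<bar>1 - f (\<sigma> u) * \<sigma> u\<bar> \<le> C" "1 \<le> C"
  shows "L2_set (\<lambda>j. h j \<bullet> filt f v - v j) J \<le> C * L2_set v J"
proof -
  let ?s = "\<Sum>u\<in>U. (coef v u)\<^sup>2 / \<sigma> u"
  have "(\<Sum>u\<in>U. ((1 - f (\<sigma> u) * \<sigma> u)\<^sup>2 - 1) * ((coef v u)\<^sup>2 / \<sigma> u)) \<le> (\<Sum>u\<in>U. (C\<^sup>2 - 1) * ((coef v u)\<^sup>2 / \<sigma> u))"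
  proof (intro sum_mono mult_right_mono)
    fix u assume u: "u \<in> U"
    show "(1 - f (\<sigma> u) * \<sigma> u)\<^sup>2 - 1 \<le> C\<^sup>2 - 1"
      using assms(1)[OF u] assms(2) by (simp add: abs_le_square_iff[symmetric])
    show "0 \<le> (coef v u)\<^sup>2 / \<sigma> u" using \<sigma>_pos[OF u] by simp
  qed
  also have "\<dots> = (C\<^sup>2 - 1) * ?s" by (simp add: sum_distrib_left)
  also have "\<dots> \<le> (C\<^sup>2 - 1) * (\<Sum>j\<in>J. (v j)\<^sup>2)"
    using assms(2) by (intro mult_left_mono bessel_coef) simp
  finally have "(\<Sum>j\<in>J. (h j \<bullet> filt f v - v j)\<^sup>2) \<le> C\<^sup>2 * (\<Sum>j\<in>J. (v j)\<^sup>2)"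
    unfolding residual_eq by (simp add: algebra_simps)
  then have "sqrt (\<Sum>j\<in>J. (h j \<bullet> filt f v - v j)\<^sup>2) \<le> sqrt (C\<^sup>2 * (\<Sum>j\<in>J. (v j)\<^sup>2))"
    by (rule real_sqrt_le_mono)
  then show ?thesis using assms(2) by (simp add: L2_set_def real_sqrt_mult)
qed

text \<open>Exact data lie in the range of \<open>B\<close>, so their squared norm cancels against
  the \<open>-1\<close> terms of \<open>residual_eq\<close> and only damped singular components
  remain.\<close>

lemma residual_exact:
  "L2_set (\<lambda>j. h j \<bullet> filt f (\<lambda>j. h j \<bullet> x) - h j \<bullet> x) J
     = L2_set (\<lambda>u. (1 - f (\<sigma> u) * \<sigma> u) * (sqrt (\<sigma> u) * (u \<bullet> x))) U"
proof -
  have "(\<Sum>u\<in>U. ((1 - f (\<sigma> u) * \<sigma> u)\<^sup>2 - 1) * ((coef (\<lambda>j. h j \<bullet> x) u)\<^sup>2 / \<sigma> u))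
      = (\<Sum>u\<in>U. ((1 - f (\<sigma> u) * \<sigma> u) * (sqrt (\<sigma> u) * (u \<bullet> x)))\<^sup>2 - \<sigma> u * (u \<bullet> x)\<^sup>2)"
  proof (intro sum.cong refl)
    fix u assume u: "u \<in> U"
    have eq: "(r\<^sup>2 - 1) * ((s * a)\<^sup>2 / s) = (r * (sqrt s * a))\<^sup>2 - s * a\<^sup>2" if "0 < s" for r s a :: real
      using that by (simp add: power_mult_distrib power2_eq_square[of s] left_diff_distrib)
    show "((1 - f (\<sigma> u) * \<sigma> u)\<^sup>2 - 1) * ((coef (\<lambda>j. h j \<bullet> x) u)\<^sup>2 / \<sigma> u)
        = ((1 - f (\<sigma> u) * \<sigma> u) * (sqrt (\<sigma> u) * (u \<bullet> x)))\<^sup>2 - \<sigma> u * (u \<bullet> x)\<^sup>2"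
      unfolding coef_frame[OF u] by (rule eq[OF \<sigma>_pos[OF u]])
  qed
  then show ?thesis unfolding L2_set_def
    by (subst residual_eq) (simp add: sum_frame_sq sum_subtractf)
qed

lemma norm_filt_le:
  assumes "\<And>u. u \<in> U \<Longrightarrow> (f (\<sigma> u))\<^sup>2 * \<sigma> u \<le> C" "0 \<le> C"
  shows "norm (filt f v) \<le> sqrt C * L2_set v J"
proof -
  have "(norm (filt f v))\<^sup>2 = (\<Sum>u\<in>U. ((f (\<sigma> u))\<^sup>2 * \<sigma> u) * ((coef v u)\<^sup>2 / \<sigma> u))"
    unfolding filt_def sum_norm_sq
    using \<sigma>_pos by (intro sum.cong refl) (force simp: power_mult_distrib)
  also have "\<dots> \<le> (\<Sum>u\<in>U. C * ((coef v u)\<^sup>2 / \<sigma> u))"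
    using \<sigma>_pos by (intro sum_mono mult_right_mono assms) (auto intro!: divide_nonneg_pos)
  also have "\<dots> \<le> C * (\<Sum>j\<in>J. (v j)\<^sup>2)"
    unfolding sum_distrib_left[symmetric] by (intro mult_left_mono bessel_coef assms)
  finally have "sqrt ((norm (filt f v))\<^sup>2) \<le> sqrt (C * (\<Sum>j\<in>J. (v j)\<^sup>2))"
    by (rule real_sqrt_le_mono)
  then show ?thesis by (simp add: L2_set_def real_sqrt_mult)
qed

text \<open>The component of \<open>x\<close> in the kernel of \<open>B\<close> is invisible to the
  data and stays in the error in full; hence the norm of \<open>x\<close> with corrections along
  \<open>U\<close> only.\<close>

lemma error_eq:
  "(norm (filt f (\<lambda>j. h j \<bullet> x) - x))\<^sup>2
     = (norm x)\<^sup>2 + (\<Sum>u\<in>U. ((1 - f (\<sigma> u) * \<sigma> u)\<^sup>2 - 1) * (u \<bullet> x)\<^sup>2)"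
proof -
  let ?z = "filt f (\<lambda>j. h j \<bullet> x)"
  have z: "?z = (\<Sum>u\<in>U. (f (\<sigma> u) * \<sigma> u * (u \<bullet> x)) *\<^sub>R u)"
    unfolding filt_def by (intro sum.cong refl) (simp add: coef_frame)
  have "(norm (?z - x))\<^sup>2 = (norm ?z)\<^sup>2 - 2 * (?z \<bullet> x) + (norm x)\<^sup>2"
    by (simp add: power2_norm_eq_inner inner_diff inner_commute)
  also have "(norm ?z)\<^sup>2 = (\<Sum>u\<in>U. (f (\<sigma> u) * \<sigma> u * (u \<bullet> x))\<^sup>2)"
    unfolding z by (rule sum_norm_sq)
  also have "?z \<bullet> x = (\<Sum>u\<in>U. f (\<sigma> u) * \<sigma> u * (u \<bullet> x)\<^sup>2)"
    unfolding z by (simp add: inner_sum_left power2_eq_square mult_ac)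
  also have "(\<Sum>u\<in>U. (f (\<sigma> u) * \<sigma> u * (u \<bullet> x))\<^sup>2) - 2 * (\<Sum>u\<in>U. f (\<sigma> u) * \<sigma> u * (u \<bullet> x)\<^sup>2)
     = (\<Sum>u\<in>U. ((1 - f (\<sigma> u) * \<sigma> u)\<^sup>2 - 1) * (u \<bullet> x)\<^sup>2)"
    unfolding sum_distrib_left sum_subtractf[symmetric]
    by (intro sum.cong refl) (simp add: algebra_simps power2_eq_square)
  finally show ?thesis by simp
qed

lemma filt_add: "filt f (\<lambda>j. v j + w j) = filt f v + filt f w"
  by (simp add: filt_def coef_def sum.distrib algebra_simps)

lemma filt_cong: "(\<And>j. j \<in> J \<Longrightarrow> v j = w j) \<Longrightarrow> filt f v = filt f w"
  by (simp add: filt_def coef_def)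

text \<open>The projected vector \<open>B\<^sup>* v\<close> is orthogonal to the kernel and so
  equals its own \<open>proj\<close>. For \<open>t = 0\<close> both sides are therefore 0, and
  otherwise the eigenspace pairs only with those \<open>u\<close> that have
  \<open>\<sigma> u = t\<close>.\<close>

lemma orth_proj_eigenspace:
  "orth_proj {y. T y = t *\<^sub>R y} (\<Sum>j\<in>J. v j *\<^sub>R h j) = (\<Sum>u\<in>{u\<in>U. \<sigma> u = t}. coef v u *\<^sub>R u)"
proof (rule orth_proj_eqI)
  let ?z = "\<Sum>j\<in>J. v j *\<^sub>R h j"
  let ?p = "\<Sum>u\<in>{u\<in>U. \<sigma> u = t}. coef v u *\<^sub>R u"
  show "subspace {y. T y = t *\<^sub>R y}"
    by (auto simp: subspace_def T.zero T.add T.scaleR algebra_simps)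
  show "?p \<in> {y. T y = t *\<^sub>R y}"
    by (auto simp: T.sum T.scaleR T_eig scaleR_sum_right mult.commute intro!: sum.cong)
  have cz: "coef v y = ?z \<bullet> y" for y by (simp add: coef_def inner_sum_left)
  have cu: "coef v u = u \<bullet> ?z" for u by (subst inner_commute) (rule cz)
  have z0: "?z \<bullet> y = 0" if "T y = 0" for y
    using frame_inner_zero[OF that] by (simp add: inner_sum_left)
  have z: "?z = proj ?z"
  proof -
    have "(?z - proj ?z) \<bullet> ?z = 0" using z0[OF T_diff_proj, of ?z] by (subst inner_commute)
    moreover have "(?z - proj ?z) \<bullet> proj ?z = 0"
      by (subst (2) proj_def) (simp add: inner_sum_right diff_proj_inner)
    ultimately have "(?z - proj ?z) \<bullet> (?z - proj ?z) = 0" by (simp add: inner_diff_right)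
    then show ?thesis by simp
  qed
  fix y assume "y \<in> {y. T y = t *\<^sub>R y}"
  then have y: "T y = t *\<^sub>R y" by simp
  have uy: "u \<bullet> y = 0" if "u \<in> U" "\<sigma> u \<noteq> t" for u
    using T_inner[OF that(1), of y] that(2) by (simp add: y inner_commute)
  have "?z \<bullet> y = (\<Sum>u\<in>U. (coef v u) * (u \<bullet> y))"
    by (subst z) (simp add: proj_def inner_sum_left cu)
  also have "\<dots> = (\<Sum>u\<in>{u\<in>U. \<sigma> u = t}. (coef v u) * (u \<bullet> y))"
    using uy finU by (intro sum.mono_neutral_right) auto
  also have "\<dots> = ?p \<bullet> y" by (simp add: inner_sum_left)
  finally show "(?z - ?p) \<bullet> y = 0" by (simp add: inner_diff_left)
qed

text \<open>Eigenvalues without a vector in \<open>U\<close>, in particular 0, contribute nothing,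
  and the vectors of \<open>U\<close> that share an eigenvalue are grouped.\<close>

lemma spectral_calculus_frame:
  "spectral_calculus f T (\<Sum>j\<in>J. v j *\<^sub>R h j) = filt f v"
proof -
  define g where "g t = f t *\<^sub>R (\<Sum>u\<in>{u\<in>U. \<sigma> u = t}. coef v u *\<^sub>R u)" for t
  have "spectral_calculus f T (\<Sum>j\<in>J. v j *\<^sub>R h j) = infsum g {t. \<exists>v. v \<noteq> 0 \<and> T v = t *\<^sub>R v}"
    unfolding spectral_calculus_def g_def orth_proj_eigenspace ..
  also have "\<dots> = infsum g (\<sigma> ` U)"
  proof (rule infsum_cong_neutral)
    fix t assume "t \<in> {t. \<exists>v. v \<noteq> 0 \<and> T v = t *\<^sub>R v} - \<sigma> ` U"
    then have "{u\<in>U. \<sigma> u = t} = {}" by auto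
    then show "g t = 0" by (simp only: g_def sum.empty scaleR_zero_right)
  next
    fix t assume t: "t \<in> \<sigma> ` U - {t. \<exists>v. v \<noteq> 0 \<and> T v = t *\<^sub>R v}"
    then obtain u where u: "u \<in> U" "t = \<sigma> u" by auto
    have "u \<noteq> 0" using orthU[of u u] u(1) by auto
    then show "g t = 0" using t u T_eig[OF u(1)] by auto
  qed simp
  also have "\<dots> = (\<Sum>t\<in>\<sigma> ` U. g t)" using finU by simp
  also have "\<dots> = (\<Sum>t\<in>\<sigma> ` U. \<Sum>u\<in>{u\<in>U. \<sigma> u = t}. (f (\<sigma> u) * coef v u) *\<^sub>R u)"
    unfolding g_def scaleR_sum_right by (intro sum.cong refl) auto
  also have "\<dots> = filt f v"
    unfolding filt_def by (rule sum.image_gen[OF finU, symmetric])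
  finally show ?thesis .
qed

end

section \<open>Filter estimates and the discrepancy principle\<close>

text \<open>\<open>C1\<close> is the qualification of order 1 and serves arbitrary elements.
  \<open>C3\<close> serves elements \<open>T w\<close>, whose extra factor \<open>t\<close> turns
  the weight \<open>sqrt t\<close> of the residual into \<open>t * sqrt t\<close>.
  \<open>CN / \<alpha>\<close> bounds the squared norm of
  \<open>F \<alpha> (B\<^sup>* B) B\<^sup>*\<close>.\<close>

locale filter_bounds =
  fixes \<Lambda> :: real and F :: "real \<Rightarrow> real \<Rightarrow> real" and C0 C1 C3 CN \<nu> :: real
  assumes C: "1 \<le> C0" "0 \<le> C1" "0 \<le> C3" "0 \<le> CN" "0 < \<Lambda>" "1 < \<nu>"
    and C0: "\<And>\<alpha> t. 0 < \<alpha> \<Longrightarrow> 0 < t \<Longrightarrow> t \<le> \<Lambda> \<Longrightarrow> \<bar>1 - F \<alpha> t * t\<bar> \<le> C0"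
    and C1: "\<And>\<alpha> t. 0 < \<alpha> \<Longrightarrow> 0 < t \<Longrightarrow> t \<le> \<Lambda> \<Longrightarrow> sqrt t * \<bar>1 - F \<alpha> t * t\<bar> \<le> C1 * sqrt \<alpha>"
    and C3: "\<And>\<alpha> t. 0 < \<alpha> \<Longrightarrow> 0 < t \<Longrightarrow> t \<le> \<Lambda> \<Longrightarrow> t * sqrt t * \<bar>1 - F \<alpha> t * t\<bar> \<le> C3 * \<alpha> powr (\<nu> / 2)"
    and CN: "\<And>\<alpha> t. 0 < \<alpha> \<Longrightarrow> 0 < t \<Longrightarrow> t \<le> \<Lambda> \<Longrightarrow> (F \<alpha> t)\<^sup>2 * t \<le> CN / \<alpha>"

lemma regularising_filter_bounds:
  assumes F: "regularising_filter \<Lambda> F \<nu>0 C0" and "0 < \<Lambda>" "1 < \<nu>0"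
  obtains C1 C3 CN \<nu> where "filter_bounds \<Lambda> F C0 C1 C3 CN \<nu>"
proof -
  have F_bounds: "\<exists>CR. \<forall>\<alpha>>0. \<forall>t\<in>{0<..\<Lambda>}. t * \<bar>F \<alpha> t\<bar> \<le> CR" "has_qualification \<Lambda> F \<nu>0"
    "\<forall>\<alpha>>0. \<forall>t\<in>{0<..\<Lambda>}. \<bar>1 - F \<alpha> t * t\<bar> \<le> C0" "\<exists>CF. \<forall>\<alpha>>0. \<forall>t\<in>{0<..\<Lambda>}. \<bar>F \<alpha> t\<bar> \<le> CF / \<alpha>"
    using F unfolding regularising_filter_def by - (elim conjE, assumption)+
  have C0: "\<bar>1 - F \<alpha> t * t\<bar> \<le> C0" if "0 < \<alpha>" "0 < t" "t \<le> \<Lambda>" for \<alpha> t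
    using F_bounds(3) that by simp
  obtain CR where "\<forall>\<alpha>>0. \<forall>t\<in>{0<..\<Lambda>}. t * \<bar>F \<alpha> t\<bar> \<le> CR" using F_bounds(1) ..
  then have CR: "\<And>\<alpha> t. 0 < \<alpha> \<Longrightarrow> 0 < t \<Longrightarrow> t \<le> \<Lambda> \<Longrightarrow> t * \<bar>F \<alpha> t\<bar> \<le> CR"
    by simp
  obtain CF where "\<forall>\<alpha>>0. \<forall>t\<in>{0<..\<Lambda>}. \<bar>F \<alpha> t\<bar> \<le> CF / \<alpha>" using F_bounds(4) ..
  then have CF: "\<And>\<alpha> t. 0 < \<alpha> \<Longrightarrow> 0 < t \<Longrightarrow> t \<le> \<Lambda> \<Longrightarrow> \<bar>F \<alpha> t\<bar> \<le> CF / \<alpha>"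
    by simp
  have CF0: "0 \<le> CF" using CF[of 1 \<Lambda>] \<open>0 < \<Lambda>\<close> by simp
  have CR0: "0 \<le> CR"
    by (rule order.trans[OF _ CR[of 1 \<Lambda>]]) (use \<open>0 < \<Lambda>\<close> in simp_all)
  have qual: "qualification_order \<Lambda> F \<nu>" if "0 \<le> \<nu>" "ereal \<nu> \<le> \<nu>0" for \<nu>
    using F_bounds(2)[unfolded has_qualification_def, THEN conjunct2, THEN conjunct1] that by simp
  \<comment> \<open>The bound \<open>CF / \<alpha>\<close> makes the filter vanish as \<alpha>
    grows, so \<open>1 - F \<alpha> \<Lambda> * \<Lambda>\<close> tends to 1.\<close>
  have "1 \<le> C0"
  proof (rule field_le_epsilon)
    fix e :: real assume e: "0 < e"
    define \<alpha> where "\<alpha> = (CF * \<Lambda> + 1) / e"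
    have \<alpha>: "0 < \<alpha>" using e CF0 \<open>0 < \<Lambda>\<close> by (simp add: \<alpha>_def add_nonneg_pos)
    have "\<bar>F \<alpha> \<Lambda>\<bar> * \<Lambda> \<le> CF / \<alpha> * \<Lambda>" using CF[of \<alpha> \<Lambda>] \<alpha> \<open>0 < \<Lambda>\<close> by (intro mult_right_mono) auto
    also have "\<dots> = e * (CF * \<Lambda> / (CF * \<Lambda> + 1))" by (simp add: \<alpha>_def)
    also have "\<dots> \<le> e * 1"
      using e CF0 \<open>0 < \<Lambda>\<close> by (intro mult_left_mono) (auto simp: divide_le_eq_1 add_nonneg_pos)
    finally have "\<bar>F \<alpha> \<Lambda> * \<Lambda>\<bar> \<le> e" using \<open>0 < \<Lambda>\<close> by (simp add: abs_mult)
    then show "1 \<le> C0 + e" using C0[OF \<alpha> \<open>0 < \<Lambda>\<close>] by simp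
  qed
  obtain r where r: "1 < ereal r" "ereal r < \<nu>0" using ereal_dense2[OF \<open>1 < \<nu>0\<close>] by blast
  \<comment> \<open>The finite \<open>r\<close> is needed because the qualification may be infinite;
    the cap keeps the exponent \<open>(3 - \<nu>) / 2\<close> in the splitting of
    \<open>t powr (3 / 2)\<close> nonnegative, so that this factor is bounded through
    \<open>t \<le> \<Lambda>\<close>.\<close>
  define \<nu> where "\<nu> = min r 3"
  have \<nu>: "1 < \<nu>" "\<nu> \<le> 3" "ereal \<nu> \<le> \<nu>0"
    using r by (auto simp: \<nu>_def min_def intro: order.trans[OF _ less_imp_le[OF r(2)]])
  have "qualification_order \<Lambda> F 1" "qualification_order \<Lambda> F \<nu>"
    using qual \<nu> \<open>1 < \<nu>0\<close> by (auto simp: one_ereal_def[symmetric] less_imp_le)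
  then obtain C1 C\<nu> where
    "\<forall>\<alpha>>0. \<forall>t\<in>{0<..\<Lambda>}. t powr (1 / 2) * \<bar>1 - F \<alpha> t * t\<bar> \<le> C1 * \<alpha> powr (1 / 2)"
    "\<forall>\<alpha>>0. \<forall>t\<in>{0<..\<Lambda>}. t powr (\<nu> / 2) * \<bar>1 - F \<alpha> t * t\<bar> \<le> C\<nu> * \<alpha> powr (\<nu> / 2)"
    unfolding qualification_order_def by (elim exE)
  then have C1: "\<And>\<alpha> t. 0 < \<alpha> \<Longrightarrow> 0 < t \<Longrightarrow> t \<le> \<Lambda> \<Longrightarrow>
      t powr (1 / 2) * \<bar>1 - F \<alpha> t * t\<bar> \<le> C1 * \<alpha> powr (1 / 2)"
    and C\<nu>: "\<And>\<alpha> t. 0 < \<alpha> \<Longrightarrow> 0 < t \<Longrightarrow> t \<le> \<Lambda> \<Longrightarrow>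
      t powr (\<nu> / 2) * \<bar>1 - F \<alpha> t * t\<bar> \<le> C\<nu> * \<alpha> powr (\<nu> / 2)"
    by simp_all
  have "0 \<le> \<Lambda> powr (1 / 2) * \<bar>1 - F 1 \<Lambda> * \<Lambda>\<bar>" by simp
  also have "\<dots> \<le> C1" using C1[of 1 \<Lambda>] \<open>0 < \<Lambda>\<close> by simp
  finally have C10: "0 \<le> C1" .
  have "0 \<le> \<Lambda> powr (\<nu> / 2) * \<bar>1 - F 1 \<Lambda> * \<Lambda>\<bar>" by simp
  also have "\<dots> \<le> C\<nu>" using C\<nu>[of 1 \<Lambda>] \<open>0 < \<Lambda>\<close> by simp
  finally have C\<nu>0: "0 \<le> C\<nu>" .
  show ?thesis
  proof (rule that[of C1 "\<Lambda> powr ((3 - \<nu>) / 2) * C\<nu>" "CF * CR" \<nu>], unfold_locales)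
    show "1 \<le> C0" "0 \<le> C1" "0 \<le> \<Lambda> powr ((3 - \<nu>) / 2) * C\<nu>" "0 \<le> CF * CR" "0 < \<Lambda>" "1 < \<nu>"
      using \<open>1 \<le> C0\<close> C10 \<nu> CF0 CR0 C\<nu>0 \<open>0 < \<Lambda>\<close> by auto
    fix \<alpha> t :: real assume a: "0 < \<alpha>" "0 < t" "t \<le> \<Lambda>"
    show "\<bar>1 - F \<alpha> t * t\<bar> \<le> C0" by (rule C0[OF a])
    show "sqrt t * \<bar>1 - F \<alpha> t * t\<bar> \<le> C1 * sqrt \<alpha>"
      using C1[OF a] a by (simp add: powr_half_sqrt)
    have "t * sqrt t = t powr (1 + 1 / 2)"
      using a by (simp only: powr_add powr_half_sqrt less_imp_le powr_one)
    also have "\<dots> = t powr ((3 - \<nu>) / 2) * t powr (\<nu> / 2)"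
      by (simp add: powr_add[symmetric] field_simps)
    also have "\<dots> * \<bar>1 - F \<alpha> t * t\<bar> = t powr ((3 - \<nu>) / 2) * (t powr (\<nu> / 2) * \<bar>1 - F \<alpha> t * t\<bar>)"
      by simp
    also have "\<dots> \<le> \<Lambda> powr ((3 - \<nu>) / 2) * (C\<nu> * \<alpha> powr (\<nu> / 2))"
      using a \<nu> by (intro mult_mono C\<nu> powr_mono2) auto
    finally show "t * sqrt t * \<bar>1 - F \<alpha> t * t\<bar> \<le> \<Lambda> powr ((3 - \<nu>) / 2) * C\<nu> * \<alpha> powr (\<nu> / 2)"
      by simp
    have "(F \<alpha> t)\<^sup>2 * t = \<bar>F \<alpha> t\<bar> * (t * \<bar>F \<alpha> t\<bar>)" by (simp add: power2_eq_square)
    also have "\<dots> \<le> CF / \<alpha> * CR"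
      using CF[OF a] CR[OF a] a CF0 CR0 by (intro mult_mono) auto
    finally show "(F \<alpha> t)\<^sup>2 * t \<le> CF * CR / \<alpha>" by simp
  qed
qed

text \<open>The two summands are the approximation error and the propagated noise for data of noise level
  \<open>d\<close>; the disjunction says that the discrepancy principle stopped immediately or had not yet been
  satisfied one step before, at \<open>\<beta> = \<alpha> / q\<close>.\<close>

lemma discrepancy_bound_small:
  fixes A B C1 C3 S \<nu> \<kappa> q \<epsilon> :: real
  assumes "0 \<le> A" "0 \<le> B" "0 \<le> C1" "0 \<le> C3" "0 \<le> S" "1 < \<nu>" "0 < \<kappa>" "0 < q" "0 < \<epsilon>"
  obtains \<eta> where "0 < \<eta>" "\<And>W. 0 \<le> W \<Longrightarrow> \<exists>d0>0. \<forall>d \<alpha>. 0 < d \<longrightarrow> d < d0 \<longrightarrow>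
      \<alpha> = 1 \<or> (\<exists>\<beta>>0. \<alpha> = q * \<beta> \<and> \<kappa> * d \<le> C3 * \<beta> powr (\<nu> / 2) * W + C1 * sqrt \<beta> * \<eta>) \<longrightarrow>
      sqrt (A * d * W + B * \<eta>) + S * d / sqrt \<alpha> < \<epsilon>"
proof -
  \<comment> \<open>\<open>g\<close> is the ratio \<open>d / sqrt \<beta>\<close> up to which
    \<open>S * d / sqrt (q * \<beta>)\<close> stays below \<epsilon> / 2. The added 1, here and
    below, guards against vanishing constants.\<close>
  define g where "g = \<epsilon> * sqrt q / (2 * (S + 1))"
  \<comment> \<open>The first entry leaves \<open>B * \<eta>\<close> half of the allowance
    \<open>\<epsilon>\<^sup>2 / 4\<close> under the root, the second keeps
    \<open>C1 * \<eta>\<close> to half of \<open>\<kappa> * g\<close>. Neither involves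
    \<open>W\<close>.\<close>
  define \<eta> where "\<eta> = min (\<epsilon>\<^sup>2 / (8 * (B + 1))) (\<kappa> * g / (2 * (C1 + 1)))"
  have g: "0 < g" using assms by (simp add: g_def)
  have \<eta>: "0 < \<eta>" using assms g by (simp add: \<eta>_def add_nonneg_pos)
  have B\<eta>: "B * \<eta> \<le> \<epsilon>\<^sup>2 / 8"
  proof -
    have "B * \<eta> \<le> (B + 1) * (\<epsilon>\<^sup>2 / (8 * (B + 1)))"
      using assms \<eta> by (intro mult_mono) (auto simp: \<eta>_def)
    also have "\<dots> = \<epsilon>\<^sup>2 / 8" using assms by (simp add: field_simps)
    finally show ?thesis .
  qed
  have C1\<eta>: "C1 * \<eta> \<le> \<kappa> * g / 2"
  proof -
    have "C1 * \<eta> \<le> (C1 + 1) * (\<kappa> * g / (2 * (C1 + 1)))"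
      using assms \<eta> by (intro mult_mono) (auto simp: \<eta>_def)
    also have "\<dots> = \<kappa> * g / 2" using assms by (simp add: field_simps)
    finally show ?thesis .
  qed
  have Sg: "S * g < \<epsilon> / 2 * sqrt q"
  proof -
    have "S * g < (S + 1) * g" using g by simp
    also have "\<dots> = \<epsilon> / 2 * sqrt q" using assms by (simp add: g_def field_simps)
    finally show ?thesis .
  qed
  show ?thesis
  proof (rule that[OF \<eta>])
    fix W :: real assume W: "0 \<le> W"
    \<comment> \<open>Up to \<open>\<beta>0\<close> the term with \<open>W\<close> uses less than
      the other half of \<open>\<kappa> * g\<close>, because the exponent
      \<open>(\<nu> - 1) / 2\<close> is positive.\<close>
    define \<beta>0 where "\<beta>0 = (\<kappa> * g / 2 / (C3 * W + 1)) powr (2 / (\<nu> - 1))"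
    have CW: "0 \<le> C3 * W" using assms W by simp
    have \<beta>0: "0 < \<beta>0" using assms g CW by (simp add: \<beta>0_def add_nonneg_pos)
    have \<beta>0_eq: "C3 * W * \<beta>0 powr ((\<nu> - 1) / 2) < \<kappa> * g / 2"
    proof -
      have "\<beta>0 powr ((\<nu> - 1) / 2) = \<kappa> * g / 2 / (C3 * W + 1)"
      proof -
        have "2 / (\<nu> - 1) * ((\<nu> - 1) / 2) = 1" using assms by simp
        moreover have "0 < \<kappa> * g / 2 / (C3 * W + 1)" using assms g CW by (simp add: add_nonneg_pos)
        ultimately show ?thesis unfolding \<beta>0_def powr_powr by (simp only: powr_one)
      qed
      moreover have "C3 * W * (\<kappa> * g / 2 / (C3 * W + 1)) = \<kappa> * g / 2 * (C3 * W / (C3 * W + 1))"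
        by simp
      moreover have "\<dots> < \<kappa> * g / 2 * 1"
        using assms g CW by (intro mult_strict_left_mono) auto
      ultimately show ?thesis by (simp only: mult_1_right)
    qed
    \<comment> \<open>The entries serve the approximation error, the case \<alpha> = 1, and the
      implication that \<open>g * sqrt \<beta> \<le> d\<close> forces
      \<open>\<beta> \<le> \<beta>0\<close>, which contradicts the discrepancy inequality divided by
      \<open>sqrt \<beta>\<close>.\<close>
    define d0 where "d0 = min (\<epsilon>\<^sup>2 / (8 * (A * W + 1))) (min (\<epsilon> / (2 * (S + 1))) (g * sqrt \<beta>0))"
    have AW: "0 \<le> A * W" using assms W by simp
    have "0 < d0" using assms g AW \<beta>0 by (simp add: d0_def add_nonneg_pos)
    moreover have "sqrt (A * d * W + B * \<eta>) + S * d / sqrt \<alpha> < \<epsilon>"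
      if d: "0 < d" "d < d0" and \<alpha>: "\<alpha> = 1 \<or> (\<exists>\<beta>>0. \<alpha> = q * \<beta> \<and> \<kappa> * d \<le> C3 * \<beta> powr (\<nu> / 2) * W + C1 * sqrt \<beta> * \<eta>)"
      for d \<alpha>
    proof -
      have "A * d * W \<le> A * W * (\<epsilon>\<^sup>2 / (8 * (A * W + 1)))"
        using mult_left_mono[OF less_imp_le[OF d(2)] AW] mult_left_mono[OF _ AW, of d0 "\<epsilon>\<^sup>2 / (8 * (A * W + 1))"]
        by (simp add: d0_def mult_ac)
      also have "\<dots> = \<epsilon>\<^sup>2 / 8 * (A * W / (A * W + 1))" by (simp add: field_simps)
      also have "\<dots> < \<epsilon>\<^sup>2 / 8 * 1"
        using assms AW by (intro mult_strict_left_mono) auto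
      finally have "A * d * W + B * \<eta> < \<epsilon>\<^sup>2 / 4" using B\<eta> by simp
      then have "sqrt (A * d * W + B * \<eta>) < sqrt (\<epsilon>\<^sup>2 / 4)" by (rule real_sqrt_less_mono)
      also have "\<dots> = \<epsilon> / 2" using assms by (simp add: real_sqrt_divide)
      finally have 1: "sqrt (A * d * W + B * \<eta>) < \<epsilon> / 2" .
      have 2: "S * d / sqrt \<alpha> < \<epsilon> / 2"
        using \<alpha>
      proof (elim disjE exE conjE)
        assume "\<alpha> = 1"
        have "S * d \<le> S * (\<epsilon> / (2 * (S + 1)))"
          using assms d by (intro mult_left_mono) (auto simp: d0_def)
        also have "\<dots> = \<epsilon> / 2 * (S / (S + 1))" by (simp add: field_simps)
        also have "\<dots> < \<epsilon> / 2 * 1" using assms by (intro mult_strict_left_mono) auto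
        finally show ?thesis using \<open>\<alpha> = 1\<close> by simp
      next
        fix \<beta> assume \<beta>: "0 < \<beta>" "\<alpha> = q * \<beta>" and
          le: "\<kappa> * d \<le> C3 * \<beta> powr (\<nu> / 2) * W + C1 * sqrt \<beta> * \<eta>"
        have "d < g * sqrt \<beta>"
        proof (rule ccontr)
          assume "\<not> ?thesis"
          then have ge: "g * sqrt \<beta> \<le> d" by simp
          have "\<beta> \<le> \<beta>0"
          proof (rule ccontr)
            assume "\<not> ?thesis"
            then have "g * sqrt \<beta>0 < d" using ge g
              by (intro less_le_trans[OF _ ge] mult_strict_left_mono) auto
            then show False using d by (simp add: d0_def)
          qed
          have "\<kappa> * (g * sqrt \<beta>) \<le> \<kappa> * d" using ge assms by (intro mult_left_mono) auto
          also note le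
          also have "\<beta> powr (\<nu> / 2) = \<beta> powr ((\<nu> - 1) / 2) * sqrt \<beta>"
            using \<beta> by (simp add: powr_half_sqrt[symmetric] powr_add[symmetric] diff_divide_distrib)
          also have "C3 * (\<beta> powr ((\<nu> - 1) / 2) * sqrt \<beta>) * W + C1 * sqrt \<beta> * \<eta>
              = (C3 * W * \<beta> powr ((\<nu> - 1) / 2) + C1 * \<eta>) * sqrt \<beta>"
            by (simp add: algebra_simps)
          finally have "\<kappa> * g \<le> C3 * W * \<beta> powr ((\<nu> - 1) / 2) + C1 * \<eta>"
            using \<beta> by (simp flip: mult.assoc)
          moreover have "C3 * W * \<beta> powr ((\<nu> - 1) / 2) \<le> C3 * W * \<beta>0 powr ((\<nu> - 1) / 2)"
            using \<open>\<beta> \<le> \<beta>0\<close> \<beta> CW assms by (intro mult_left_mono powr_mono2) auto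
          ultimately show False using C1\<eta> \<beta>0_eq by linarith
        qed
        then have "S * d \<le> S * g * sqrt \<beta>"
          using assms by (simp add: mult.assoc mult_left_mono)
        also have "\<dots> < \<epsilon> / 2 * sqrt q * sqrt \<beta>"
          using Sg \<beta> by (intro mult_strict_right_mono) auto
        finally show ?thesis using \<beta> assms
          by (simp add: pos_divide_less_eq real_sqrt_mult mult.assoc)
      qed
      from 1 2 show ?thesis by linarith
    qed
    ultimately show "\<exists>d0>0. \<forall>d \<alpha>. 0 < d \<longrightarrow> d < d0 \<longrightarrow>
      \<alpha> = 1 \<or> (\<exists>\<beta>>0. \<alpha> = q * \<beta> \<and> \<kappa> * d \<le> C3 * \<beta> powr (\<nu> / 2) * W + C1 * sqrt \<beta> * \<eta>) \<longrightarrow>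
      sqrt (A * d * W + B * \<eta>) + S * d / sqrt \<alpha> < \<epsilon>" by blast
  qed
qed

section \<open>Residuals and errors under the discrepancy principle\<close>

context frame_svd begin

lemma L2_set_coord_le:
  assumes "\<And>u. u \<in> U \<Longrightarrow> \<bar>c u\<bar> \<le> C" "0 \<le> C"
  shows "L2_set (\<lambda>u. c u * (u \<bullet> x)) U \<le> C * norm x"
proof -
  have "L2_set (\<lambda>u. c u * (u \<bullet> x)) U = L2_set (\<lambda>u. \<bar>c u\<bar> * \<bar>u \<bullet> x\<bar>) U"
    by (simp add: L2_set_def power_mult_distrib)
  also have "\<dots> \<le> L2_set (\<lambda>u. C * \<bar>u \<bullet> x\<bar>) U"
    by (intro L2_set_mono mult_right_mono assms) auto
  also have "\<dots> = C * L2_set (\<lambda>u. \<bar>u \<bullet> x\<bar>) U"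
    by (simp add: L2_set_right_distrib[OF assms(2)])
  also have "\<dots> \<le> C * norm x"
    using real_sqrt_le_mono[OF bessel[of x]] assms(2) by (intro mult_left_mono) (auto simp: L2_set_def)
  finally show ?thesis .
qed

lemma T_coord: "u \<in> U \<Longrightarrow> u \<bullet> T x = \<sigma> u * (u \<bullet> x)"
  using T_inner by (simp add: inner_commute)

text \<open>One factor \<open>x\<close> of each quadratic term is replaced by
  \<open>T w + e\<close>. In the \<open>T w\<close> part the eigenvalue is split as
  \<open>sqrt (\<sigma> u) * sqrt (\<sigma> u)\<close>, and Cauchy-Schwarz separates the exact
  residual from a multiple of \<open>norm w\<close>. The \<open>e\<close> part is estimated
  crudely.\<close>

lemma approximation_error_le:
  assumes r: "\<And>u. u \<in> U \<Longrightarrow> \<bar>1 - f (\<sigma> u) * \<sigma> u\<bar> \<le> C" "1 \<le> C"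
    and L: "\<And>u. u \<in> U \<Longrightarrow> \<sigma> u \<le> L" "0 \<le> L" and x: "x = T w + e"
  shows "(norm (filt f (\<lambda>j. h j \<bullet> x) - x))\<^sup>2
     \<le> L2_set (\<lambda>j. h j \<bullet> filt f (\<lambda>j. h j \<bullet> x) - h j \<bullet> x) J * (C * sqrt L * norm w)
         + (C\<^sup>2 + 1) * norm x * norm e"
proof -
  define \<rho> where "\<rho> u = 1 - f (\<sigma> u) * \<sigma> u" for u
  have \<rho>: "\<bar>\<rho> u\<bar> \<le> C" if "u \<in> U" for u using r(1)[OF that] by (simp add: \<rho>_def)
  have \<rho>2: "\<bar>(\<rho> u)\<^sup>2 - 1\<bar> \<le> C\<^sup>2" if "u \<in> U" for u
  proof -
    have "(\<rho> u)\<^sup>2 \<le> C\<^sup>2" using \<rho>[OF that] r(2) by (simp add: abs_le_square_iff[symmetric])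
    moreover have "1 \<le> C\<^sup>2" using r(2) by simp
    ultimately show ?thesis using zero_le_power2[of "\<rho> u"] by linarith
  qed
  have "(norm (filt f (\<lambda>j. h j \<bullet> x) - x))\<^sup>2 = x \<bullet> x + (\<Sum>u\<in>U. ((\<rho> u)\<^sup>2 - 1) * ((u \<bullet> x) * (u \<bullet> x)))"
    by (subst error_eq) (simp add: \<rho>_def power2_norm_eq_inner power2_eq_square[of "_ \<bullet> _"])
  also have "\<dots> = x \<bullet> T w + (\<Sum>u\<in>U. ((\<rho> u)\<^sup>2 - 1) * ((u \<bullet> x) * (u \<bullet> T w)))
      + (x \<bullet> e + (\<Sum>u\<in>U. ((\<rho> u)\<^sup>2 - 1) * ((u \<bullet> x) * (u \<bullet> e))))"
  proof -
    have "y \<bullet> x = y \<bullet> T w + y \<bullet> e" for y by (simp add: x inner_add_right)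
    then show ?thesis by (simp add: distrib_left sum.distrib)
  qed
  finally have split: "(norm (filt f (\<lambda>j. h j \<bullet> x) - x))\<^sup>2 = x \<bullet> T w + (\<Sum>u\<in>U. ((\<rho> u)\<^sup>2 - 1) * ((u \<bullet> x) * (u \<bullet> T w)))
      + (x \<bullet> e + (\<Sum>u\<in>U. ((\<rho> u)\<^sup>2 - 1) * ((u \<bullet> x) * (u \<bullet> e))))" .
  \<comment> \<open>The kernel component of \<open>x\<close> is orthogonal to \<open>T w\<close>, so
    the full inner product is a sum over \<open>U\<close> and cancels the \<open>-1\<close>.\<close>
  have xT: "x \<bullet> T w = (\<Sum>u\<in>U. (u \<bullet> x) * (u \<bullet> T w))"
    by (subst T_expand) (simp add: T_coord inner_sum_right inner_commute mult_ac)
  have "x \<bullet> T w + (\<Sum>u\<in>U. ((\<rho> u)\<^sup>2 - 1) * ((u \<bullet> x) * (u \<bullet> T w)))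
      = (\<Sum>u\<in>U. (\<rho> u * (sqrt (\<sigma> u) * (u \<bullet> x))) * (\<rho> u * (sqrt (\<sigma> u) * (u \<bullet> w))))"
    unfolding xT sum.distrib[symmetric]
  proof (intro sum.cong refl)
    fix u assume u: "u \<in> U"
    have "sqrt (\<sigma> u) * sqrt (\<sigma> u) = \<sigma> u" using \<sigma>_pos[OF u] by simp
    then have "(\<rho> u * (sqrt (\<sigma> u) * a)) * (\<rho> u * (sqrt (\<sigma> u) * b)) = (\<rho> u)\<^sup>2 * (\<sigma> u * (a * b))" for a b
      by (metis power2_eq_square mult.assoc mult.left_commute)
    note eq = this
    show "(u \<bullet> x) * (u \<bullet> T w) + ((\<rho> u)\<^sup>2 - 1) * ((u \<bullet> x) * (u \<bullet> T w))
       = (\<rho> u * (sqrt (\<sigma> u) * (u \<bullet> x))) * (\<rho> u * (sqrt (\<sigma> u) * (u \<bullet> w)))"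
      unfolding eq T_coord[OF u] by (simp add: algebra_simps)
  qed
  also have "\<dots> \<le> (\<Sum>u\<in>U. \<bar>\<rho> u * (sqrt (\<sigma> u) * (u \<bullet> x))\<bar> * \<bar>\<rho> u * (sqrt (\<sigma> u) * (u \<bullet> w))\<bar>)"
    by (intro sum_mono) (simp flip: abs_mult)
  also have "\<dots> \<le> L2_set (\<lambda>u. \<rho> u * (sqrt (\<sigma> u) * (u \<bullet> x))) U * L2_set (\<lambda>u. \<rho> u * (sqrt (\<sigma> u) * (u \<bullet> w))) U"
    by (rule L2_set_mult_ineq)
  also have "\<dots> \<le> L2_set (\<lambda>u. \<rho> u * (sqrt (\<sigma> u) * (u \<bullet> x))) U * (C * sqrt L * norm w)"
  proof (rule mult_left_mono)
    show "L2_set (\<lambda>u. \<rho> u * (sqrt (\<sigma> u) * (u \<bullet> w))) U \<le> C * sqrt L * norm w"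
      unfolding mult.assoc[symmetric, of "\<rho> _"]
    proof (rule L2_set_coord_le)
      show "\<bar>\<rho> u * sqrt (\<sigma> u)\<bar> \<le> C * sqrt L" if "u \<in> U" for u
        unfolding abs_mult using \<rho>[OF that] L(1)[OF that] \<sigma>_pos[OF that] by (intro mult_mono) auto
      show "0 \<le> C * sqrt L" using r(2) \<open>0 \<le> L\<close> by simp
    qed
  qed simp
  finally have smooth: "x \<bullet> T w + (\<Sum>u\<in>U. ((\<rho> u)\<^sup>2 - 1) * ((u \<bullet> x) * (u \<bullet> T w)))
      \<le> L2_set (\<lambda>u. \<rho> u * (sqrt (\<sigma> u) * (u \<bullet> x))) U * (C * sqrt L * norm w)" .
  have "x \<bullet> e + (\<Sum>u\<in>U. ((\<rho> u)\<^sup>2 - 1) * ((u \<bullet> x) * (u \<bullet> e)))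
     \<le> norm x * norm e + (\<Sum>u\<in>U. \<bar>((\<rho> u)\<^sup>2 - 1) * (u \<bullet> x)\<bar> * \<bar>u \<bullet> e\<bar>)"
    by (intro add_mono norm_cauchy_schwarz sum_mono) (simp flip: abs_mult mult.assoc)
  also have "(\<Sum>u\<in>U. \<bar>((\<rho> u)\<^sup>2 - 1) * (u \<bullet> x)\<bar> * \<bar>u \<bullet> e\<bar>) \<le> C\<^sup>2 * norm x * norm e"
  proof (rule order.trans[OF L2_set_mult_ineq], intro mult_mono L2_set_coord_le \<rho>2)
    show "L2_set (\<lambda>u. u \<bullet> e) U \<le> norm e" using L2_set_coord_le[of "\<lambda>_. 1" 1 e] by simp
  qed auto
  finally have rest: "x \<bullet> e + (\<Sum>u\<in>U. ((\<rho> u)\<^sup>2 - 1) * ((u \<bullet> x) * (u \<bullet> e))) \<le> (C\<^sup>2 + 1) * norm x * norm e"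
    by (simp add: algebra_simps)
  show ?thesis
    using add_mono[OF smooth rest] unfolding split residual_exact \<rho>_def .
qed

end

locale filtered_svd = frame_svd J h U + filter_bounds \<Lambda> F C0 C1 C3 CN \<nu>
  for J :: "'i set" and h :: "'i \<Rightarrow> 'a::real_inner" and U \<Lambda> F C0 C1 C3 CN \<nu> +
  assumes onorm_le: "onorm T \<le> \<Lambda>"
begin

lemma \<sigma>_le: "u \<in> U \<Longrightarrow> \<sigma> u \<le> \<Lambda>"
  using \<sigma>_le_onorm onorm_le by fastforce

lemma residual_exact_le:
  assumes "0 < \<alpha>" "x = T w + e"
  shows "L2_set (\<lambda>j. h j \<bullet> filt (F \<alpha>) (\<lambda>j. h j \<bullet> x) - h j \<bullet> x) J
     \<le> C3 * \<alpha> powr (\<nu> / 2) * norm w + C1 * sqrt \<alpha> * norm e"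
proof -
  define r where "r u = (1 - F \<alpha> (\<sigma> u) * \<sigma> u) * sqrt (\<sigma> u)" for u
  have "L2_set (\<lambda>j. h j \<bullet> filt (F \<alpha>) (\<lambda>j. h j \<bullet> x) - h j \<bullet> x) J
      = L2_set (\<lambda>u. (r u * \<sigma> u) * (u \<bullet> w) + r u * (u \<bullet> e)) U"
    unfolding residual_exact
    by (rule L2_set_cong) (simp_all add: assms(2) inner_add_right T_coord r_def algebra_simps)
  also have "\<dots> \<le> L2_set (\<lambda>u. (r u * \<sigma> u) * (u \<bullet> w)) U + L2_set (\<lambda>u. r u * (u \<bullet> e)) U"
    by (rule L2_set_triangle_ineq)
  also have "\<dots> \<le> C3 * \<alpha> powr (\<nu> / 2) * norm w + C1 * sqrt \<alpha> * norm e"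
  proof (intro add_mono L2_set_coord_le)
    fix u assume u: "u \<in> U"
    show "\<bar>r u * \<sigma> u\<bar> \<le> C3 * \<alpha> powr (\<nu> / 2)"
      using C3[OF assms(1) \<sigma>_pos[OF u] \<sigma>_le[OF u]] \<sigma>_pos[OF u] by (simp add: r_def abs_mult mult_ac)
    show "\<bar>r u\<bar> \<le> C1 * sqrt \<alpha>"
      using C1[OF assms(1) \<sigma>_pos[OF u] \<sigma>_le[OF u]] \<sigma>_pos[OF u] by (simp add: r_def abs_mult mult_ac)
  qed (use C assms(1) in auto)
  finally show ?thesis .
qed

text \<open>At every parameter the noise contributes at most \<open>C0 * L2_set \<xi> J\<close> to
  the residual, so exact and noisy residuals differ by at most \<open>\<tau>1 * d\<close>. Passing
  the test bounds the exact residual from above, failing it bounds it from below.\<close>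

lemma discrepancy_principle_error:
  fixes \<tau> \<tau>1 d q \<eta> :: real and x w e :: 'a and \<xi> :: "'i \<Rightarrow> real"
  defines "v \<equiv> \<lambda>j. h j \<bullet> x + \<xi> j"
  defines "\<alpha> \<equiv> q ^ (LEAST k. L2_set (\<lambda>j. h j \<bullet> filt (F (q ^ k)) v - v j) J \<le> \<tau> * d)"
  assumes q: "0 < q" "q < 1" and \<tau>: "\<tau>1 < \<tau>" and d: "0 < d"
    and \<xi>: "C0 * L2_set \<xi> J \<le> \<tau>1 * d"
    and x: "x = T w + e" "norm e \<le> \<eta>"
  shows "norm (filt (F \<alpha>) v - x)
      \<le> sqrt (((\<tau> + \<tau>1) * C0 * sqrt \<Lambda>) * d * norm w + ((C0\<^sup>2 + 1) * norm x) * \<eta>)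
        + (sqrt CN * \<tau>1) * d / sqrt \<alpha>"
    and "\<alpha> = 1 \<or> (\<exists>\<beta>>0. \<alpha> = q * \<beta>
      \<and> (\<tau> - \<tau>1) * d \<le> C3 * \<beta> powr (\<nu> / 2) * norm w + C1 * sqrt \<beta> * \<eta>)"
proof -
  let ?D = "\<lambda>\<alpha>. L2_set (\<lambda>j. h j \<bullet> filt (F \<alpha>) (\<lambda>j. h j \<bullet> x) - h j \<bullet> x) J"
  let ?R = "\<lambda>\<alpha>. L2_set (\<lambda>j. h j \<bullet> filt (F \<alpha>) v - v j) J"
  let ?N = "\<lambda>\<alpha>. L2_set (\<lambda>j. h j \<bullet> filt (F \<alpha>) \<xi> - \<xi> j) J"
  let ?P = "\<lambda>k. ?R (q ^ k) \<le> \<tau> * d"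
  have split: "filt (F \<alpha>) v = filt (F \<alpha>) (\<lambda>j. h j \<bullet> x) + filt (F \<alpha>) \<xi>" for \<alpha>
    unfolding v_def by (rule filt_add)
  have hv: "h j \<bullet> filt (F \<alpha>) v = h j \<bullet> filt (F \<alpha>) (\<lambda>j. h j \<bullet> x) + h j \<bullet> filt (F \<alpha>) \<xi>" for j \<alpha>
    by (simp only: split inner_add_right)
  have v: "v j = h j \<bullet> x + \<xi> j" for j by (simp add: v_def)
  have N: "?N \<alpha> \<le> \<tau>1 * d" if "0 < \<alpha>" for \<alpha>
    by (rule order.trans[OF residual_le \<xi>]) (use that C \<sigma>_le \<sigma>_pos C0 in auto)
  have RD: "?R \<alpha> \<le> ?D \<alpha> + ?N \<alpha>" for \<alpha>
    by (rule order.trans[OF _ L2_set_triangle_ineq]) (simp add: hv v algebra_simps)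
  have RD: "?R \<alpha> \<le> ?D \<alpha> + \<tau>1 * d" if "0 < \<alpha>" for \<alpha>
    using RD[of \<alpha>] N[OF that] by linarith
  have DR: "?D \<alpha> \<le> ?R \<alpha> + ?N \<alpha>" for \<alpha>
  proof -
    have "?D \<alpha> = L2_set (\<lambda>j. (h j \<bullet> filt (F \<alpha>) v - v j) + - (h j \<bullet> filt (F \<alpha>) \<xi> - \<xi> j)) J"
      by (simp add: hv v)
    also have "\<dots> \<le> ?R \<alpha> + L2_set (\<lambda>j. - (h j \<bullet> filt (F \<alpha>) \<xi> - \<xi> j)) J"
      by (rule L2_set_triangle_ineq)
    also have "L2_set (\<lambda>j. - (h j \<bullet> filt (F \<alpha>) \<xi> - \<xi> j)) J = ?N \<alpha>"
      by (simp add: L2_set_def power2_commute)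
    finally show ?thesis .
  qed
  have DR: "?D \<alpha> \<le> ?R \<alpha> + \<tau>1 * d" if "0 < \<alpha>" for \<alpha>
    using DR[of \<alpha>] N[OF that] by linarith
  have qpos: "0 < q ^ k" for k using q by simp
  \<comment> \<open>Termination uses the trivial decomposition \<open>x = T 0 + x\<close>: the exact
    residual is \<open>O(sqrt \<alpha>)\<close> and falls below the gap
    \<open>(\<tau> - \<tau>1) * d\<close>.\<close>
  have ex: "\<exists>k. ?P k"
  proof -
    have "(\<lambda>k. C1 * sqrt (q ^ k) * norm x) \<longlonglongrightarrow> C1 * sqrt 0 * norm x"
      using q by (intro tendsto_intros LIMSEQ_power_zero) auto
    then have "eventually (\<lambda>k. C1 * sqrt (q ^ k) * norm x < (\<tau> - \<tau>1) * d) sequentially"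
      using \<tau> d by (intro order_tendstoD) auto
    then obtain k where k: "C1 * sqrt (q ^ k) * norm x < (\<tau> - \<tau>1) * d"
      by (auto simp: eventually_sequentially)
    have "?D (q ^ k) \<le> C1 * sqrt (q ^ k) * norm x"
      using residual_exact_le[OF qpos, of x 0 x k] by (simp add: T.zero)
    with k RD[OF qpos, of k] have "?R (q ^ k) \<le> \<tau> * d" by (simp add: left_diff_distrib)
    then show ?thesis ..
  qed
  define k where "k = (LEAST k. ?P k)"
  have \<alpha>: "\<alpha> = q ^ k" by (simp add: \<alpha>_def k_def)
  have \<alpha>0: "0 < \<alpha>" using qpos by (simp add: \<alpha>)
  have "?P k" unfolding k_def by (rule LeastI_ex[OF ex])
  then have D\<alpha>: "?D \<alpha> \<le> (\<tau> + \<tau>1) * d" using DR[OF \<alpha>0] by (simp add: \<alpha> distrib_right)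
  have "0 \<le> C0 * L2_set \<xi> J" using C by simp
  then have \<tau>1: "0 \<le> \<tau>1" using \<xi> d by (meson order_trans zero_le_mult_iff less_le_not_le)
  have \<eta>: "0 \<le> \<eta>" using x(2) norm_ge_zero order_trans by blast
  show "\<alpha> = 1 \<or> (\<exists>\<beta>>0. \<alpha> = q * \<beta>
      \<and> (\<tau> - \<tau>1) * d \<le> C3 * \<beta> powr (\<nu> / 2) * norm w + C1 * sqrt \<beta> * \<eta>)"
  \<comment> \<open>\<open>\<beta>\<close> is the last parameter that failed the test; for
    \<open>k = 0\<close> there is none, and \<alpha> = 1.\<close>
  proof (cases k)
    case 0
    then show ?thesis by (simp add: \<alpha>)
  next
    case (Suc k')
    then have "\<not> ?P k'" using not_less_Least[of k' ?P] by (simp add: k_def)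
    then have "(\<tau> - \<tau>1) * d \<le> ?D (q ^ k')" using RD[OF qpos, of k'] by (simp add: left_diff_distrib)
    also have "\<dots> \<le> C3 * (q ^ k') powr (\<nu> / 2) * norm w + C1 * sqrt (q ^ k') * norm e"
      by (rule residual_exact_le[OF qpos x(1)])
    also have "\<dots> \<le> C3 * (q ^ k') powr (\<nu> / 2) * norm w + C1 * sqrt (q ^ k') * \<eta>"
      using C qpos[of k'] x(2) by (intro add_left_mono mult_left_mono) auto
    finally show ?thesis using Suc qpos[of k'] by (intro disjI2 exI[of _ "q ^ k'"]) (simp add: \<alpha>)
  qed
  have "(norm (filt (F \<alpha>) (\<lambda>j. h j \<bullet> x) - x))\<^sup>2
      \<le> ?D \<alpha> * (C0 * sqrt \<Lambda> * norm w) + (C0\<^sup>2 + 1) * norm x * norm e"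
    by (rule approximation_error_le[OF _ _ _ _ x(1)]) (use \<alpha>0 C \<sigma>_le \<sigma>_pos C0 in auto)
  also have "\<dots> \<le> ((\<tau> + \<tau>1) * d) * (C0 * sqrt \<Lambda> * norm w) + (C0\<^sup>2 + 1) * norm x * \<eta>"
    using C D\<alpha> x(2) by (intro add_mono mult_right_mono mult_left_mono) auto
  finally have "(norm (filt (F \<alpha>) (\<lambda>j. h j \<bullet> x) - x))\<^sup>2
      \<le> ((\<tau> + \<tau>1) * C0 * sqrt \<Lambda>) * d * norm w + ((C0\<^sup>2 + 1) * norm x) * \<eta>"
    by (simp add: mult_ac)
  then have 1: "norm (filt (F \<alpha>) (\<lambda>j. h j \<bullet> x) - x)
      \<le> sqrt (((\<tau> + \<tau>1) * C0 * sqrt \<Lambda>) * d * norm w + ((C0\<^sup>2 + 1) * norm x) * \<eta>)"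
    by (rule real_le_rsqrt)
  have "1 * L2_set \<xi> J \<le> C0 * L2_set \<xi> J" using C by (intro mult_right_mono) auto
  then have L2\<xi>: "L2_set \<xi> J \<le> \<tau>1 * d" using \<xi> by simp
  have "norm (filt (F \<alpha>) \<xi>) \<le> sqrt (CN / \<alpha>) * L2_set \<xi> J"
    by (rule norm_filt_le) (use \<alpha>0 C \<sigma>_le \<sigma>_pos CN in auto)
  also have "\<dots> \<le> sqrt (CN / \<alpha>) * (\<tau>1 * d)"
    using \<alpha>0 C by (intro mult_left_mono L2\<xi>) auto
  also have "\<dots> = (sqrt CN * \<tau>1) * d / sqrt \<alpha>" by (simp add: real_sqrt_divide)
  finally have 2: "norm (filt (F \<alpha>) \<xi>) \<le> (sqrt CN * \<tau>1) * d / sqrt \<alpha>" .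
  have "norm (filt (F \<alpha>) v - x) \<le> norm (filt (F \<alpha>) (\<lambda>j. h j \<bullet> x) - x) + norm (filt (F \<alpha>) \<xi>)"
    unfolding split by (metis add_diff_eq diff_add_eq norm_triangle_ineq)
  with 1 2 show "norm (filt (F \<alpha>) v - x)
      \<le> sqrt (((\<tau> + \<tau>1) * C0 * sqrt \<Lambda>) * d * norm w + ((C0\<^sup>2 + 1) * norm x) * \<eta>)
        + (sqrt CN * \<tau>1) * d / sqrt \<alpha>" by linarith
qed

end

section \<open>Transfer to the discretised operators\<close>

lemma adjoint_Rm_eq:
  assumes "\<And>x j. j \<in> {1..m} \<Longrightarrow> B x j = h j \<bullet> x"
  shows "adjoint_Rm m B v = (\<Sum>j=1..m. v j *\<^sub>R h j)"
  unfolding adjoint_Rm_def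
proof (rule the_equality)
  show *: "\<forall>x. x \<bullet> (\<Sum>j=1..m. v j *\<^sub>R h j) = (\<Sum>j=1..m. B x j * v j)"
    using assms by (auto simp: inner_sum_right inner_commute intro!: sum.cong)
  show "h' = (\<Sum>j=1..m. v j *\<^sub>R h j)" if "\<forall>x. x \<bullet> h' = (\<Sum>j=1..m. B x j * v j)" for h'
    using that * by (metis vector_eq_ldot)
qed

lemma gram_eq_frame_op:
  assumes "\<And>x j. j \<in> {1..m} \<Longrightarrow> B x j = h j \<bullet> x"
  shows "adjoint_Rm m B (B x) = frame_op {1..m} h x"
  using adjoint_Rm_eq[of m B h "B x", OF assms] by (simp add: frame_op_def assms)

text \<open>A nonnegative quadratic form that vanishes at \<open>y\<close> is minimal there, so its
  derivative in the direction \<open>A y\<close>, twice the squared norm of \<open>A y\<close>, must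
  be 0. The step \<open>t\<close> is negative and small enough for the linear term to
  dominate.\<close>

lemma positive_selfadjoint_inner_eq_0:
  fixes A :: "'a::real_inner \<Rightarrow> 'a"
  assumes "linear A" and sym: "\<And>y z. A y \<bullet> z = y \<bullet> A z" and pos: "\<And>y. 0 \<le> A y \<bullet> y"
    and "A y \<bullet> y = 0"
  shows "A y = 0"
proof (rule ccontr)
  assume "A y \<noteq> 0"
  define a where "a = A y \<bullet> A y"
  define c where "c = A (A y) \<bullet> A y"
  have a: "0 < a" using \<open>A y \<noteq> 0\<close> by (simp add: a_def)
  have c: "0 \<le> c" by (simp add: c_def pos)
  define t where "t = - a / (c + 1)"
  have "0 \<le> A (y + t *\<^sub>R A y) \<bullet> (y + t *\<^sub>R A y)" by (rule pos)
  also have "\<dots> = 2 * t * a + t * t * c"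
    using assms(4) sym[of "A y" y]
    by (simp add: linear_add[OF assms(1)] linear_scale[OF assms(1)] inner_add a_def c_def algebra_simps)
  also have "\<dots> = t * (2 * a + t * c)" by (simp add: algebra_simps)
  also have "\<dots> < 0"
  proof (rule mult_neg_pos)
    show "t < 0" using a c by (simp add: t_def)
    have "a * (c / (c + 1)) \<le> a * 1" using a c by (intro mult_left_mono) auto
    then show "0 < 2 * a + t * c" using a by (simp add: t_def)
  qed
  finally show False by simp
qed

text \<open>A vector \<open>z\<close> orthogonal to the range satisfies
  \<open>A (K z) \<bullet> K z = 0\<close>; positivity upgrades this to \<open>A (K z) = 0\<close>,
  and the two injectivities give \<open>z = 0\<close>.\<close>

lemma dense_range_adjoint_conjugate:
  fixes K :: "'x::{real_inner,complete_space} \<Rightarrow>\<^sub>L 'y::real_inner" and A :: "'y \<Rightarrow>\<^sub>L 'y"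
  assumes "bounded_linear Ks" and Ks: "\<And>x y. x \<bullet> Ks y = blinfun_apply K x \<bullet> y"
    and K: "inj (blinfun_apply K)" and A: "inj (blinfun_apply A)"
    and sym: "\<And>y z. blinfun_apply A y \<bullet> z = y \<bullet> blinfun_apply A z"
    and pos: "\<And>y. 0 \<le> blinfun_apply A y \<bullet> y"
  shows "closure (range (\<lambda>x. Ks (blinfun_apply A (blinfun_apply K x)))) = UNIV"
proof (rule ccontr)
  interpret Ks: bounded_linear Ks by fact
  let ?T = "\<lambda>x. Ks (blinfun_apply A (blinfun_apply K x))"
  assume "closure (range ?T) \<noteq> UNIV"
  moreover have "linear ?T"
    by (intro linearI) (simp_all add: blinfun.bilinear_simps Ks.add Ks.scaleR)
  then have "subspace (range ?T)" by (intro linear_subspace_image subspace_UNIV)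
  ultimately obtain z where z: "z \<noteq> 0" "\<And>s. s \<in> range ?T \<Longrightarrow> z \<bullet> s = 0"
    using not_dense_imp_orthogonal_vector by blast
  have "blinfun_apply A (blinfun_apply K z) \<bullet> blinfun_apply K z = 0"
    using z(2)[of "?T z"] by (simp add: Ks inner_commute)
  then have "blinfun_apply A (blinfun_apply K z) = 0"
    by (rule positive_selfadjoint_inner_eq_0[OF bounded_linear.linear[OF blinfun.bounded_linear_right] sym pos])
  then have "blinfun_apply K z = 0" using injD[OF A, of "blinfun_apply K z" 0] by (simp add: blinfun.zero_right)
  then have "z = 0" using injD[OF K, of z 0] by (simp add: blinfun.zero_right)
  with z(1) show False ..
qed

text \<open>The pointwise limit acts three times: it passes symmetry and positivity on to
  \<open>A\<close>, it bounds the norms of all levels together, and it makes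
  \<open>x - S m w\<close> small for one fixed \<open>w\<close>.\<close>

lemma discrepancy_principle_uniform_error:
  fixes K :: "'x::{real_inner,complete_space} \<Rightarrow>\<^sub>L 'y::{real_inner,complete_space}"
    and l :: "nat \<Rightarrow> nat \<Rightarrow> 'y \<Rightarrow>\<^sub>L real" and A :: "'y \<Rightarrow>\<^sub>L 'y"
  assumes K: "inj (blinfun_apply K)" "K \<noteq> 0" and A: "inj (blinfun_apply A)"
    and lim: "\<And>y. (\<lambda>m. adjoint_Rm m (meas_op l m) (meas_op l m y)) \<longlonglongrightarrow> blinfun_apply A y"
    and F: "regularising_filter (spectral_bound K l) F \<nu>0 C0" "1 < \<nu>0"
    and \<tau>: "0 \<le> \<tau>1" "\<tau>1 < \<tau>" and q: "0 < q" "q < 1" and \<epsilon>: "0 < \<epsilon>"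
  obtains d0 m0 where "0 < d0"
    "\<And>m d \<xi> Y. m0 \<le> m \<Longrightarrow> 0 < d \<Longrightarrow> d < d0 \<Longrightarrow> C0 * L2_set \<xi> {1..m} \<le> \<tau>1 * d \<Longrightarrow>
      (\<And>j. j \<in> {1..m} \<Longrightarrow> Y j = blinfun_apply (l m j) (blinfun_apply K x) + \<xi> j) \<Longrightarrow>
      norm (reg_op K l F m (q ^ (LEAST k. L2_set (\<lambda>j. disc_op K l m (reg_op K l F m (q ^ k) Y) j - Y j) {1..m}
              \<le> \<tau> * d)) Y - x) < \<epsilon>"
proof -
  have "\<exists>g. \<forall>y. blinfun_apply (l m j) y = g \<bullet> y" for m j
    using riesz_representation[of "l m j"] by (metis inner_commute)
  then obtain g where g: "\<And>m j y. blinfun_apply (l m j) y = g m j \<bullet> y" by metis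
  obtain Ks where Ks_bl: "bounded_linear Ks" and Ks: "\<And>x y. x \<bullet> Ks y = blinfun_apply K x \<bullet> y"
    using bounded_linear_adjoint_exists[of K] by blast
  interpret Ks: bounded_linear Ks by (rule Ks_bl)
  define h where "h m j = Ks (g m j)" for m j
  have h: "g m j \<bullet> blinfun_apply K x = h m j \<bullet> x" for m j x
    by (simp add: h_def inner_commute[of _ x] Ks inner_commute)
  define S where "S m = frame_op {1..m} (h m)" for m
  have disc: "disc_op K l m x j = h m j \<bullet> x" if "j \<in> {1..m}" for m x j
    using that by (simp add: disc_op_def meas_op_def g h)
  have meas: "meas_op l m y j = g m j \<bullet> y" if "j \<in> {1..m}" for m y j
    using that by (simp add: meas_op_def g)
  have gramX: "disc_gram K l m = S m" for m
    unfolding disc_gram_def S_def by (rule ext) (rule gram_eq_frame_op[OF disc])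
  have limA: "(\<lambda>m. frame_op {1..m} (g m) y) \<longlonglongrightarrow> blinfun_apply A y" for y
    using lim[of y] by (simp only: gram_eq_frame_op[OF meas])
  have SK: "S m x = Ks (frame_op {1..m} (g m) (blinfun_apply K x))" for m x
    unfolding S_def frame_op_def Ks.sum Ks.scaleR h_def[symmetric] h ..
  have limT: "(\<lambda>m. S m x) \<longlonglongrightarrow> Ks (blinfun_apply A (blinfun_apply K x))" for x
    unfolding SK by (intro Ks.tendsto limA)
  have symA: "blinfun_apply A y \<bullet> z = y \<bullet> blinfun_apply A z" for y z
  proof (rule LIMSEQ_unique)
    show "(\<lambda>m. frame_op {1..m} (g m) y \<bullet> z) \<longlonglongrightarrow> blinfun_apply A y \<bullet> z"
      by (intro tendsto_intros limA)
    show "(\<lambda>m. frame_op {1..m} (g m) y \<bullet> z) \<longlonglongrightarrow> y \<bullet> blinfun_apply A z"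
      unfolding frame_op_sym by (intro tendsto_intros limA)
  qed
  have posA: "0 \<le> blinfun_apply A y \<bullet> y" for y
  proof (rule LIMSEQ_le_const)
    show "(\<lambda>m. frame_op {1..m} (g m) y \<bullet> y) \<longlonglongrightarrow> blinfun_apply A y \<bullet> y"
      by (intro tendsto_intros limA)
  qed (auto simp: frame_op_inner intro!: sum_nonneg)
  have dense: "closure (range (\<lambda>x. Ks (blinfun_apply A (blinfun_apply K x)))) = UNIV"
    by (rule dense_range_adjoint_conjugate[OF Ks_bl Ks K(1) A symA posA])
  define \<Lambda> where "\<Lambda> = spectral_bound K l"
  have "0 < (norm K)\<^sup>2" using K(2) by simp
  also have "\<dots> \<le> \<Lambda>" by (simp add: \<Lambda>_def spectral_bound_def)
  finally have \<Lambda>: "0 < \<Lambda>" .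
  have bl: "bounded_linear (S m)" for m unfolding S_def by (rule bounded_linear_frame_op)
  \<comment> \<open>Without this bound the real supremum in \<open>spectral_bound\<close> need not
    dominate the individual norms.\<close>
  have "bdd_above ((\<lambda>m. norm (Blinfun (S m))) ` {1..})"
  proof (rule pointwise_bounded_imp_bounded)
    fix x
    have "Bseq (\<lambda>m. S m x)" using limT[of x] convergentI convergent_imp_Bseq by blast
    then obtain B where "\<And>m. norm (S m x) \<le> B" by (auto simp: Bseq_def)
    then show "bdd_above ((\<lambda>m. norm (blinfun_apply (Blinfun (S m)) x)) ` {1..})"
      by (intro bdd_aboveI2[of _ _ B]) (simp add: bounded_linear_Blinfun_apply[OF bl])
  qed
  then have bdd: "bdd_above ((\<lambda>m. onorm (disc_gram K l m)) ` {1..})"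
    by (simp add: norm_blinfun.rep_eq bounded_linear_Blinfun_apply[OF bl] gramX)
  have onorm_le: "onorm (S m) \<le> \<Lambda>" if "1 \<le> m" for m
    using cSUP_upper[OF _ bdd, of m] that by (simp add: \<Lambda>_def spectral_bound_def gramX le_max_iff_disj)
  obtain C1 C3 CN \<nu> where bounds: "filter_bounds \<Lambda> F C0 C1 C3 CN \<nu>"
    using regularising_filter_bounds[OF F(1)[folded \<Lambda>_def] \<Lambda> F(2)] by blast
  then interpret filter_bounds \<Lambda> F C0 C1 C3 CN \<nu> .
  define a where "a = (\<tau> + \<tau>1) * C0 * sqrt \<Lambda>"
  define b where "b = (C0\<^sup>2 + 1) * norm x"
  define s where "s = sqrt CN * \<tau>1"
  have "0 \<le> a" "0 \<le> b" "0 \<le> s" "0 < \<tau> - \<tau>1"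
    using C \<tau> \<Lambda> by (auto simp: a_def b_def s_def)
  from discrepancy_bound_small[OF this(1,2) C(2,3) this(3) C(6) this(4) q(1) \<epsilon>]
  obtain \<eta> where \<eta>: "0 < \<eta>" and small: "\<And>W. 0 \<le> W \<Longrightarrow> \<exists>d0>0. \<forall>d \<alpha>. 0 < d \<longrightarrow> d < d0 \<longrightarrow>
      \<alpha> = 1 \<or> (\<exists>\<beta>>0. \<alpha> = q * \<beta> \<and> (\<tau> - \<tau>1) * d \<le> C3 * \<beta> powr (\<nu> / 2) * W + C1 * sqrt \<beta> * \<eta>) \<longrightarrow>
      sqrt (a * d * W + b * \<eta>) + s * d / sqrt \<alpha> < \<epsilon>"
    by blast
  have "x \<in> closure (range (\<lambda>x. Ks (blinfun_apply A (blinfun_apply K x))))" using dense by simp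
  then obtain w where w: "dist (Ks (blinfun_apply A (blinfun_apply K w))) x < \<eta>"
    using \<eta> unfolding closure_approachable by auto
  have "(\<lambda>m. norm (x - S m w)) \<longlonglongrightarrow> norm (x - Ks (blinfun_apply A (blinfun_apply K w)))"
    by (intro tendsto_intros limT)
  then have "eventually (\<lambda>m. norm (x - S m w) < \<eta>) sequentially"
    by (rule order_tendstoD) (use w in \<open>simp add: dist_norm norm_minus_commute\<close>)
  then obtain m0 where m0: "\<And>m. m0 \<le> m \<Longrightarrow> norm (x - S m w) < \<eta>" by (auto simp: eventually_sequentially)
  obtain d0 where d0: "0 < d0" "\<And>d \<alpha>. 0 < d \<Longrightarrow> d < d0 \<Longrightarrow>
      \<alpha> = 1 \<or> (\<exists>\<beta>>0. \<alpha> = q * \<beta> \<and> (\<tau> - \<tau>1) * d \<le> C3 * \<beta> powr (\<nu> / 2) * norm w + C1 * sqrt \<beta> * \<eta>) \<Longrightarrow>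
      sqrt (a * d * norm w + b * \<eta>) + s * d / sqrt \<alpha> < \<epsilon>"
    using small[OF norm_ge_zero[of w]] by blast
  show ?thesis
  proof (rule that[OF d0(1)])
    fix m d \<xi> Y
    \<comment> \<open>Level 0 is excluded because the supremum in \<open>spectral_bound\<close>
      starts at 1.\<close>
    assume m: "max m0 1 \<le> m" and d: "0 < d" "d < d0" and \<xi>: "C0 * L2_set \<xi> {1..m} \<le> \<tau>1 * d"
      and Y: "\<And>j. j \<in> {1..m} \<Longrightarrow> Y j = blinfun_apply (l m j) (blinfun_apply K x) + \<xi> j"
    obtain U where "eigen_system (frame_op {1..m} (h m)) U"
      "\<And>x. (\<And>u. u \<in> U \<Longrightarrow> u \<bullet> x = 0) \<Longrightarrow> frame_op {1..m} (h m) x = 0"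
      by (rule frame_op_spectral[of "{1..m}" "h m"]) auto
    then interpret filtered_svd "{1..m}" "h m" U \<Lambda> F C0 C1 C3 CN \<nu>
      by unfold_locales (use onorm_le[of m] m in \<open>auto simp: S_def\<close>)
    note err = discrepancy_principle_error[OF q \<tau>(2) d(1) \<xi>, of x w "x - S m w" \<eta>]
    let ?v = "\<lambda>j. h m j \<bullet> x + \<xi> j"
    have reg: "reg_op K l F m \<alpha> Y = filt (F \<alpha>) ?v" for \<alpha>
    proof -
      have "reg_op K l F m \<alpha> Y = filt (F \<alpha>) Y"
        unfolding reg_op_def gramX S_def spectral_calculus_frame[symmetric]
        by (simp only: adjoint_Rm_eq[of m "disc_op K l m" "h m", OF disc])
      also have "\<dots> = filt (F \<alpha>) ?v" by (rule filt_cong) (simp add: Y g h)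
      finally show ?thesis .
    qed
    have L2: "L2_set (\<lambda>j. disc_op K l m z j - Y j) {1..m} = L2_set (\<lambda>j. h m j \<bullet> z - ?v j) {1..m}" for z
      by (rule L2_set_cong) (simp_all add: disc Y g h)
    have e: "x = frame_op {1..m} (h m) w + (x - S m w)" "norm (x - S m w) \<le> \<eta>"
      using m0[of m] m by (simp_all add: S_def)
    show "norm (reg_op K l F m (q ^ (LEAST k. L2_set (\<lambda>j. disc_op K l m (reg_op K l F m (q ^ k) Y) j - Y j) {1..m}
              \<le> \<tau> * d)) Y - x) < \<epsilon>"
      unfolding reg L2
      by (rule le_less_trans[OF err(1)[OF e]]) (use d0(2)[OF d err(2)[OF e]] in \<open>simp add: a_def b_def s_def\<close>)
  qed
qed

section \<open>Independent errors\<close>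

text \<open>Events chosen for \<open>L\<close> are carried to the indices \<open>f j\<close> through
  the inverse of \<open>f\<close>. In the first error model this extracts one row from the family
  with three indices.\<close>

lemma (in prob_space) indep_sets_reindex:
  assumes "indep_sets F I" "inj_on f J" "f ` J \<subseteq> I"
  shows "indep_sets (\<lambda>j. F (f j)) J"
  unfolding indep_sets_def
proof (intro conjI ballI allI impI)
  show "F (f j) \<subseteq> events" if "j \<in> J" for j
    using assms that unfolding indep_sets_def by blast
  fix L A assume L: "L \<subseteq> J" "L \<noteq> {}" "finite L" and A: "A \<in> Pi L (\<lambda>j. F (f j))"
  have inj: "inj_on f L" using assms(2) L(1) by (rule inj_on_subset)
  define B where "B = A \<circ> the_inv_into L f"
  have B: "B (f j) = A j" if "j \<in> L" for j
    using that by (simp add: B_def the_inv_into_f_f[OF inj])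
  have "B \<in> Pi (f ` L) F" using A B by (auto simp: Pi_iff)
  moreover have "f ` L \<subseteq> I" "f ` L \<noteq> {}" "finite (f ` L)" using L assms(3) by auto
  ultimately have "prob (\<Inter>i\<in>f ` L. B i) = (\<Prod>i\<in>f ` L. prob (B i))"
    using assms(1) unfolding indep_sets_def by blast
  moreover have "(\<Inter>i\<in>f ` L. B i) = (\<Inter>j\<in>L. A j)" using B by simp
  moreover have "(\<Prod>i\<in>f ` L. prob (B i)) = (\<Prod>j\<in>L. prob (A j))"
    using B by (simp add: prod.reindex[OF inj])
  ultimately show "prob (\<Inter>j\<in>L. A j) = (\<Prod>j\<in>L. prob (A j))" by simp
qed

lemma (in prob_space) indep_vars_reindex:
  assumes "indep_vars M' X I" "inj_on f J" "f ` J \<subseteq> I"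
  shows "indep_vars (\<lambda>j. M' (f j)) (\<lambda>j. X (f j)) J"
  using assms(1) indep_sets_reindex[OF _ assms(2,3)] assms(3)
  unfolding indep_vars_def2 by blast

text \<open>An index common to both sets contributes a square, any other a single variable of mean
  zero. Independence factorises the expectation, so one unmatched index annihilates it, and second
  moments suffice.\<close>

lemma (in prob_space) product_orthogonality:
  fixes X :: "'i \<Rightarrow> 'a \<Rightarrow> real"
  assumes indep: "indep_vars (\<lambda>_. borel) X I"
    and int: "\<And>i. i \<in> I \<Longrightarrow> integrable M (X i)" "\<And>i. i \<in> I \<Longrightarrow> integrable M (\<lambda>\<omega>. (X i \<omega>)\<^sup>2)"
    and mean: "\<And>i. i \<in> I \<Longrightarrow> expectation (X i) = 0"
    and S: "finite S" "S \<subseteq> I" "finite S'" "S' \<subseteq> I"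
  shows "integrable M (\<lambda>\<omega>. (\<Prod>i\<in>S. X i \<omega>) * (\<Prod>i\<in>S'. X i \<omega>))" (is ?int)
    and "expectation (\<lambda>\<omega>. (\<Prod>i\<in>S. X i \<omega>) * (\<Prod>i\<in>S'. X i \<omega>))
      = (if S = S' then \<Prod>i\<in>S. expectation (\<lambda>\<omega>. (X i \<omega>)\<^sup>2) else 0)" (is ?eq)
proof -
  define f where "f i x = (if i \<in> S \<inter> S' then x\<^sup>2 else x :: real)" for i and x
  have split: "(\<Prod>i\<in>S. X i \<omega>) * (\<Prod>i\<in>S'. X i \<omega>) = (\<Prod>i\<in>S \<union> S'. f i (X i \<omega>))" for \<omega>
  proof -
    have "(\<Prod>i\<in>S. X i \<omega>) = (\<Prod>i\<in>S \<union> S'. if i \<in> S then X i \<omega> else 1)"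
      using S by (subst prod.inter_restrict[symmetric]) (auto intro: prod.cong)
    moreover have "(\<Prod>i\<in>S'. X i \<omega>) = (\<Prod>i\<in>S \<union> S'. if i \<in> S' then X i \<omega> else 1)"
      using S by (subst prod.inter_restrict[symmetric]) (auto intro: prod.cong)
    ultimately show ?thesis
      by (simp only: prod.distrib[symmetric]) (rule prod.cong; auto simp: f_def power2_eq_square)
  qed
  have ind: "indep_vars (\<lambda>_. borel) (\<lambda>i \<omega>. f i (X i \<omega>)) (S \<union> S')"
    by (rule indep_vars_compose2[OF indep_vars_subset[OF indep]]) (use S in \<open>auto simp: f_def\<close>)
  have int': "integrable M (\<lambda>\<omega>. f i (X i \<omega>))" if "i \<in> S \<union> S'" for i
    using int that S by (cases "i \<in> S \<inter> S'") (auto simp: f_def)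
  have fin: "finite (S \<union> S')" using S by simp
  show ?int unfolding split by (rule indep_vars_integrable[OF fin ind int'])
  have "expectation (\<lambda>\<omega>. (\<Prod>i\<in>S. X i \<omega>) * (\<Prod>i\<in>S'. X i \<omega>)) = (\<Prod>i\<in>S \<union> S'. expectation (\<lambda>\<omega>. f i (X i \<omega>)))"
    unfolding split by (rule indep_vars_lebesgue_integral[OF fin ind int'])
  also have "\<dots> = (if S = S' then \<Prod>i\<in>S. expectation (\<lambda>\<omega>. (X i \<omega>)\<^sup>2) else 0)"
  proof (cases "S = S'")
    case True
    then show ?thesis by (simp add: f_def)
  next
    case False
    then obtain i where i: "i \<in> S \<union> S'" "i \<notin> S \<inter> S'" by blast
    then have "expectation (\<lambda>\<omega>. f i (X i \<omega>)) = 0" using mean[of i] S by (auto simp: f_def)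
    then show ?thesis using False fin i(1) by (auto simp: prod_zero_iff)
  qed
  finally show ?eq .
qed

text \<open>Injectivity of \<open>S\<close> gives distinct products distinct index sets, so all
  cross terms vanish. Singletons yield the variance of a sum, pairs the mixed products of
  errors.\<close>

lemma (in prob_space) second_moment_sum_products:
  fixes X :: "'i \<Rightarrow> 'a \<Rightarrow> real"
  assumes X: "indep_vars (\<lambda>_. borel) X I"
    "\<And>i. i \<in> I \<Longrightarrow> integrable M (X i)" "\<And>i. i \<in> I \<Longrightarrow> integrable M (\<lambda>\<omega>. (X i \<omega>)\<^sup>2)"
    "\<And>i. i \<in> I \<Longrightarrow> expectation (X i) = 0"
    and P: "finite P" "inj_on S P" "\<And>p. p \<in> P \<Longrightarrow> finite (S p) \<and> S p \<subseteq> I"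
  shows "integrable M (\<lambda>\<omega>. (\<Sum>p\<in>P. \<Prod>i\<in>S p. X i \<omega>)\<^sup>2)" (is ?int)
    and "expectation (\<lambda>\<omega>. (\<Sum>p\<in>P. \<Prod>i\<in>S p. X i \<omega>)\<^sup>2) = (\<Sum>p\<in>P. \<Prod>i\<in>S p. expectation (\<lambda>\<omega>. (X i \<omega>)\<^sup>2))" (is ?eq)
proof -
  have sq: "(\<Sum>p\<in>P. \<Prod>i\<in>S p. X i \<omega>)\<^sup>2 = (\<Sum>p\<in>P. \<Sum>p'\<in>P. (\<Prod>i\<in>S p. X i \<omega>) * (\<Prod>i\<in>S p'. X i \<omega>))" for \<omega>
    by (simp add: power2_eq_square sum_product)
  note orth = product_orthogonality[OF X]
  show ?int unfolding sq using P by (intro Bochner_Integration.integrable_sum orth(1)) auto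
  have "expectation (\<lambda>\<omega>. (\<Sum>p\<in>P. \<Prod>i\<in>S p. X i \<omega>)\<^sup>2)
      = (\<Sum>p\<in>P. \<Sum>p'\<in>P. expectation (\<lambda>\<omega>. (\<Prod>i\<in>S p. X i \<omega>) * (\<Prod>i\<in>S p'. X i \<omega>)))"
    unfolding sq using P by (simp add: orth(1) Bochner_Integration.integral_sum)
  also have "\<dots> = (\<Sum>p\<in>P. \<Sum>p'\<in>P. if p = p' then \<Prod>i\<in>S p. expectation (\<lambda>\<omega>. (X i \<omega>)\<^sup>2) else 0)"
    using P by (intro sum.cong refl) (auto simp: orth(2) inj_on_eq_iff)
  also have "\<dots> = (\<Sum>p\<in>P. \<Prod>i\<in>S p. expectation (\<lambda>\<omega>. (X i \<omega>)\<^sup>2))"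
    using P(1) by simp
  finally show ?eq .
qed

section \<open>Weak law and concentration\<close>

lemma (in prob_space) prob_abs_ge_le_second_moment:
  fixes W :: "'a \<Rightarrow> real"
  assumes [measurable]: "random_variable borel W" and "integrable M (\<lambda>\<omega>. (W \<omega>)\<^sup>2)" "0 < a"
  shows "prob {\<omega>\<in>space M. a \<le> \<bar>W \<omega>\<bar>} \<le> expectation (\<lambda>\<omega>. (W \<omega>)\<^sup>2) / a\<^sup>2"
proof -
  have "{\<omega>\<in>space M. a \<le> \<bar>W \<omega>\<bar>} = {\<omega>\<in>space M. a\<^sup>2 \<le> (W \<omega>)\<^sup>2}"
    using assms(3) by (auto simp: abs_le_square_iff[symmetric])
  then show ?thesis
    using integral_Markov_inequality_measure[OF assms(2), of "space M" "a\<^sup>2"] assms(3) by simp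
qed

text \<open>Chebyshev's inequality for the truncated variables and Markov's inequality for the rest.\<close>

lemma (in prob_space) truncated_weak_law:
  fixes Z :: "'i \<Rightarrow> 'a \<Rightarrow> real" and v c \<gamma> \<eta> :: real
  assumes I: "finite I" "I \<noteq> {}" and indep: "indep_vars (\<lambda>_. borel) Z I"
    and Z: "\<And>i \<omega>. i \<in> I \<Longrightarrow> 0 \<le> Z i \<omega>" "\<And>i. i \<in> I \<Longrightarrow> integrable M (Z i)"
    "\<And>i. i \<in> I \<Longrightarrow> expectation (Z i) = v"
    and tail: "\<And>i. i \<in> I \<Longrightarrow> expectation (\<lambda>\<omega>. Z i \<omega> - min (Z i \<omega>) c) \<le> \<eta>"
    and c: "0 \<le> c" and \<gamma>: "0 < \<gamma>" "3 * \<eta> \<le> \<gamma>"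
  shows "prob {\<omega>\<in>space M. card I * \<gamma> \<le> \<bar>(\<Sum>i\<in>I. Z i \<omega>) - card I * v\<bar>}
      \<le> 9 * c\<^sup>2 / (card I * \<gamma>\<^sup>2) + 3 * \<eta> / \<gamma>"
proof -
  have meas[measurable]: "i \<in> I \<Longrightarrow> random_variable borel (Z i)" for i using Z(2) by auto
  define N where "N = real (card I)"
  have N: "0 < N" using I by (simp add: N_def card_gt_0_iff)
  define Y where "Y i \<omega> = min (Z i \<omega>) c" for i \<omega>
  define R where "R i \<omega> = Z i \<omega> - Y i \<omega>" for i \<omega>
  have [measurable]: "random_variable borel (Y i)" "random_variable borel (R i)" if "i \<in> I" for i
    using that unfolding R_def Y_def by measurable
  have Y: "0 \<le> Y i \<omega>" "Y i \<omega> \<le> c" if "i \<in> I" for i \<omega> using Z(1)[OF that] c by (auto simp: Y_def)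
  have intY: "integrable M (Y i)" if "i \<in> I" for i
    using Y[OF that] that by (intro integrable_const_bound[where B = c]) auto
  have intR: "integrable M (R i)" if "i \<in> I" for i
    unfolding R_def by (intro Bochner_Integration.integrable_diff Z(2) intY that)
  have R0: "0 \<le> R i \<omega>" for i \<omega> by (simp add: R_def Y_def)
  have ER: "expectation (R i) \<le> \<eta>" if "i \<in> I" for i using tail[OF that] unfolding R_def[abs_def] Y_def .
  define C where "C i \<omega> = Y i \<omega> - expectation (Y i)" for i \<omega>
  have [measurable]: "random_variable borel (C i)" if "i \<in> I" for i
    using that unfolding C_def by measurable
  have EY: "0 \<le> expectation (Y i)" "expectation (Y i) \<le> c" if "i \<in> I" for i
    using Y[OF that] intY[OF that] by (auto intro: integral_nonneg_AE integral_le_const)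
  have Cb: "\<bar>C i \<omega>\<bar> \<le> c" if "i \<in> I" for i \<omega>
    using Y[OF that, of \<omega>] EY[OF that] by (auto simp: C_def abs_le_iff)
  have intC: "integrable M (C i)" if "i \<in> I" for i
    unfolding C_def using intY[OF that] by simp
  have C2: "(C i \<omega>)\<^sup>2 \<le> c\<^sup>2" if "i \<in> I" for i \<omega> using Cb[OF that] c by (simp add: abs_le_square_iff[symmetric])
  have intC2: "integrable M (\<lambda>\<omega>. (C i \<omega>)\<^sup>2)" if "i \<in> I" for i
    using C2[OF that] that by (intro integrable_const_bound[where B = "c\<^sup>2"]) auto
  have EC2: "expectation (\<lambda>\<omega>. (C i \<omega>)\<^sup>2) \<le> c\<^sup>2" if "i \<in> I" for i
    using C2[OF that] intC2[OF that] by (auto intro: integral_le_const)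
  have EC: "expectation (C i) = 0" if "i \<in> I" for i
    unfolding C_def using intY[OF that] by (simp add: prob_space)
  have indC: "indep_vars (\<lambda>_. borel) C I"
    unfolding C_def Y_def by (rule indep_vars_compose2[OF indep]) auto
  note sm = second_moment_sum_products[OF indC intC intC2 EC I(1), of "\<lambda>i. {i}"]
  have smi: "integrable M (\<lambda>\<omega>. (\<Sum>i\<in>I. C i \<omega>)\<^sup>2)" using sm(1) by (simp add: inj_on_def)
  have sme: "expectation (\<lambda>\<omega>. (\<Sum>i\<in>I. C i \<omega>)\<^sup>2) \<le> N * c\<^sup>2"
    using sm(2) sum_bounded_above[of I "\<lambda>i. expectation (\<lambda>\<omega>. (C i \<omega>)\<^sup>2)" "c\<^sup>2"] EC2
    by (simp add: inj_on_def N_def)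
  let ?B1 = "{\<omega>\<in>space M. N * \<gamma> / 3 \<le> \<bar>\<Sum>i\<in>I. C i \<omega>\<bar>}"
  let ?B2 = "{\<omega>\<in>space M. N * \<gamma> / 3 \<le> (\<Sum>i\<in>I. R i \<omega>)}"
  have meas1: "?B1 \<in> events" "?B2 \<in> events" by measurable
  have "prob ?B1 \<le> expectation (\<lambda>\<omega>. (\<Sum>i\<in>I. C i \<omega>)\<^sup>2) / (N * \<gamma> / 3)\<^sup>2"
    using N \<gamma> by (intro prob_abs_ge_le_second_moment smi) auto
  also have "\<dots> \<le> (N * c\<^sup>2) / (N * \<gamma> / 3)\<^sup>2" by (intro divide_right_mono sme) auto
  also have "\<dots> = 9 * c\<^sup>2 / (N * \<gamma>\<^sup>2)" using N \<gamma> by (simp add: power2_eq_square field_simps)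
  finally have B1: "prob ?B1 \<le> 9 * c\<^sup>2 / (N * \<gamma>\<^sup>2)" .
  have ERs: "expectation (\<lambda>\<omega>. \<Sum>i\<in>I. R i \<omega>) \<le> N * \<eta>"
    using intR sum_bounded_above[of I "\<lambda>i. expectation (R i)" \<eta>] ER by (simp add: N_def)
  have "prob ?B2 \<le> expectation (\<lambda>\<omega>. \<Sum>i\<in>I. R i \<omega>) / (N * \<gamma> / 3)"
    by (rule integral_Markov_inequality_measure[of _ _ "space M"])
      (use intR N \<gamma> R0 in \<open>auto intro!: sum_nonneg\<close>)
  also have "\<dots> \<le> (N * \<eta>) / (N * \<gamma> / 3)" using N \<gamma> by (intro divide_right_mono ERs) auto
  also have "\<dots> = 3 * \<eta> / \<gamma>" using N by simp
  finally have B2: "prob ?B2 \<le> 3 * \<eta> / \<gamma>" .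
  \<comment> \<open>The deviation is the centred truncated sum plus the remainder minus its mean.
    That mean is at most \<open>N * \<gamma> / 3\<close>, so one of the other two terms must reach a
    third.\<close>
  have "{\<omega>\<in>space M. N * \<gamma> \<le> \<bar>(\<Sum>i\<in>I. Z i \<omega>) - N * v\<bar>} \<subseteq> ?B1 \<union> ?B2"
  proof
    fix \<omega> assume \<omega>: "\<omega> \<in> {\<omega>\<in>space M. N * \<gamma> \<le> \<bar>(\<Sum>i\<in>I. Z i \<omega>) - N * v\<bar>}"
    have v: "v = expectation (Y i) + expectation (R i)" if "i \<in> I" for i
      using Z(3)[OF that] intY[OF that] Z(2)[OF that] by (simp add: R_def[abs_def])
    have Nv: "N * v = (\<Sum>i\<in>I. expectation (Y i)) + (\<Sum>i\<in>I. expectation (R i))"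
      unfolding sum.distrib[symmetric] by (simp add: v[symmetric] N_def)
    have eq: "(\<Sum>i\<in>I. Z i \<omega>) - N * v = (\<Sum>i\<in>I. C i \<omega>) + (\<Sum>i\<in>I. R i \<omega>) - (\<Sum>i\<in>I. expectation (R i))"
      unfolding Nv by (simp add: C_def R_def sum_subtractf)
    have "(\<Sum>i\<in>I. expectation (R i)) \<le> N * \<eta>"
      using sum_bounded_above[of I "\<lambda>i. expectation (R i)" \<eta>] ER by (simp add: N_def)
    also have "\<dots> \<le> N * (\<gamma> / 3)" using N \<gamma> by (intro mult_left_mono) auto
    finally have 1: "(\<Sum>i\<in>I. expectation (R i)) \<le> N * \<gamma> / 3" by simp
    have 2: "0 \<le> (\<Sum>i\<in>I. expectation (R i))" "0 \<le> (\<Sum>i\<in>I. R i \<omega>)"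
      using R0 by (auto intro!: sum_nonneg)
    show "\<omega> \<in> ?B1 \<union> ?B2"
    proof (rule ccontr)
      assume "\<omega> \<notin> ?B1 \<union> ?B2"
      then have "\<bar>\<Sum>i\<in>I. C i \<omega>\<bar> < N * \<gamma> / 3" "(\<Sum>i\<in>I. R i \<omega>) < N * \<gamma> / 3" using \<omega> by auto
      then have "\<bar>(\<Sum>i\<in>I. Z i \<omega>) - N * v\<bar> < N * \<gamma>" unfolding eq using 1 2 by linarith
      then show False using \<omega> by simp
    qed
  qed
  then have "prob {\<omega>\<in>space M. N * \<gamma> \<le> \<bar>(\<Sum>i\<in>I. Z i \<omega>) - N * v\<bar>} \<le> prob (?B1 \<union> ?B2)"
    using meas1 by (intro finite_measure_mono) auto
  also have "\<dots> \<le> prob ?B1 + prob ?B2" by (intro measure_Un_le meas1)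
  finally show ?thesis using B1 B2 unfolding N_def by linarith
qed

lemma square_sum_eq:
  fixes x :: "nat \<Rightarrow> real"
  shows "(\<Sum>i=1..n. x i)\<^sup>2 = (\<Sum>i=1..n. (x i)\<^sup>2) + 2 * (\<Sum>b=1..n. \<Sum>a\<in>{1..<b}. x a * x b)"
proof (induction n)
  case (Suc n)
  have "{1..<Suc n} = {1..n}" by auto
  then show ?case
    using Suc by (simp add: power2_sum sum_distrib_right atLeastLessThanSuc_atLeastAtMost)
qed simp

text \<open>The mixed products of errors of the same column are pairwise orthogonal, so the cross terms need
  only second moments; the squares are governed by the weak law of large numbers.\<close>

lemma (in prob_space) array_concentration:
  fixes X :: "nat \<times> nat \<Rightarrow> 'a \<Rightarrow> real" and v c \<eta> \<gamma> :: real and m n :: nat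
  assumes X: "indep_vars (\<lambda>_. borel) X ({1..} \<times> {1..})"
    "\<And>k. k \<in> {1..} \<times> {1..} \<Longrightarrow> integrable M (X k)"
    "\<And>k. k \<in> {1..} \<times> {1..} \<Longrightarrow> integrable M (\<lambda>\<omega>. (X k \<omega>)\<^sup>2)"
    "\<And>k. k \<in> {1..} \<times> {1..} \<Longrightarrow> expectation (X k) = 0"
    and var: "\<And>k. k \<in> {1..} \<times> {1..} \<Longrightarrow> expectation (\<lambda>\<omega>. (X k \<omega>)\<^sup>2) = v"
    and tail: "\<And>k. k \<in> {1..} \<times> {1..} \<Longrightarrow>
      expectation (\<lambda>\<omega>. (X k \<omega>)\<^sup>2 - min ((X k \<omega>)\<^sup>2) (c * v)) \<le> \<eta> * v"
    and c: "0 \<le> c" and v: "0 < v" and \<gamma>: "0 < \<gamma>" "3 * \<eta> \<le> \<gamma>" and mn: "1 \<le> m" "1 \<le> n"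
  obtains B where "B \<in> events"
    "prob B \<le> 9 * c\<^sup>2 / (real m * real n * \<gamma>\<^sup>2) + 3 * \<eta> / \<gamma> + 4 / (\<gamma>\<^sup>2 * real m)"
    "\<And>\<omega>. \<omega> \<in> space M - B \<Longrightarrow>
      \<bar>(\<Sum>j=1..m. \<Sum>i=1..n. (X (i, j) \<omega>)\<^sup>2) - real m * real n * v\<bar> < real m * real n * v * \<gamma>"
    "\<And>\<omega>. \<omega> \<in> space M - B \<Longrightarrow>
      \<bar>(\<Sum>j=1..m. (\<Sum>i=1..n. X (i, j) \<omega>)\<^sup>2) - (\<Sum>j=1..m. \<Sum>i=1..n. (X (i, j) \<omega>)\<^sup>2)\<bar>
        < real m * real n * v * \<gamma>"
proof -
  define I where "I = {1..n} \<times> {1..m}"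
  have I: "finite I" "I \<noteq> {}" "I \<subseteq> {1..} \<times> {1..}" "card I = m * n"
    using mn by (auto simp: I_def)
  have sumI: "(\<Sum>k\<in>I. f k) = (\<Sum>j=1..m. \<Sum>i=1..n. f (i, j))" for f :: "nat \<times> nat \<Rightarrow> real"
    unfolding I_def by (subst sum.swap) (simp add: sum.cartesian_product)
  have [measurable]: "random_variable borel (X k)" if "k \<in> {1..} \<times> {1..}" for k using X(2)[OF that] by auto
  have mXI[measurable]: "random_variable borel (X k)" if "k \<in> I" for k using X(2)[of k] that I(3) by auto
  define S where "S \<omega> = (\<Sum>k\<in>I. (X k \<omega>)\<^sup>2)" for \<omega>
  define P where "P = (SIGMA j:{1..m}. SIGMA b:{1..n}. {1..<b})"
  \<comment> \<open>The two indices of a mixed product as a set; \<open>a < b\<close> makes the set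
    determine the triple and have two elements.\<close>
  define pr where "pr = (\<lambda>(j, b, a). {(a, j), (b, j)} :: (nat \<times> nat) set)"
  define W where "W \<omega> = (\<Sum>p\<in>P. \<Prod>k\<in>pr p. X k \<omega>)" for \<omega>
  have finP: "finite P" by (simp add: P_def)
  have inj: "inj_on pr P"
    by (auto simp: inj_on_def pr_def P_def doubleton_eq_iff)
  have prI: "finite (pr p) \<and> pr p \<subseteq> {1..} \<times> {1..}" if "p \<in> P" for p
    using that by (auto simp: pr_def P_def)
  have W_eq: "W \<omega> = (\<Sum>j=1..m. \<Sum>b=1..n. \<Sum>a\<in>{1..<b}. X (a, j) \<omega> * X (b, j) \<omega>)" for \<omega>
  proof -
    have "W \<omega> = (\<Sum>(j, b, a)\<in>P. X (a, j) \<omega> * X (b, j) \<omega>)"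
      unfolding W_def by (intro sum.cong refl) (auto simp: pr_def P_def)
    then show ?thesis by (simp add: P_def sum.Sigma split_def)
  qed
  have cross: "(\<Sum>j=1..m. (\<Sum>i=1..n. X (i, j) \<omega>)\<^sup>2) = S \<omega> + 2 * W \<omega>" for \<omega>
    unfolding square_sum_eq sum.distrib S_def sumI W_eq by (simp add: sum_distrib_left)
  note sm = second_moment_sum_products[OF X finP inj prI]
  have mW[measurable]: "random_variable borel W"
  proof -
    have "random_variable borel (X k)" if "p \<in> P" "k \<in> pr p" for p k
      using prI[OF that(1)] that(2) X(2)[of k] by auto
    then show ?thesis unfolding W_def by (intro borel_measurable_sum borel_measurable_prod)
  qed
  have mS[measurable]: "random_variable borel S" unfolding S_def by measurable
  have "(\<Prod>k\<in>pr p. expectation (\<lambda>\<omega>. (X k \<omega>)\<^sup>2)) = v\<^sup>2" if "p \<in> P" for p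
    using that by (auto simp: pr_def P_def var) (simp add: power2_eq_square)
  then have EW: "expectation (\<lambda>\<omega>. (W \<omega>)\<^sup>2) = card P * v\<^sup>2" using sm(2) by (simp add: W_def)
  \<comment> \<open>A crude count suffices: in Chebyshev's bound the powers of \<open>n\<close>
    cancel and \<open>1 / m\<close> remains.\<close>
  have "card P \<le> card ({1..m} \<times> {1..n} \<times> {1..n})"
    by (intro card_mono) (auto simp: P_def)
  then have "real (card P) \<le> real (m * (n * n))" by (simp only: of_nat_le_iff) simp
  then have cP: "real (card P) \<le> real m * (real n)\<^sup>2" by (simp add: power2_eq_square)
  let ?N = "real m * real n * v * \<gamma>"
  have N: "0 < ?N" using mn v \<gamma> by simp
  let ?B1 = "{\<omega>\<in>space M. ?N \<le> \<bar>S \<omega> - real m * real n * v\<bar>}"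
  \<comment> \<open>Half the threshold, because the cross terms add up to
    \<open>2 * W \<omega>\<close>.\<close>
  let ?B2 = "{\<omega>\<in>space M. ?N / 2 \<le> \<bar>W \<omega>\<bar>}"
  have B1: "prob ?B1 \<le> 9 * c\<^sup>2 / (real m * real n * \<gamma>\<^sup>2) + 3 * \<eta> / \<gamma>"
  proof -
    have "prob {\<omega>\<in>space M. card I * (\<gamma> * v) \<le> \<bar>(\<Sum>i\<in>I. (X i \<omega>)\<^sup>2) - card I * v\<bar>}
      \<le> 9 * (c * v)\<^sup>2 / (card I * (\<gamma> * v)\<^sup>2) + 3 * (\<eta> * v) / (\<gamma> * v)"
      by (rule truncated_weak_law[OF I(1,2)])
        (use I(3) X var tail c v \<gamma> in \<open>auto intro!: indep_vars_compose2[OF indep_vars_subset[OF X(1) I(3)]]\<close>)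
    also have "9 * (c * v)\<^sup>2 / (card I * (\<gamma> * v)\<^sup>2) = 9 * c\<^sup>2 / (real m * real n * \<gamma>\<^sup>2)"
      using v by (simp add: I(4) power_mult_distrib)
    also have "3 * (\<eta> * v) / (\<gamma> * v) = 3 * \<eta> / \<gamma>" using v by simp
    finally show ?thesis by (simp add: I(4) S_def mult_ac)
  qed
  have B2: "prob ?B2 \<le> 4 / (\<gamma>\<^sup>2 * real m)"
  proof -
    have "prob ?B2 \<le> (card P * v\<^sup>2) / (?N / 2)\<^sup>2"
      unfolding EW[symmetric]
      by (intro prob_abs_ge_le_second_moment mW) (use sm(1) N in \<open>auto simp: W_def\<close>)
    also have "\<dots> \<le> (real m * (real n)\<^sup>2 * v\<^sup>2) / (?N / 2)\<^sup>2"
      by (intro divide_right_mono mult_right_mono cP) auto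
    also have "\<dots> = 4 / (\<gamma>\<^sup>2 * real m)"
      using mn v \<gamma> by (simp add: power2_eq_square field_simps)
    finally show ?thesis .
  qed
  show ?thesis
  proof (rule that[of "?B1 \<union> ?B2"])
    show "?B1 \<union> ?B2 \<in> events" by measurable
    have "prob (?B1 \<union> ?B2) \<le> prob ?B1 + prob ?B2" by (intro measure_Un_le) measurable
    then show "prob (?B1 \<union> ?B2) \<le> 9 * c\<^sup>2 / (real m * real n * \<gamma>\<^sup>2) + 3 * \<eta> / \<gamma> + 4 / (\<gamma>\<^sup>2 * real m)"
      using B1 B2 by linarith
    fix \<omega> assume \<omega>: "\<omega> \<in> space M - (?B1 \<union> ?B2)"
    then show "\<bar>(\<Sum>j=1..m. \<Sum>i=1..n. (X (i, j) \<omega>)\<^sup>2) - real m * real n * v\<bar> < ?N"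
      unfolding S_def sumI by auto
    have "\<bar>W \<omega>\<bar> < ?N / 2" using \<omega> by auto
    then show "\<bar>(\<Sum>j=1..m. (\<Sum>i=1..n. X (i, j) \<omega>)\<^sup>2) - (\<Sum>j=1..m. \<Sum>i=1..n. (X (i, j) \<omega>)\<^sup>2)\<bar> < ?N"
      unfolding cross unfolding S_def sumI by simp
  qed
qed

section \<open>The estimated noise level\<close>

lemma sum_sq_deviation:
  fixes x :: "nat \<Rightarrow> real"
  assumes "1 \<le> n"
  shows "(\<Sum>i=1..n. (x i - 1 / real n * (\<Sum>k=1..n. x k))\<^sup>2)
    = (\<Sum>i=1..n. (x i)\<^sup>2) - (\<Sum>i=1..n. x i)\<^sup>2 / real n"
proof -
  define s where "s = (\<Sum>k=1..n. x k)"
  have "(\<Sum>i=1..n. (x i - 1 / real n * s)\<^sup>2)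
      = (\<Sum>i=1..n. (x i)\<^sup>2) - (2 * s / real n) * (\<Sum>i=1..n. x i) + real n * (s / real n)\<^sup>2"
    by (simp add: power2_diff sum.distrib sum_subtractf sum_distrib_left sum_divide_distrib mult_ac)
  also have "(\<Sum>i=1..n. x i) = s" by (simp add: s_def)
  also have "(\<Sum>i=1..n. (x i)\<^sup>2) - (2 * s / real n) * s + real n * (s / real n)\<^sup>2
      = (\<Sum>i=1..n. (x i)\<^sup>2) - s\<^sup>2 / real n"
    using assms by (simp add: power2_eq_square field_simps)
  finally show ?thesis by (simp add: s_def)
qed

lemma obs_mean_eq:
  assumes "1 \<le> n" "j \<in> {1..m}"
  shows "obs_mean l y \<delta> m n \<omega> j = blinfun_apply (l m j) y + 1 / real n * (\<Sum>i=1..n. \<delta> m i j \<omega>)"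
  using assms by (simp add: obs_mean_def obs_def sum.distrib field_simps)

text \<open>Deviations from the mean do not see the exact data. What remains are exactly the two
  sums that \<open>array_concentration\<close> controls.\<close>

lemma noise_est_eq:
  assumes "1 \<le> m" "2 \<le> n"
  shows "(noise_est l y \<delta> m n \<omega>)\<^sup>2 =
     ((\<Sum>j=1..m. \<Sum>i=1..n. (\<delta> m i j \<omega>)\<^sup>2) - (\<Sum>j=1..m. (\<Sum>i=1..n. \<delta> m i j \<omega>)\<^sup>2) / real n)
       / (real n * (real n - 1))"
proof -
  have dev: "(\<Sum>i=1..n. (obs l y \<delta> m i j \<omega> - 1 / real n * (\<Sum>k=1..n. obs l y \<delta> m k j \<omega>))\<^sup>2)
      = (\<Sum>i=1..n. (\<delta> m i j \<omega>)\<^sup>2) - (\<Sum>i=1..n. \<delta> m i j \<omega>)\<^sup>2 / real n" for j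
  proof -
    have "1 / real n * (\<Sum>k=1..n. obs l y \<delta> m k j \<omega>)
        = blinfun_apply (l m j) y + 1 / real n * (\<Sum>k=1..n. \<delta> m k j \<omega>)"
      using assms by (simp add: obs_def sum.distrib field_simps)
    then show ?thesis using sum_sq_deviation[of n "\<lambda>i. \<delta> m i j \<omega>"] assms by (simp add: obs_def)
  qed
  have "0 \<le> sample_var l y \<delta> m n \<omega>"
    unfolding sample_var_def using assms by (intro mult_nonneg_nonneg sum_nonneg) auto
  then have "(noise_est l y \<delta> m n \<omega>)\<^sup>2 = real m / real n * sample_var l y \<delta> m n \<omega>"
    by (simp add: noise_est_def)
  also have "\<dots> = (\<Sum>j=1..m. (\<Sum>i=1..n. (\<delta> m i j \<omega>)\<^sup>2) - (\<Sum>i=1..n. \<delta> m i j \<omega>)\<^sup>2 / real n)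
      / (real n * (real n - 1))"
    unfolding sample_var_def dev sum_distrib_left[symmetric] using assms by simp
  finally show ?thesis by (simp add: sum_subtractf sum_divide_distrib)
qed

text \<open>Up to a relative error \<open>2 * \<gamma>\<close>, \<open>m * v / n\<close> bounds the
  squared noise norm from above and the squared estimate from below; the inequality between
  \<open>C\<close> and \<tau> absorbs both errors.\<close>

lemma noise_level_bounds:
  fixes \<delta> :: "nat \<Rightarrow> nat \<Rightarrow> nat \<Rightarrow> 'w \<Rightarrow> real" and v \<gamma> C \<tau> :: real
  assumes mn: "1 \<le> m" "4 \<le> n" and v: "0 < v" and \<gamma>: "0 < \<gamma>" "\<gamma> < 1 / 2"
    and C: "0 \<le> C" "0 \<le> \<tau>" "C\<^sup>2 * (1 + 2 * \<gamma>) \<le> \<tau>\<^sup>2 * (1 - 2 * \<gamma>)"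
    and S: "\<bar>(\<Sum>j=1..m. \<Sum>i=1..n. (\<delta> m i j \<omega>)\<^sup>2) - real m * real n * v\<bar> < real m * real n * v * \<gamma>"
    and Q: "\<bar>(\<Sum>j=1..m. (\<Sum>i=1..n. \<delta> m i j \<omega>)\<^sup>2) - (\<Sum>j=1..m. \<Sum>i=1..n. (\<delta> m i j \<omega>)\<^sup>2)\<bar>
      < real m * real n * v * \<gamma>"
  shows "0 < noise_est l y \<delta> m n \<omega>" "(noise_est l y \<delta> m n \<omega>)\<^sup>2 \<le> 4 * v * (real m / real n)"
    "C * L2_set (\<lambda>j. 1 / real n * (\<Sum>i=1..n. \<delta> m i j \<omega>)) {1..m} \<le> \<tau> * noise_est l y \<delta> m n \<omega>"
proof -
  define s where "s = (\<Sum>j=1..m. \<Sum>i=1..n. (\<delta> m i j \<omega>)\<^sup>2)"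
  define t where "t = (\<Sum>j=1..m. (\<Sum>i=1..n. \<delta> m i j \<omega>)\<^sup>2)"
  define e where "e = noise_est l y \<delta> m n \<omega>"
  define N where "N = real n"
  have N: "4 \<le> N" using mn by (simp add: N_def)
  define w where "w = real m * v"
  have w: "0 < w" using mn v by (simp add: w_def)
  have s: "\<bar>s - w * N\<bar> < w * N * \<gamma>" using S by (simp add: s_def w_def N_def mult_ac)
  have ts: "\<bar>t - s\<bar> < w * N * \<gamma>" using Q by (simp add: s_def t_def w_def N_def mult_ac)
  have t0: "0 \<le> t" by (simp add: t_def sum_nonneg)
  have e2: "e\<^sup>2 = (s - t / N) / (N * (N - 1))"
    using noise_est_eq[of m n] mn by (simp add: e_def s_def t_def N_def)
  have e0: "0 \<le> e"
  proof -
    have "0 \<le> sample_var l y \<delta> m n \<omega>"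
      unfolding sample_var_def using mn by (intro mult_nonneg_nonneg sum_nonneg) auto
    then show ?thesis by (simp add: e_def noise_est_def)
  qed
  have tN: "t / N < w * (1 + 2 * \<gamma>)"
  proof -
    have "t < w * N * (1 + 2 * \<gamma>)" using s ts by (simp add: algebra_simps abs_less_iff)
    then show ?thesis using N by (simp add: pos_divide_less_eq mult_ac)
  qed
  have lower: "w * (1 - 2 * \<gamma>) / N \<le> e\<^sup>2"
  proof -
    \<comment> \<open>The slack between \<gamma> and \<open>2 * \<gamma>\<close> pays for the
      subtracted squares of the means; the balance comes down to \<open>4 \<le> n\<close>.\<close>
    have "0 \<le> w * (\<gamma> * (N - 4))" using w \<gamma> N by simp
    then have "w * (1 - 2 * \<gamma>) * (N - 1) \<le> s - t / N"
      using s tN by (simp add: algebra_simps abs_less_iff)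
    then have "w * (1 - 2 * \<gamma>) * (N - 1) / (N * (N - 1)) \<le> e\<^sup>2"
      unfolding e2 using N by (intro divide_right_mono) auto
    then show ?thesis using N by simp
  qed
  have "0 < w * (1 - 2 * \<gamma>) / N" using w \<gamma> N by simp
  then have "e \<noteq> 0" using lower by auto
  then show "0 < noise_est l y \<delta> m n \<omega>" using e0 by (simp add: e_def)
  have "e\<^sup>2 \<le> 4 * (w / N)"
  proof -
    have "s - t / N \<le> s" using t0 N by simp
    also have "\<dots> \<le> w * N * 2"
    proof -
      have "w * N * \<gamma> \<le> w * N * 1" using w N \<gamma> by (intro mult_left_mono) auto
      then show ?thesis using s by (simp add: abs_less_iff)
    qed
    also have "\<dots> \<le> w * 4 * (N - 1)" using w N by (simp add: algebra_simps)
    finally have "e\<^sup>2 \<le> w * 4 * (N - 1) / (N * (N - 1))"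
      unfolding e2 using N by (intro divide_right_mono) auto
    then show ?thesis using N by (simp add: mult.commute)
  qed
  then show "(noise_est l y \<delta> m n \<omega>)\<^sup>2 \<le> 4 * v * (real m / real n)"
    by (simp add: e_def w_def N_def mult_ac)
  let ?L = "L2_set (\<lambda>j. 1 / real n * (\<Sum>i=1..n. \<delta> m i j \<omega>)) {1..m}"
  have L: "?L\<^sup>2 = t / N / N"
    by (simp add: L2_set_def sum_nonneg power_mult_distrib power_divide sum_divide_distrib[symmetric] t_def N_def power2_eq_square)
  have "(C * ?L)\<^sup>2 = C\<^sup>2 * (t / N) / N"
    by (simp only: power_mult_distrib L times_divide_eq_right)
  also have "\<dots> \<le> C\<^sup>2 * (w * (1 + 2 * \<gamma>)) / N"
    using tN N by (intro divide_right_mono mult_left_mono) auto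
  also have "\<dots> = w / N * (C\<^sup>2 * (1 + 2 * \<gamma>))" by simp
  also have "\<dots> \<le> w / N * (\<tau>\<^sup>2 * (1 - 2 * \<gamma>))" using C w N by (intro mult_left_mono) auto
  also have "\<dots> = \<tau>\<^sup>2 * (w * (1 - 2 * \<gamma>) / N)" by simp
  also have "\<dots> \<le> (\<tau> * e)\<^sup>2" unfolding power_mult_distrib by (intro mult_left_mono lower) auto
  finally have "C * ?L \<le> \<tau> * e" by (rule power2_le_imp_le) (use C e0 in simp)
  then show "C * ?L \<le> \<tau> * noise_est l y \<delta> m n \<omega>" by (simp add: e_def)
qed

section \<open>Uniform integrability in the two error models\<close>

lemma (in prob_space) expectation_cong_distr:
  fixes X Y :: "'a \<Rightarrow> real" and f :: "real \<Rightarrow> real"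
  assumes "distr M borel X = distr M borel Y" "random_variable borel X" "random_variable borel Y"
    and "f \<in> borel_measurable borel"
  shows "expectation (\<lambda>\<omega>. f (X \<omega>)) = expectation (\<lambda>\<omega>. f (Y \<omega>))"
  using integral_distr[OF assms(2,4)] integral_distr[OF assms(3,4)] assms(1) by metis

text \<open>At each outcome the truncation is inactive for large \<open>k\<close>, and
  \<open>Z\<close> dominates.\<close>

lemma (in prob_space) truncation_tail_tendsto_0:
  fixes Z :: "'a \<Rightarrow> real" and v :: real
  assumes Z: "integrable M Z" "\<And>\<omega>. 0 \<le> Z \<omega>" and v: "0 < v"
  shows "(\<lambda>k::nat. expectation (\<lambda>\<omega>. Z \<omega> - min (Z \<omega>) (real k * v))) \<longlonglongrightarrow> 0"
proof -
  have [measurable]: "random_variable borel Z" using Z(1) by auto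
  have "(\<lambda>k::nat. expectation (\<lambda>\<omega>. Z \<omega> - min (Z \<omega>) (real k * v))) \<longlonglongrightarrow> expectation (\<lambda>\<omega>. 0)"
  proof (rule integral_dominated_convergence[where w = Z])
    show "AE \<omega> in M. (\<lambda>k::nat. Z \<omega> - min (Z \<omega>) (real k * v)) \<longlonglongrightarrow> 0"
    proof (rule AE_I2)
      fix \<omega>
      obtain k0 :: nat where k0: "Z \<omega> / v < real k0" using reals_Archimedean2 by blast
      have "Z \<omega> - min (Z \<omega>) (real k * v) = 0" if "k0 \<le> k" for k
      proof -
        have "Z \<omega> / v \<le> real k" using k0 that by (meson less_imp_le of_nat_le_iff order_trans)
        then show ?thesis using v by (simp add: min_def pos_divide_le_eq)
      qed
      then show "(\<lambda>k::nat. Z \<omega> - min (Z \<omega>) (real k * v)) \<longlonglongrightarrow> 0"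
        by (intro tendsto_eventually eventually_sequentiallyI)
    qed
    show "AE \<omega> in M. norm (Z \<omega> - min (Z \<omega>) (real k * v)) \<le> Z \<omega>" for k :: nat
      using Z(2) v by (intro AE_I2) (auto simp: min_def not_le intro: less_imp_le)
  qed (use Z(1) in auto)
  then show ?thesis by simp
qed

text \<open>Where the truncation acts, the square of \<open>X\<close> exceeds \<open>c * v\<close>;
  of its powers \<open>p\<close> and \<open>1 - p\<close> the second has a negative exponent and is
  at most \<open>(c * v) powr (1 - p)\<close>.\<close>

lemma (in prob_space) truncation_tail_le_moment:
  fixes X :: "'a \<Rightarrow> real" and v c p :: real
  assumes X: "random_variable borel X" "integrable M (\<lambda>\<omega>. \<bar>X \<omega>\<bar> powr (2 * p))"
    and p: "1 < p" and v: "0 < v" and c: "0 < c"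
  shows "expectation (\<lambda>\<omega>. (X \<omega>)\<^sup>2 - min ((X \<omega>)\<^sup>2) (c * v))
    \<le> expectation (\<lambda>\<omega>. \<bar>X \<omega>\<bar> powr (2 * p)) * (c * v) powr (1 - p)"
proof -
  have le: "(X \<omega>)\<^sup>2 - min ((X \<omega>)\<^sup>2) (c * v) \<le> \<bar>X \<omega>\<bar> powr (2 * p) * (c * v) powr (1 - p)" for \<omega>
  proof (cases "(X \<omega>)\<^sup>2 \<le> c * v")
    case False
    then have gt: "c * v < (X \<omega>)\<^sup>2" by simp
    have cv: "0 < c * v" using c v by simp
    have "X \<omega> \<noteq> 0" using gt cv by auto
    have "(X \<omega>)\<^sup>2 - min ((X \<omega>)\<^sup>2) (c * v) \<le> (X \<omega>)\<^sup>2" using gt cv by simp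
    also have "\<dots> = ((X \<omega>)\<^sup>2) powr p * ((X \<omega>)\<^sup>2) powr (1 - p)"
      using \<open>X \<omega> \<noteq> 0\<close> by (simp flip: powr_add)
    also have "((X \<omega>)\<^sup>2) powr p = \<bar>X \<omega>\<bar> powr (2 * p)"
      using \<open>X \<omega> \<noteq> 0\<close> by (simp add: powr_powr[symmetric] powr_numeral)
    also have "((X \<omega>)\<^sup>2) powr (1 - p) \<le> (c * v) powr (1 - p)"
      using gt cv p by (intro powr_mono2') auto
    finally show ?thesis by (simp add: mult_left_mono)
  qed simp
  have int: "integrable M (\<lambda>\<omega>. \<bar>X \<omega>\<bar> powr (2 * p) * (c * v) powr (1 - p))" using X(2) by simp
  have "expectation (\<lambda>\<omega>. (X \<omega>)\<^sup>2 - min ((X \<omega>)\<^sup>2) (c * v))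
      \<le> expectation (\<lambda>\<omega>. \<bar>X \<omega>\<bar> powr (2 * p) * (c * v) powr (1 - p))"
  proof (rule integral_mono[OF _ int le])
    show "integrable M (\<lambda>\<omega>. (X \<omega>)\<^sup>2 - min ((X \<omega>)\<^sup>2) (c * v))"
      by (rule Bochner_Integration.integrable_bound[OF int]) (use X(1) le in \<open>auto intro!: AE_I2\<close>)
  qed
  then show ?thesis by simp
qed

text \<open>The last property is the uniform integrability, over all rows, of the squared errors divided by
  their variance. The weak law needs nothing else from either error model.\<close>

lemma (in prob_space) error_models:
  assumes "errors_iid \<delta> \<or> errors_rowwise_iid \<delta>"
  obtains v V where
    "\<And>m. 1 \<le> m \<Longrightarrow> 0 < v m \<and> v m \<le> V"
    "\<And>m. 1 \<le> m \<Longrightarrow> indep_vars (\<lambda>_. borel) (\<lambda>(i, j). \<delta> m i j) ({1..} \<times> {1..})"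
    "\<And>m i j. 1 \<le> m \<Longrightarrow> 1 \<le> i \<Longrightarrow> 1 \<le> j \<Longrightarrow> integrable M (\<delta> m i j)"
    "\<And>m i j. 1 \<le> m \<Longrightarrow> 1 \<le> i \<Longrightarrow> 1 \<le> j \<Longrightarrow> integrable M (\<lambda>\<omega>. (\<delta> m i j \<omega>)\<^sup>2)"
    "\<And>m i j. 1 \<le> m \<Longrightarrow> 1 \<le> i \<Longrightarrow> 1 \<le> j \<Longrightarrow> expectation (\<delta> m i j) = 0"
    "\<And>m i j. 1 \<le> m \<Longrightarrow> 1 \<le> i \<Longrightarrow> 1 \<le> j \<Longrightarrow> expectation (\<lambda>\<omega>. (\<delta> m i j \<omega>)\<^sup>2) = v m"
    "\<And>\<eta>. 0 < \<eta> \<Longrightarrow> \<exists>c\<ge>0. \<forall>m\<ge>1. \<forall>i\<ge>1. \<forall>j\<ge>1.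
      expectation (\<lambda>\<omega>. (\<delta> m i j \<omega>)\<^sup>2 - min ((\<delta> m i j \<omega>)\<^sup>2) (c * v m)) \<le> \<eta> * v m"
  using assms
proof
  assume iid: "errors_iid \<delta>"
  define v where "v = expectation (\<lambda>\<omega>. (\<delta> 1 1 1 \<omega>)\<^sup>2)"
  have ind: "indep_vars (\<lambda>_. borel) (\<lambda>(m, i, j). \<delta> m i j) ({1..} \<times> {1..} \<times> {1..})"
    and id: "\<And>k k'. k \<in> {1..} \<times> {1..} \<times> {1..} \<Longrightarrow> k' \<in> {1..} \<times> {1..} \<times> {1..} \<Longrightarrow>
      distr M borel (case k of (m, i, j) \<Rightarrow> \<delta> m i j) = distr M borel (case k' of (m, i, j) \<Rightarrow> \<delta> m i j)"
    using iid unfolding errors_iid_def iid_vars_def by blast+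
  have \<delta>: "integrable M (\<delta> m i j)" "expectation (\<delta> m i j) = 0" "integrable M (\<lambda>\<omega>. (\<delta> m i j \<omega>)\<^sup>2)"
    "variance (\<delta> m i j) > 0" if "1 \<le> m" "1 \<le> i" "1 \<le> j" for m i j
    using iid that unfolding errors_iid_def by blast+
  have cong: "expectation (\<lambda>\<omega>. f (\<delta> m i j \<omega>)) = expectation (\<lambda>\<omega>. f (\<delta> 1 1 1 \<omega>))"
    if "1 \<le> m" "1 \<le> i" "1 \<le> j" "f \<in> borel_measurable borel" for m i j and f :: "real \<Rightarrow> real"
    using id[of "(m, i, j)" "(1, 1, 1)"] \<delta>(1)[OF that(1-3)] \<delta>(1)[of 1 1 1] that
    by (intro expectation_cong_distr) auto
  have v0: "0 < v" using \<delta>(4)[of 1 1 1] \<delta>(2)[of 1 1 1] by (simp add: v_def)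
  show ?thesis
  proof (rule that[of "\<lambda>_. v" v])
    fix m :: nat assume m: "1 \<le> m"
    have "indep_vars (\<lambda>_. borel) (\<lambda>k. (\<lambda>(m, i, j). \<delta> m i j) (case k of (i, j) \<Rightarrow> (m, i, j))) ({1..} \<times> {1..})"
      by (rule indep_vars_reindex[OF ind]) (use m in \<open>auto simp: inj_on_def\<close>)
    then show "indep_vars (\<lambda>_. borel) (\<lambda>(i, j). \<delta> m i j) ({1..} \<times> {1..})"
      by (simp add: split_def)
  next
    fix \<eta> :: real assume \<eta>: "0 < \<eta>"
    have "(\<lambda>k::nat. expectation (\<lambda>\<omega>. (\<delta> 1 1 1 \<omega>)\<^sup>2 - min ((\<delta> 1 1 1 \<omega>)\<^sup>2) (real k * v))) \<longlonglongrightarrow> 0"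
      by (rule truncation_tail_tendsto_0) (use \<delta>(3) v0 in auto)
    then have "eventually (\<lambda>k::nat. expectation (\<lambda>\<omega>. (\<delta> 1 1 1 \<omega>)\<^sup>2 - min ((\<delta> 1 1 1 \<omega>)\<^sup>2) (real k * v)) < \<eta> * v) sequentially"
      using \<eta> v0 by (intro order_tendstoD) auto
    then obtain k :: nat where k: "expectation (\<lambda>\<omega>. (\<delta> 1 1 1 \<omega>)\<^sup>2 - min ((\<delta> 1 1 1 \<omega>)\<^sup>2) (real k * v)) < \<eta> * v"
      by (auto simp: eventually_sequentially)
    have "expectation (\<lambda>\<omega>. (\<delta> m i j \<omega>)\<^sup>2 - min ((\<delta> m i j \<omega>)\<^sup>2) (real k * v)) \<le> \<eta> * v"
      if "1 \<le> m" "1 \<le> i" "1 \<le> j" for m i j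
      using cong[OF that, of "\<lambda>x. x\<^sup>2 - min (x\<^sup>2) (real k * v)"] k by simp
    then show "\<exists>c\<ge>0. \<forall>m\<ge>1. \<forall>i\<ge>1. \<forall>j\<ge>1.
      expectation (\<lambda>\<omega>. (\<delta> m i j \<omega>)\<^sup>2 - min ((\<delta> m i j \<omega>)\<^sup>2) (c * v)) \<le> \<eta> * v"
      by (intro exI[of _ "real k"]) auto
  next
    fix m i j :: nat assume k: "1 \<le> m" "1 \<le> i" "1 \<le> j"
    show "expectation (\<lambda>\<omega>. (\<delta> m i j \<omega>)\<^sup>2) = v"
      using cong[OF k, of "\<lambda>x. x\<^sup>2"] by (simp add: v_def)
  qed (use \<delta> v0 in auto)
next
  assume "errors_rowwise_iid \<delta>"
  then obtain Cd p V where p: "1 < p" and rows: "\<And>m. 1 \<le> m \<Longrightarrow> iid_vars (\<lambda>(i, j). \<delta> m i j) ({1..} \<times> {1..}) \<and>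
         (\<forall>i\<ge>1. \<forall>j\<ge>1.
            integrable M (\<delta> m i j) \<and> expectation (\<delta> m i j) = 0 \<and>
            integrable M (\<lambda>\<omega>. \<bar>\<delta> m i j \<omega>\<bar> powr (2 * p)) \<and>
            0 < variance (\<delta> m i j) \<and> variance (\<delta> m i j) \<le> V \<and>
            expectation (\<lambda>\<omega>. \<bar>\<delta> m i j \<omega>\<bar> powr (2 * p))
              / (expectation (\<lambda>\<omega>. (\<delta> m i j \<omega>)\<^sup>2)) powr p \<le> Cd)"
    unfolding errors_rowwise_iid_def by blast
  define v where "v m = expectation (\<lambda>\<omega>. (\<delta> m 1 1 \<omega>)\<^sup>2)" for m
  have ind: "indep_vars (\<lambda>_. borel) (\<lambda>(i, j). \<delta> m i j) ({1..} \<times> {1..})"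
    and id: "\<And>k k'. k \<in> {1..} \<times> {1..} \<Longrightarrow> k' \<in> {1..} \<times> {1..} \<Longrightarrow>
      distr M borel (case k of (i, j) \<Rightarrow> \<delta> m i j) = distr M borel (case k' of (i, j) \<Rightarrow> \<delta> m i j)"
    if "1 \<le> m" for m
    using rows[OF that] unfolding iid_vars_def by blast+
  have \<delta>: "integrable M (\<delta> m i j)" "expectation (\<delta> m i j) = 0"
    "integrable M (\<lambda>\<omega>. \<bar>\<delta> m i j \<omega>\<bar> powr (2 * p))"
    "0 < variance (\<delta> m i j)" "variance (\<delta> m i j) \<le> V"
    "expectation (\<lambda>\<omega>. \<bar>\<delta> m i j \<omega>\<bar> powr (2 * p)) / (expectation (\<lambda>\<omega>. (\<delta> m i j \<omega>)\<^sup>2)) powr p \<le> Cd"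
    if "1 \<le> m" "1 \<le> i" "1 \<le> j" for m i j
    using rows[OF that(1)] that(2,3) by blast+
  have v: "expectation (\<lambda>\<omega>. (\<delta> m i j \<omega>)\<^sup>2) = v m" if k: "1 \<le> m" "1 \<le> i" "1 \<le> j" for m i j
    unfolding v_def using id[OF k(1), of "(i, j)" "(1, 1)"] \<delta>(1)[OF k] \<delta>(1)[of m 1 1] k
    by (intro expectation_cong_distr) auto
  have vV: "0 < v m \<and> v m \<le> V" if "1 \<le> m" for m
    using \<delta>(2,4,5)[OF that, of 1 1] by (simp add: v_def)
  have int2: "integrable M (\<lambda>\<omega>. (\<delta> m i j \<omega>)\<^sup>2)" if k: "1 \<le> m" "1 \<le> i" "1 \<le> j" for m i j
  proof (rule Bochner_Integration.integrable_bound)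
    show "integrable M (\<lambda>\<omega>. 1 + \<bar>\<delta> m i j \<omega>\<bar> powr (2 * p))" using \<delta>(3)[OF k] by simp
    have "x\<^sup>2 \<le> 1 + \<bar>x\<bar> powr (2 * p)" for x :: real
    proof (cases "\<bar>x\<bar> \<le> 1")
      case True
      then have "x\<^sup>2 \<le> 1" by (simp add: abs_square_le_1)
      then show ?thesis by (simp add: add_increasing2)
    next
      case False
      then have "\<bar>x\<bar> powr 2 \<le> \<bar>x\<bar> powr (2 * p)" using p by (intro powr_mono) auto
      then show ?thesis using False by (simp add: powr_numeral)
    qed
    then show "AE \<omega> in M. norm ((\<delta> m i j \<omega>)\<^sup>2) \<le> norm (1 + \<bar>\<delta> m i j \<omega>\<bar> powr (2 * p))"
      by (intro AE_I2) simp
  qed (use \<delta>(1)[OF k] in auto)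
  have "0 \<le> Cd" by (rule order.trans[OF _ \<delta>(6)[of 1 1 1]]) auto
  show ?thesis
  proof (rule that[of v V])
    fix \<eta> :: real assume \<eta>: "0 < \<eta>"
    \<comment> \<open>Chosen so that \<open>c powr (1 - p)\<close> is
      \<open>\<eta> / (Cd + 1)\<close>; the scale invariance of the moment quotient makes it
      independent of \<open>m\<close>.\<close>
    define c where "c = (\<eta> / (Cd + 1)) powr (1 / (1 - p))"
    have c: "0 < c" using \<eta> \<open>0 \<le> Cd\<close> by (simp add: c_def)
    have "1 / (1 - p) * (1 - p) = 1" using p by simp
    then have cp: "c powr (1 - p) = \<eta> / (Cd + 1)"
      using \<eta> \<open>0 \<le> Cd\<close> unfolding c_def powr_powr by simp
    have "expectation (\<lambda>\<omega>. (\<delta> m i j \<omega>)\<^sup>2 - min ((\<delta> m i j \<omega>)\<^sup>2) (c * v m)) \<le> \<eta> * v m"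
      if k: "1 \<le> m" "1 \<le> i" "1 \<le> j" for m i j
    proof -
      have vm: "0 < v m" using vV[OF k(1)] by simp
      have "expectation (\<lambda>\<omega>. (\<delta> m i j \<omega>)\<^sup>2 - min ((\<delta> m i j \<omega>)\<^sup>2) (c * v m))
          \<le> expectation (\<lambda>\<omega>. \<bar>\<delta> m i j \<omega>\<bar> powr (2 * p)) * (c * v m) powr (1 - p)"
        by (rule truncation_tail_le_moment) (use \<delta>(1,3)[OF k] p vm c in auto)
      also have "\<dots> \<le> (Cd * v m powr p) * (c * v m) powr (1 - p)"
        using \<delta>(6)[OF k] vm by (intro mult_right_mono) (auto simp: v[OF k] pos_divide_le_eq)
      also have "\<dots> = Cd * c powr (1 - p) * (v m powr p * v m powr (1 - p))"
        using c vm by (simp add: powr_mult)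
      also have "v m powr p * v m powr (1 - p) = v m" using vm by (simp flip: powr_add)
      also have "Cd * c powr (1 - p) * v m = \<eta> * (Cd / (Cd + 1)) * v m" by (simp add: cp)
      also have "\<dots> \<le> \<eta> * 1 * v m"
        using \<eta> \<open>0 \<le> Cd\<close> vm by (intro mult_right_mono mult_left_mono) auto
      finally show ?thesis by simp
    qed
    then show "\<exists>c\<ge>0. \<forall>m\<ge>1. \<forall>i\<ge>1. \<forall>j\<ge>1.
      expectation (\<lambda>\<omega>. (\<delta> m i j \<omega>)\<^sup>2 - min ((\<delta> m i j \<omega>)\<^sup>2) (c * v m)) \<le> \<eta> * v m"
      using c by (intro exI[of _ c]) auto
  qed (use ind \<delta> v vV int2 in auto)
qed

section \<open>Convergence in probability\<close>

text \<open>Dense range makes its orthogonal complement trivial, so the domain of the generalised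
  inverse is the range itself, and injectivity makes it a genuine inverse there.\<close>

lemma mp_inverse_range:
  fixes K :: "'x::real_inner \<Rightarrow>\<^sub>L 'y::real_inner"
  assumes K: "inj (blinfun_apply K)" and dense: "closure (range (blinfun_apply K)) = UNIV"
    and y: "y \<in> mp_domain K"
  shows "blinfun_apply K (mp_inverse K y) = y"
proof -
  have perp: "(range (blinfun_apply K))\<^sup>\<bottom> = {0}"
  proof (intro equalityI subsetI)
    fix v assume "v \<in> (range (blinfun_apply K))\<^sup>\<bottom>"
    then have "range (blinfun_apply K) \<subseteq> {z. z \<bullet> v = 0}"
      by (auto simp: orthogonal_comp_def orthogonal_def)
    moreover have "closed {z. z \<bullet> v = 0}" by (intro closed_Collect_eq continuous_intros)
    ultimately have "closure (range (blinfun_apply K)) \<subseteq> {z. z \<bullet> v = 0}"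
      by (rule closure_minimal)
    then have "v \<bullet> v = 0" unfolding dense by blast
    then show "v \<in> {0}" by simp
  qed (auto simp: orthogonal_comp_def orthogonal_def)
  have ker: "{z. blinfun_apply K z = 0} = {0}"
    using injD[OF K, of _ 0] by (auto simp: blinfun.zero_right)
  obtain x where x: "y = blinfun_apply K x" using y unfolding mp_domain_def perp by auto
  have "mp_inverse K y = x"
    unfolding mp_inverse_def perp ker
    by (rule the_equality) (use injD[OF K] in \<open>auto simp: x\<close>)
  then show ?thesis using x by simp
qed

lemma eventually_joint_limitI:
  assumes "0 < r" and "\<And>m n. m0 \<le> m \<Longrightarrow> n0 \<le> n \<Longrightarrow> real m / real n < r \<Longrightarrow> P (m, n)"
  shows "eventually P joint_limit"
  unfolding joint_limit_def eventually_inf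
proof (intro exI conjI)
  show "eventually (\<lambda>(m, n). m0 \<le> m \<and> n0 \<le> n) (sequentially \<times>\<^sub>F sequentially)"
    unfolding eventually_prod_filter
    by (intro exI[of _ "\<lambda>m. m0 \<le> m"] exI[of _ "\<lambda>n. n0 \<le> n"]) (auto simp: eventually_ge_at_top)
  have "eventually (\<lambda>x. x < r) (nhds 0)" by (rule eventually_nhds_in_open[of "{..<r}", simplified]) fact
  then show "eventually (\<lambda>(m, n). real m / real n < r) (filtercomap (\<lambda>(m, n). real m / real n) (nhds 0))"
    by (rule eventually_filtercomapI[THEN eventually_mono]) auto
  show "\<forall>x. (case x of (m, n) \<Rightarrow> m0 \<le> m \<and> n0 \<le> n) \<and> (case x of (m, n) \<Rightarrow> real m / real n < r) \<longrightarrow> P x"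
    using assms(2) by auto
qed

theorem theorem2p11:
  fixes K :: "'x::{real_inner,complete_space} \<Rightarrow>\<^sub>L 'y::{real_inner,complete_space}"
    and l :: "nat \<Rightarrow> nat \<Rightarrow> 'y \<Rightarrow>\<^sub>L real"
    and A :: "'y \<Rightarrow>\<^sub>L 'y"
    and yhat :: 'y
    and M :: "'w measure"
    and \<delta> :: "nat \<Rightarrow> nat \<Rightarrow> nat \<Rightarrow> 'w \<Rightarrow> real"
    and F :: "real \<Rightarrow> real \<Rightarrow> real"
    and \<nu>0 :: ereal
    and C0 \<tau> q \<epsilon> :: real
  assumes "compact_operator K"
    and "inj (blinfun_apply K)"
    and "closure (range (blinfun_apply K)) = UNIV"
    and "yhat \<in> mp_domain K"
    and "\<And>m i j. i \<in> {1..m} \<Longrightarrow> j \<in> {1..m} \<Longrightarrow> norm (l m i) = norm (l m j)"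
    and "\<And>m. m \<ge> 1 \<Longrightarrow>
           bij_betw (\<lambda>v. meas_op l m (adjoint_Rm m (meas_op l m) v))
             ({1..m} \<rightarrow>\<^sub>E UNIV) ({1..m} \<rightarrow>\<^sub>E UNIV)"
    and "inj (blinfun_apply A)"
    and "\<And>y. (\<lambda>m. adjoint_Rm m (meas_op l m) (meas_op l m y)) \<longlonglongrightarrow> blinfun_apply A y"
    and "prob_space M"
    and "prob_space.errors_iid M \<delta> \<or> prob_space.errors_rowwise_iid M \<delta>"
    and "regularising_filter (spectral_bound K l) F \<nu>0 C0"
    and "\<nu>0 > 1"
    and "\<tau> > C0"
    and "0 < q" and "q < 1"
    and "\<epsilon> > 0"
  shows "((\<lambda>(m, n). measure M
             {\<omega> \<in> space M.
                norm (reg_op K l F m (dp_alpha K l F \<tau> q yhat \<delta> m n \<omega>) (obs_mean l yhat \<delta> m n \<omega>)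
                      - mp_inverse K yhat) \<ge> \<epsilon>})
          \<longlongrightarrow> 0) joint_limit"
proof (cases "K = 0")
  case True
  \<comment> \<open>An injective zero operator forces a trivial space. The case is separated because
    the filter bounds need a positive spectral bound.\<close>
  have "z = 0" for z :: 'x using injD[OF assms(2), of z 0] True by simp
  then have "norm z = 0" for z :: 'x by simp
  then show ?thesis using \<open>\<epsilon> > 0\<close> by (simp only: split_def) simp
next
  case False
  interpret prob_space M by fact
  define x where "x = mp_inverse K yhat"
  have x: "yhat = blinfun_apply K x"
    unfolding x_def by (rule mp_inverse_range[OF assms(2-4), symmetric])
  have "0 < spectral_bound K l" using False by (simp add: spectral_bound_def less_max_iff_disj)
  from regularising_filter_bounds[OF assms(11) this assms(12)]
  have C0: "1 \<le> C0" by (meson filter_bounds.C(1))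
  define \<tau>1 where "\<tau>1 = (C0 + \<tau>) / 2"
  have \<tau>1: "C0 < \<tau>1" "\<tau>1 < \<tau>" using \<open>\<tau> > C0\<close> by (auto simp: \<tau>1_def)
  then have \<tau>1_pos: "0 \<le> \<tau>1" using C0 by simp
  \<comment> \<open>The second entry solves \<open>C0\<^sup>2 * (1 + 2 * \<gamma>) = \<tau>1\<^sup>2
    * (1 - 2 * \<gamma>)\<close>; the first keeps \<gamma> below 1 / 2.\<close>
  define \<gamma> where "\<gamma> = min (1 / 4) ((\<tau>1\<^sup>2 - C0\<^sup>2) / (2 * (C0\<^sup>2 + \<tau>1\<^sup>2)))"
  have sq: "C0\<^sup>2 < \<tau>1\<^sup>2" "0 < C0\<^sup>2 + \<tau>1\<^sup>2"
    using \<tau>1 C0 by (auto intro!: power_strict_mono add_pos_pos)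
  have \<gamma>: "0 < \<gamma>" "\<gamma> < 1 / 2" using sq by (auto simp: \<gamma>_def min_def)
  have \<gamma>C: "C0\<^sup>2 * (1 + 2 * \<gamma>) \<le> \<tau>1\<^sup>2 * (1 - 2 * \<gamma>)"
  proof -
    have "\<gamma> * (2 * (C0\<^sup>2 + \<tau>1\<^sup>2)) \<le> \<tau>1\<^sup>2 - C0\<^sup>2"
      using sq by (subst pos_le_divide_eq[symmetric]) (auto simp: \<gamma>_def)
    then show ?thesis by (simp add: algebra_simps)
  qed
  obtain d0 m0 where d0: "0 < d0" and det: "\<And>m d \<xi> Y. m0 \<le> m \<Longrightarrow> 0 < d \<Longrightarrow> d < d0 \<Longrightarrow> C0 * L2_set \<xi> {1..m} \<le> \<tau>1 * d \<Longrightarrow>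
      (\<And>j. j \<in> {1..m} \<Longrightarrow> Y j = blinfun_apply (l m j) (blinfun_apply K x) + \<xi> j) \<Longrightarrow>
      norm (reg_op K l F m (q ^ (LEAST k. L2_set (\<lambda>j. disc_op K l m (reg_op K l F m (q ^ k) Y) j - Y j) {1..m}
              \<le> \<tau> * d)) Y - x) < \<epsilon>"
    by (rule discrepancy_principle_uniform_error[where x = x,
          OF assms(2) False assms(7,8,11,12) \<tau>1_pos \<tau>1(2) assms(14-16)]) blast
  obtain v V where v: "\<And>m. 1 \<le> m \<Longrightarrow> 0 < v m \<and> v m \<le> V"
    and ind: "\<And>m. 1 \<le> m \<Longrightarrow> indep_vars (\<lambda>_. borel) (\<lambda>(i, j). \<delta> m i j) ({1..} \<times> {1..})"
    and \<delta>: "\<And>m i j. 1 \<le> m \<Longrightarrow> 1 \<le> i \<Longrightarrow> 1 \<le> j \<Longrightarrow> integrable M (\<delta> m i j)"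
    "\<And>m i j. 1 \<le> m \<Longrightarrow> 1 \<le> i \<Longrightarrow> 1 \<le> j \<Longrightarrow> integrable M (\<lambda>\<omega>. (\<delta> m i j \<omega>)\<^sup>2)"
    "\<And>m i j. 1 \<le> m \<Longrightarrow> 1 \<le> i \<Longrightarrow> 1 \<le> j \<Longrightarrow> expectation (\<delta> m i j) = 0"
    "\<And>m i j. 1 \<le> m \<Longrightarrow> 1 \<le> i \<Longrightarrow> 1 \<le> j \<Longrightarrow> expectation (\<lambda>\<omega>. (\<delta> m i j \<omega>)\<^sup>2) = v m"
    and tail: "\<And>\<eta>. 0 < \<eta> \<Longrightarrow> \<exists>c\<ge>0. \<forall>m\<ge>1. \<forall>i\<ge>1. \<forall>j\<ge>1.
      expectation (\<lambda>\<omega>. (\<delta> m i j \<omega>)\<^sup>2 - min ((\<delta> m i j \<omega>)\<^sup>2) (c * v m)) \<le> \<eta> * v m"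
    by (rule error_models[OF assms(10)]) blast
  have V: "0 < V" using v[of 1] by simp
  show ?thesis
  proof (rule tendstoI)
    fix \<zeta> :: real assume \<zeta>: "0 < \<zeta>"
    \<comment> \<open>Allots \<open>\<zeta> / 4\<close> to the truncation tails; the minimum with 1
      secures \<open>3 * \<eta> \<le> \<gamma>\<close>.\<close>
    define \<eta> where "\<eta> = \<gamma> * min \<zeta> 1 / 12"
    have \<eta>: "0 < \<eta>" "3 * \<eta> \<le> \<gamma>" "3 * \<eta> / \<gamma> \<le> \<zeta> / 4"
      using \<gamma> \<zeta> by (auto simp: \<eta>_def min_def)
    obtain c where c: "0 \<le> c" "\<And>m i j. 1 \<le> m \<Longrightarrow> 1 \<le> i \<Longrightarrow> 1 \<le> j \<Longrightarrow>
      expectation (\<lambda>\<omega>. (\<delta> m i j \<omega>)\<^sup>2 - min ((\<delta> m i j \<omega>)\<^sup>2) (c * v m)) \<le> \<eta> * v m"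
      using tail[OF \<eta>(1)] by blast
    \<comment> \<open>From \<open>m1\<close> on the two Chebyshev terms, both of order
      \<open>1 / m\<close>, are together below \<open>\<zeta> / 4\<close>.\<close>
    obtain m1 :: nat where m1: "(9 * c\<^sup>2 + 4) / (\<gamma>\<^sup>2 * (\<zeta> / 4)) < real m1" using reals_Archimedean2 by blast
    show "eventually (\<lambda>p. dist (case p of (m, n) \<Rightarrow> measure M
             {\<omega> \<in> space M.
                norm (reg_op K l F m (dp_alpha K l F \<tau> q yhat \<delta> m n \<omega>) (obs_mean l yhat \<delta> m n \<omega>)
                      - mp_inverse K yhat) \<ge> \<epsilon>}) 0 < \<zeta>) joint_limit"
    \<comment> \<open>The squared estimate is at most \<open>4 * V * (m / n)\<close>, so this radius
      keeps the estimated level below \<open>d0\<close>; the last 4 is the sample size that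
      \<open>noise_level_bounds\<close> requires.\<close>
    proof (rule eventually_joint_limitI[of "d0\<^sup>2 / (4 * V)" "max m0 (max m1 1)" 4])
      show "0 < d0\<^sup>2 / (4 * V)" using d0 V by simp
      fix m n :: nat
      assume m: "max m0 (max m1 1) \<le> m" and n: "4 \<le> n" and mn: "real m / real n < d0\<^sup>2 / (4 * V)"
      have m': "1 \<le> m" "m0 \<le> m" "m1 \<le> m" using m by auto
      obtain B where B: "B \<in> events"
        "prob B \<le> 9 * c\<^sup>2 / (real m * real n * \<gamma>\<^sup>2) + 3 * \<eta> / \<gamma> + 4 / (\<gamma>\<^sup>2 * real m)"
        "\<And>\<omega>. \<omega> \<in> space M - B \<Longrightarrow>
          \<bar>(\<Sum>j=1..m. \<Sum>i=1..n. (\<delta> m i j \<omega>)\<^sup>2) - real m * real n * v m\<bar> < real m * real n * v m * \<gamma>"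
        "\<And>\<omega>. \<omega> \<in> space M - B \<Longrightarrow>
          \<bar>(\<Sum>j=1..m. (\<Sum>i=1..n. \<delta> m i j \<omega>)\<^sup>2) - (\<Sum>j=1..m. \<Sum>i=1..n. (\<delta> m i j \<omega>)\<^sup>2)\<bar>
            < real m * real n * v m * \<gamma>"
        by (rule array_concentration[OF ind[OF m'(1)], of "v m" c \<eta> \<gamma> m n])
          (use \<delta> v c \<gamma> \<eta> m' n in auto)
      \<comment> \<open>Inclusion in the measurable set \<open>B\<close> suffices, so measurability
        of the event, which involves the stopping index, need not be settled.\<close>
      have "{\<omega> \<in> space M.
                norm (reg_op K l F m (dp_alpha K l F \<tau> q yhat \<delta> m n \<omega>) (obs_mean l yhat \<delta> m n \<omega>)
                      - mp_inverse K yhat) \<ge> \<epsilon>} \<subseteq> B"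
      proof (rule subsetI, rule ccontr)
        fix \<omega> assume \<omega>: "\<omega> \<in> {\<omega> \<in> space M.
                norm (reg_op K l F m (dp_alpha K l F \<tau> q yhat \<delta> m n \<omega>) (obs_mean l yhat \<delta> m n \<omega>)
                      - mp_inverse K yhat) \<ge> \<epsilon>}" and "\<omega> \<notin> B"
        then have \<omega>B: "\<omega> \<in> space M - B" by blast
        have vm: "0 < v m" "v m \<le> V" using v[OF m'(1)] by auto
        note noise = noise_level_bounds[where l = l and y = yhat and \<delta> = \<delta> and \<omega> = \<omega>,
            OF m'(1) n vm(1) \<gamma> order.trans[OF zero_le_one C0] \<tau>1_pos \<gamma>C B(3)[OF \<omega>B] B(4)[OF \<omega>B]]
        have "(noise_est l yhat \<delta> m n \<omega>)\<^sup>2 \<le> 4 * v m * (real m / real n)"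
          by (rule noise(2))
        also have "\<dots> \<le> 4 * V * (real m / real n)"
          using vm by (intro mult_right_mono) auto
        also have "\<dots> < d0\<^sup>2" using mn V by (simp add: pos_less_divide_eq mult.commute)
        finally have small: "noise_est l yhat \<delta> m n \<omega> < d0"
          by (rule power2_less_imp_less) (use d0 in simp)
        have "norm (reg_op K l F m (dp_alpha K l F \<tau> q yhat \<delta> m n \<omega>) (obs_mean l yhat \<delta> m n \<omega>) - x) < \<epsilon>"
          unfolding dp_alpha_def
        proof (rule det[OF m'(2) _ small])
          show "0 < noise_est l yhat \<delta> m n \<omega>" by (rule noise(1))
          show "C0 * L2_set (\<lambda>j. 1 / real n * (\<Sum>i=1..n. \<delta> m i j \<omega>)) {1..m} \<le> \<tau>1 * noise_est l yhat \<delta> m n \<omega>"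
            by (rule noise(3))
          show "obs_mean l yhat \<delta> m n \<omega> j
              = blinfun_apply (l m j) (blinfun_apply K x) + 1 / real n * (\<Sum>i=1..n. \<delta> m i j \<omega>)"
            if "j \<in> {1..m}" for j
            unfolding x[symmetric] by (rule obs_mean_eq) (use n that in auto)
        qed
        then show False using \<omega> by (simp add: x_def)
      qed
      then have "measure M {\<omega> \<in> space M.
                norm (reg_op K l F m (dp_alpha K l F \<tau> q yhat \<delta> m n \<omega>) (obs_mean l yhat \<delta> m n \<omega>)
                      - mp_inverse K yhat) \<ge> \<epsilon>} \<le> prob B"
        by (rule finite_measure_mono) (rule B(1))
      also have "prob B < \<zeta>"
      proof -
        have "9 * c\<^sup>2 / (real m * real n * \<gamma>\<^sup>2) \<le> 9 * c\<^sup>2 / (real m * 1 * \<gamma>\<^sup>2)"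
          using m' n \<gamma> by (intro divide_left_mono mult_right_mono mult_left_mono) auto
        then have "9 * c\<^sup>2 / (real m * real n * \<gamma>\<^sup>2) + 4 / (\<gamma>\<^sup>2 * real m) \<le> (9 * c\<^sup>2 + 4) / (\<gamma>\<^sup>2 * real m)"
          by (simp add: add_divide_distrib mult.commute)
        also have "\<dots> < \<zeta> / 4"
        proof -
          have "(9 * c\<^sup>2 + 4) / (\<gamma>\<^sup>2 * (\<zeta> / 4)) < real m" using m1 m'(3) by simp
          then show ?thesis using \<gamma> \<zeta> m' by (simp add: pos_divide_less_eq mult_ac)
        qed
        finally show ?thesis using B(2) \<eta>(3) \<zeta> by linarith
      qed
      finally show "dist (case (m, n) of (m, n) \<Rightarrow> measure M
             {\<omega> \<in> space M.
                norm (reg_op K l F m (dp_alpha K l F \<tau> q yhat \<delta> m n \<omega>) (obs_mean l yhat \<delta> m n \<omega>)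
                      - mp_inverse K yhat) \<ge> \<epsilon>}) 0 < \<zeta>" by simp
    qed
  qed
qed

end
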